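(* Let $(X,d)$ be a compact metric space and consider the random dynamical system $x_n=S(x_{n-1},\eta_{n-1})$ on $X$ described in the context. Suppose that the hypotheses $(\mathbf{I})$ (uniform irreducibility) and $(\mathbf{C})$ (coupling condition for squeezing) stated in the context are satisfied. Then there exists a convex good rate function $I\colon\mathcal{P}(X)\to[0,\infty]$ such that for any Borel set $B\subset\mathcal{P}(X)$, $$-\inf_{\sigma\in B^\circ}I(\sigma)\le\liminf_{n\to\infty}\inf_{\mu\in\mathcal{P}(X)}\frac1n\log\mathbb{P}(L_{n,\mu}\in B)\le\limsup_{n\to\infty}\sup_{\mu\in\mathcal{P}(X)}\frac1n\log\mathbb{P}(L_{n,\mu}\in B)\le-\inf_{\sigma\in\overline{B}}I(\sigma),$$ where $B^\circ$ and $\overline{B}$ are the interior and closure of $B$.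
   Context: Setting. $(X,d)$ and $E$ are compact metric spaces, $\eta_n$ ($n\ge0$) are i.i.d. $E$-valued random variables, and $S\colon X\times E\to X$ is continuous and uniformly Lipschitz in its first argument: there is $C>0$ with $d(S(x,\zeta),S(x',\zeta))\le Cd(x,x')$ for all $x,x'\in X$, $\zeta\in E$. The recursion $x_n=S(x_{n-1},\eta_{n-1})$, $x_0=x\in X$, defines a Feller family of Markov processes $(x_n,\mathbb{P}_x)$ with transition functions $P_n(x,B)=\mathbb{P}_x(x_n\in B)$, and $P=P_1$. Hypotheses. $(\mathbf{I})$ For any $\varepsilon>0$ there exist $N\in\mathbb{N}$ and $p>0$ such that $P_N(x,B(y,\varepsilon))>p$ for any $x,y\in X$, where $B(y,\varepsilon)$ is the open ball. $(\mathbf{C})$ There exist $q\in[0,1)$ and $C>0$ such that for any $x,x'\in X$ the pair $(P(x,\cdot),P(x',\cdot))$ admits a coupling $(R(x,x'),R'(x,x'))$ on a common probability space $(\Omega,\mathcal{F},\mathbb{P})$ (i.e. an $X\times X$-valued random variable with marginal laws $P(x,\cdot)$ and $P(x',\cdot)$) satisfying $\mathbb{P}(d(R(x,x'),R'(x,x'))>q\,d(x,x'))\le Cd(x,x')$; in addition, the maps $R,R'\colon X\times X\times\Omega\to X$ are measurable. Empirical distributions. For $\mu\in\mathcal{P}(X)$, let $x_0$ be a random variable with law $\mu$, independent of $\{\eta_n\}$, and set $L_{n,\mu}=\frac1n\sum_{k=1}^n\delta_{x_k}$. $\mathcal{P}(X)$ is the space of Borel probability measures on $X$ with the weak-* topology.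 A good rate function is a lower semicontinuous function with values in $[0,\infty]$ such that $\{I\le c\}$ is compact for every $c\in[0,\infty)$. Convention: $\inf\emptyset=\infty$. *)

theory Defs
  imports "HOL-Probability.Probability"
begin

section \<open>Borel probability measures with the weak-* topology\<close>

definition prob_measures :: "'a::topological_space measure set" where
  "prob_measures = {\<mu>. sets \<mu> = sets borel \<and> prob_space \<mu>}"

text \<open>The coarsest topology on \<^const>\<open>prob_measures\<close> that makes the integral of every
  continuous function continuous. It is used only for compact spaces, where every continuous
  function is bounded.\<close>

definition weak_star_topology :: "'a::topological_space measure topology" where
  "weak_star_topology = topology_generated_by
     {{\<sigma> \<in> prob_measures. integral\<^sup>L \<sigma> f \<in> U} | (f :: 'a \<Rightarrow> real) U.
        continuous_on UNIV f \<and> open U}"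

lemma topspace_weak_star_topology [simp]: "topspace weak_star_topology = prob_measures"
proof
  show "topspace weak_star_topology \<subseteq> (prob_measures :: 'a measure set)"
    by (auto simp: weak_star_topology_def topology_generated_by_topspace)
  show "(prob_measures :: 'a measure set) \<subseteq> topspace weak_star_topology"
    unfolding weak_star_topology_def topology_generated_by_topspace
  proof
    fix \<mu> :: "'a measure"
    assume "\<mu> \<in> prob_measures"
    moreover have "prob_measures \<in> {{\<sigma> \<in> prob_measures. integral\<^sup>L \<sigma> f \<in> U} | (f :: 'a \<Rightarrow> real) U.
        continuous_on UNIV f \<and> open U}"
      by (rule CollectI, rule exI[of _ "\<lambda>_. 0"], rule exI[of _ UNIV]) auto
    ultimately show "\<mu> \<in> \<Union> {{\<sigma> \<in> prob_measures. integral\<^sup>L \<sigma> f \<in> U} | (f :: 'a \<Rightarrow> real) U.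
        continuous_on UNIV f \<and> open U}"
      by blast
  qed
qed

definition borel_sets_of :: "'b topology \<Rightarrow> 'b set set" where
  "borel_sets_of T = sigma_sets (topspace T) {U. openin T U}"

definition mix_measure ::
    "real \<Rightarrow> 'a::topological_space measure \<Rightarrow> 'a measure \<Rightarrow> 'a measure" where
  "mix_measure t \<sigma> \<tau> = measure_of UNIV (sets borel)
     (\<lambda>A. ennreal t * emeasure \<sigma> A + ennreal (1 - t) * emeasure \<tau> A)"

lemma emeasure_mix_measure:
  assumes "sets \<sigma> = sets borel" "sets \<tau> = sets borel" "A \<in> sets borel"
  shows "emeasure (mix_measure t \<sigma> \<tau>) A
    = ennreal t * emeasure \<sigma> A + ennreal (1 - t) * emeasure \<tau> A"
proof (rule emeasure_measure_of[OF mix_measure_def])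
  show "countably_additive (sets (mix_measure t \<sigma> \<tau>))
     (\<lambda>A. ennreal t * emeasure \<sigma> A + ennreal (1 - t) * emeasure \<tau> A)"
    using assms
    by (auto simp: countably_additive_def mix_measure_def sets.sigma_sets_eq[of borel, simplified]
        suminf_add[symmetric] suminf_emeasure)
qed (use assms in \<open>auto simp: positive_def mix_measure_def
       sets.sigma_sets_eq[of borel, simplified]\<close>)

section \<open>Rate functions\<close>

text \<open>The infimum over the empty set is \<^term>\<open>\<infinity> :: ereal\<close>.\<close>

definition good_rate_function :: "'b topology \<Rightarrow> ('b \<Rightarrow> ereal) \<Rightarrow> bool" where
  "good_rate_function T I \<longleftrightarrow>
     (\<forall>\<sigma> \<in> topspace T. 0 \<le> I \<sigma>) \<and>
     (\<forall>c. openin T {\<sigma> \<in> topspace T. c < I \<sigma>}) \<and>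
     (\<forall>c::real. 0 \<le> c \<longrightarrow> compactin T {\<sigma> \<in> topspace T. I \<sigma> \<le> ereal c})"

definition convex_rate :: "('a::topological_space measure \<Rightarrow> ereal) \<Rightarrow> bool" where
  "convex_rate I \<longleftrightarrow> (\<forall>\<sigma> \<in> prob_measures. \<forall>\<tau> \<in> prob_measures. \<forall>t \<in> {0..1}.
     I (mix_measure t \<sigma> \<tau>) \<le> ereal t * I \<sigma> + ereal (1 - t) * I \<tau>)"

text \<open>The logarithm of a probability, with value \<open>-\<infinity>\<close> at 0.\<close>

definition elog :: "real \<Rightarrow> ereal" where
  "elog p = (if p = 0 then -\<infinity> else ereal (ln p))"

section \<open>The random dynamical system\<close>

text \<open>The compact metric spaces are rendered as types of class \<^class>\<open>polish_space\<close> with compact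
  universe. As compact metric spaces are complete and separable, this is no restriction.\<close>

primrec orbit :: "('a \<Rightarrow> 'e \<Rightarrow> 'a) \<Rightarrow> (nat \<Rightarrow> 'e) \<Rightarrow> 'a \<Rightarrow> nat \<Rightarrow> 'a" where
  "orbit S \<zeta> x 0 = x"
| "orbit S \<zeta> x (Suc n) = S (orbit S \<zeta> x n) (\<zeta> n)"

definition iid_sequence :: "'w measure \<Rightarrow> (nat \<Rightarrow> 'w \<Rightarrow> 'e::topological_space) \<Rightarrow> bool" where
  "iid_sequence M \<eta> \<longleftrightarrow> prob_space M \<and> prob_space.indep_vars M (\<lambda>_. borel) \<eta> UNIV \<and>
     (\<forall>n. distr M borel (\<eta> n) = distr M borel (\<eta> 0))"

definition transition ::
    "'w measure \<Rightarrow> (nat \<Rightarrow> 'w \<Rightarrow> 'e) \<Rightarrow> ('a \<Rightarrow> 'e \<Rightarrow> 'a) \<Rightarrow> nat \<Rightarrow> 'a \<Rightarrow> 'a::topological_space measure"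
  where "transition M \<eta> S n x = distr M borel (\<lambda>\<omega>. orbit S (\<lambda>k. \<eta> k \<omega>) x n)"

definition uniformly_irreducible :: "(nat \<Rightarrow> 'a \<Rightarrow> 'a::metric_space measure) \<Rightarrow> bool" where
  "uniformly_irreducible P \<longleftrightarrow>
     (\<forall>\<epsilon>>0. \<exists>N. \<exists>p>0. \<forall>x y. measure (P N x) (ball y \<epsilon>) > p)"

text \<open>The underlying probability space \<open>Q\<close> of the coupling is an argument, because its type
  cannot be quantified inside a formula; a theorem assuming this predicate for arbitrary \<open>Q\<close>
  assumes precisely the existence of some such space.\<close>

definition squeezing_coupling ::
    "'b measure \<Rightarrow> ('a \<Rightarrow> 'a::metric_space measure) \<Rightarrow> bool" where
  "squeezing_coupling Q P \<longleftrightarrow> prob_space Q \<and>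
     (\<exists>q C R R'. 0 \<le> q \<and> q < 1 \<and> 0 < C \<and>
        (\<lambda>(x, x', \<omega>). R x x' \<omega>) \<in> borel \<Otimes>\<^sub>M borel \<Otimes>\<^sub>M Q \<rightarrow>\<^sub>M borel \<and>
        (\<lambda>(x, x', \<omega>). R' x x' \<omega>) \<in> borel \<Otimes>\<^sub>M borel \<Otimes>\<^sub>M Q \<rightarrow>\<^sub>M borel \<and>
        (\<forall>x x'. distr Q borel (R x x') = P x \<and> distr Q borel (R' x x') = P x' \<and>
           measure Q {\<omega> \<in> space Q. dist (R x x' \<omega>) (R' x x' \<omega>) > q * dist x x'}
             \<le> C * dist x x'))"

section \<open>Empirical distributions\<close>

definition empirical_measure :: "nat \<Rightarrow> (nat \<Rightarrow> 'a) \<Rightarrow> 'a::topological_space measure" where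
  "empirical_measure n y = measure_of UNIV (sets borel)
     (\<lambda>A. (\<Sum>k=1..n. emeasure (return borel (y k)) A) / of_nat n)"

lemma emeasure_empirical_measure:
  assumes "A \<in> sets borel"
  shows "emeasure (empirical_measure n y) A
    = (\<Sum>k=1..n. emeasure (return borel (y k)) A) / of_nat n"
proof (rule emeasure_measure_of[OF empirical_measure_def])
  show "countably_additive (sets (empirical_measure n y))
     (\<lambda>A. (\<Sum>k=1..n. emeasure (return borel (y k)) A) / of_nat n)"
  proof (rule countably_additiveI)
    fix F :: "nat \<Rightarrow> 'a set"
    assume F: "range F \<subseteq> sets (empirical_measure n y)" "disjoint_family F"
    then have F': "range F \<subseteq> sets (return borel (y k))" for k
      by (simp add: empirical_measure_def sets.sigma_sets_eq[of borel, simplified])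
    have "(\<Sum>i. (\<Sum>k=1..n. emeasure (return borel (y k)) (F i)) / of_nat n)
      = (\<Sum>i. (\<Sum>k=1..n. emeasure (return borel (y k)) (F i))) / of_nat n"
      by (rule ennreal_suminf_divide)
    also have "(\<Sum>i. (\<Sum>k=1..n. emeasure (return borel (y k)) (F i)))
      = (\<Sum>k=1..n. (\<Sum>i. emeasure (return borel (y k)) (F i)))"
      by (rule suminf_sum) simp
    also have "\<dots> = (\<Sum>k=1..n. emeasure (return borel (y k)) (\<Union>(range F)))"
      by (rule sum.cong[OF refl]) (rule suminf_emeasure[OF F' F(2)])
    finally show "(\<Sum>i. (\<Sum>k=1..n. emeasure (return borel (y k)) (F i)) / of_nat n)
      = (\<Sum>k=1..n. emeasure (return borel (y k)) (\<Union>(range F))) / of_nat n" .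
  qed
qed (use assms in \<open>auto simp: positive_def empirical_measure_def
       sets.sigma_sets_eq[of borel, simplified]\<close>)

text \<open>The probability that \<open>L\<^bsub>n,\<mu>\<^esub>\<close> lies in \<open>B\<close>. The pair consisting of the initial
  point and the noise lives on the product of \<open>\<mu>\<close> with the probability space carrying the noise,
  so the initial point has law \<open>\<mu>\<close> and is independent of the noise.\<close>

definition empirical_prob ::
    "'w measure \<Rightarrow> (nat \<Rightarrow> 'w \<Rightarrow> 'e) \<Rightarrow> ('a::topological_space \<Rightarrow> 'e \<Rightarrow> 'a) \<Rightarrow>
     nat \<Rightarrow> 'a measure \<Rightarrow> 'a measure set \<Rightarrow> real" where
  "empirical_prob M \<eta> S n \<mu> B =
     measure (\<mu> \<Otimes>\<^sub>M M)
       {(x, \<omega>) \<in> space (\<mu> \<Otimes>\<^sub>M M). empirical_measure n (orbit S (\<lambda>k. \<eta> k \<omega>) x) \<in> B}"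

end

theory Submission
  imports Defs
begin

text \<open>For a Lipschitz potential \<open>V\<close> let \<open>T f x = \<integral>y. exp (V y) * f y \<partial>P x\<close> be the Feynman--Kac operator of the
transition kernel \<open>P\<close>. By the Markov property, \<open>(T ^^ n) (\<lambda>_. 1) x\<close> is the expectation of
\<open>exp (V x\<^sub>1 + \<dots> + V x\<^sub>n)\<close> for the system started at \<open>x\<close> (lemma \<open>feynman_kac_formula\<close>). Let \<open>pressure P V\<close>
be the exponential growth rate of the supremum of these functions. The rate function is the
Legendre transform \<open>\<sigma> \<mapsto> (SUP V. \<integral> V \<partial>\<sigma> - pressure P V)\<close> over Lipschitz potentials. It is convex
and lower semicontinuous, being a supremum of continuous affine functions, and its sublevel sets are compact
because the space of probability measures on a compact metric space is compact
(\<open>compact_weak_star_topology\<close>, from the Riesz representation theorem and Tychonoff). The argument is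
that of the Gaertner--Ellis theorem: the upper bound is the exponential Chebyshev inequality plus
compactness; the lower bound needs that the growth rate does not depend on the starting point and
that the pressure is differentiable.

Both are consequences of the hypotheses as follows. If \<open>f\<close> satisfies
\<open>\<bar>f x - f y\<bar> \<le> dist x y * G y\<close>, then one step of the coupling gives such an estimate for \<open>T f\<close> with \<open>G\<close>
replaced by \<open>q * T G\<close> plus a constant (\<open>gradient_step\<close>): good pairs are contracted, and bad pairs
have probability at most \<open>C * dist x y\<close>. Iterating bounds the Lipschitz constant of \<open>(T ^^ n) (\<lambda>_. 1)\<close> by
\<open>\<Sum>k<n. q ^ k * M k * M (n - 1 - k)\<close> up to a factor, with \<open>M n\<close> the supremum of \<open>(T ^^ n) (\<lambda>_. 1)\<close>. Keeping the function
\<open>G\<close> instead of a number is what makes the estimate work for potentials of arbitrary oscillation: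
the weight \<open>q ^ k\<close> is compared with the subexponential quantity \<open>M k * exp (- k * pressure)\<close>, not with the
exponential of the oscillation. When \<open>M n * exp (- n * pressure)\<close> takes a record value, this makes the normalized
iterate Lipschitz with a constant that does not depend on the record; irreducibility then forces
\<open>(T ^^ (N + n)) (\<lambda>_. 1)\<close> to be bounded below by a multiple of \<open>M n\<close>, and supermultiplicativity shows that the
record was bounded (\<open>growth_bounded\<close>). Hence \<open>(T ^^ n) (\<lambda>_. 1)\<close> is comparable to \<open>exp (n * pressure)\<close>, uniformly
in the starting point, and normalized iterates of Lipschitz functions are equi-Lipschitz
(\<open>normalized_estimates\<close>).

It follows that \<open>T\<close> has a positive Lipschitz eigenfunction \<open>h\<close> (\<open>eigenfunction\<close>), and that the iterates of the
Markov operator \<open>\<psi> \<mapsto> T (h * \<psi>) / h\<close>, normalized by the eigenvalue, flatten every Lipschitz function \<open>W\<close> to a constant \<open>m\<close>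
(\<open>doob_transform_converges\<close>). So \<open>W - m\<close> is, up to a small error, a coboundary \<open>g - P' g\<close> for that Markov operator \<open>P'\<close>,
and \<open>h * exp (t * g)\<close> is an approximate
eigenfunction for the potential \<open>V + t * W\<close>; therefore \<open>m\<close> is the derivative of the pressure in the direction \<open>W\<close>
(\<open>pressure_differentiable\<close>). For the lower bound near a measure \<open>\<sigma>\<close> of finite rate, finitely many Lipschitz test
functions describe the neighbourhood, and a quadratically penalized minimization over the finite-dimensional
space of their combinations yields a tilt under which the averages concentrate close to their
values at \<open>\<sigma>\<close> (\<open>optimal_tilt\<close>).\<close>

section \<open>Riesz representation and compactness of the space of probability measures\<close>

lemma Dini_to_zero:
  fixes f :: "nat \<Rightarrow> 'a::topological_space \<Rightarrow> real"
  assumes comp: "compact (UNIV :: 'a set)" and cont: "\<And>n. continuous_on UNIV (f n)"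
    and dec: "\<And>x. decseq (\<lambda>n. f n x)" and lim: "\<And>x. (\<lambda>n. f n x) \<longlonglongrightarrow> 0" and "\<epsilon> > 0"
  shows "\<exists>n. \<forall>x. f n x < \<epsilon>"
proof -
  have op: "open {x. f n x < \<epsilon>}" for n
    using cont by (intro open_Collect_less) auto
  have cov: "UNIV \<subseteq> (\<Union>n\<in>UNIV. {x. f n x < \<epsilon>})"
  proof
    fix x
    obtain n where "f n x < \<epsilon>"
      using order_tendstoD(2)[OF lim[of x] \<open>\<epsilon> > 0\<close>] by (auto simp: eventually_sequentially)
    then show "x \<in> (\<Union>n\<in>UNIV. {x. f n x < \<epsilon>})" by blast
  qed
  obtain D where D: "finite D" "UNIV \<subseteq> (\<Union>n\<in>D. {x. f n x < \<epsilon>})"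
    using compactE_image[OF comp, of UNIV "\<lambda>n. {x. f n x < \<epsilon>}"] op cov by metis
  have "f (Max (insert 0 D)) x < \<epsilon>" for x
  proof -
    obtain n where n: "n \<in> D" "f n x < \<epsilon>" using D by blast
    then have "n \<le> Max (insert 0 D)" using D by (intro Max_ge) auto
    then have "f (Max (insert 0 D)) x \<le> f n x" using dec by (auto dest: decseqD)
    then show ?thesis using n by simp
  qed
  then show ?thesis by blast
qed

text \<open>Only the values at continuous functions are constrained, so that these functionals form a
  closed subset of a product of lines.\<close>

definition normalized_positive_functional :: "(('a::topological_space \<Rightarrow> real) \<Rightarrow> real) \<Rightarrow> bool" where
  "normalized_positive_functional \<Phi> \<longleftrightarrow>
     (\<forall>f g. continuous_on UNIV f \<longrightarrow> continuous_on UNIV g \<longrightarrow>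
        \<Phi> (\<lambda>x. f x + g x) = \<Phi> f + \<Phi> g) \<and>
     (\<forall>c f. continuous_on UNIV f \<longrightarrow> \<Phi> (\<lambda>x. c * f x) = c * \<Phi> f) \<and>
     (\<forall>f. continuous_on UNIV f \<longrightarrow> (\<forall>x. 0 \<le> f x) \<longrightarrow> 0 \<le> \<Phi> f) \<and>
     \<Phi> (\<lambda>_. 1) = 1"

context
  fixes \<Phi> :: "('a::topological_space \<Rightarrow> real) \<Rightarrow> real"
  assumes npf: "normalized_positive_functional \<Phi>"
begin

lemma npf_add: "continuous_on UNIV f \<Longrightarrow> continuous_on UNIV g \<Longrightarrow> \<Phi> (\<lambda>x. f x + g x) = \<Phi> f + \<Phi> g"
  and npf_scale: "continuous_on UNIV f \<Longrightarrow> \<Phi> (\<lambda>x. c * f x) = c * \<Phi> f"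
  and npf_nonneg: "continuous_on UNIV f \<Longrightarrow> (\<And>x. 0 \<le> f x) \<Longrightarrow> 0 \<le> \<Phi> f"
  and npf_one: "\<Phi> (\<lambda>_. 1) = 1"
  using npf unfolding normalized_positive_functional_def by blast+

lemma npf_const: "\<Phi> (\<lambda>_. c) = c"
  using npf_scale[of "\<lambda>_. 1" c] npf_one by simp

lemma npf_diff:
  assumes "continuous_on UNIV f" "continuous_on UNIV g"
  shows "\<Phi> (\<lambda>x. f x - g x) = \<Phi> f - \<Phi> g"
  using npf_add[of f "\<lambda>x. (-1) * g x"] npf_scale[of g "-1"] assms
  by (simp add: continuous_intros)

lemma npf_mono:
  assumes "continuous_on UNIV f" "continuous_on UNIV g" "\<And>x. f x \<le> g x"
  shows "\<Phi> f \<le> \<Phi> g"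
  using npf_nonneg[of "\<lambda>x. g x - f x"] npf_diff[of g f] assms by (simp add: continuous_intros)

lemma npf_sum:
  assumes "\<And>i. i \<in> I \<Longrightarrow> continuous_on UNIV (f i)" 
  shows "\<Phi> (\<lambda>x. \<Sum>i\<in>I. f i x) = (\<Sum>i\<in>I. \<Phi> (f i))"
  using assms
proof (induction I rule: infinite_finite_induct)
  case (insert i I)
  then show ?case by (simp add: npf_add continuous_on_sum)
qed (simp_all add: npf_const)

lemma npf_bounds:
  assumes "continuous_on UNIV f" "\<And>x. \<bar>f x\<bar> \<le> b"
  shows "\<bar>\<Phi> f\<bar> \<le> b"
proof -
  have "\<Phi> f \<le> b"
    using npf_mono[OF assms(1), of "\<lambda>_. b"] assms(2) by (auto simp: npf_const abs_le_iff)
  moreover have "- b \<le> \<Phi> f"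
    using npf_mono[OF _ assms(1), of "\<lambda>_. -b"] assms(2) npf_const[of "-b"]
    by (simp add: abs_le_iff) (metis minus_le_iff)
  ultimately show ?thesis by linarith
qed

end

text \<open>The representing measure is constructed from the volume of subgraphs: the strip between \<open>f\<close> and
  \<open>g\<close> should have measure \<open>\<Phi> (g - f)\<close>, and in general a set should have the measure \<open>\<Phi>\<close> of the length of
  its vertical sections. Unlike open or compact sets, strips form a semiring on which this content
  is given by a formula.\<close>

definition strip :: "('a \<Rightarrow> real) \<Rightarrow> ('a \<Rightarrow> real) \<Rightarrow> ('a \<times> real) set" where
  "strip f g = {(x, t). f x \<le> t \<and> t < g x}"

definition strips :: "('a::topological_space \<times> real) set set" where
  "strips = {strip f g | f g. continuous_on UNIV f \<and> continuous_on UNIV g}"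

definition section_length :: "('a \<times> real) set \<Rightarrow> 'a \<Rightarrow> real" where
  "section_length A x = measure lborel {t. (x, t) \<in> A}"

lemma strip_section: "{t. (x, t) \<in> strip f g} = {f x..<g x}"
  by (auto simp: strip_def)

lemma section_length_strip: "section_length (strip f g) = (\<lambda>x. max 0 (g x - f x))"
  by (rule ext) (auto simp: section_length_def strip_section max_def)

lemma continuous_section_length:
  "A \<in> strips \<Longrightarrow> continuous_on UNIV (section_length A)"
  unfolding strips_def by (auto simp: section_length_strip intro!: continuous_intros)

text \<open>A difference of strips consists of the points below and the points above the removed strip. The two pieces
  are disjoint only if that strip has its lower boundary below its upper one, hence the function \<open>u\<close>.\<close>

lemma semiring_strips: "semiring_of_sets (UNIV :: ('a::topological_space \<times> real) set) strips"
proof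
  show "strips \<subseteq> Pow (UNIV :: ('a \<times> real) set)" by simp
  show "{} \<in> (strips :: ('a \<times> real) set set)"
    unfolding strips_def strip_def
    by (rule CollectI, rule exI[of _ "\<lambda>_. 0"], rule exI[of _ "\<lambda>_. 0"]) auto
next
  fix a b :: "('a \<times> real) set" assume "a \<in> strips" "b \<in> strips"
  then obtain f g f' g' where *: "a = strip f g" "b = strip f' g'" "continuous_on UNIV f"
    "continuous_on UNIV g" "continuous_on UNIV f'" "continuous_on UNIV g'"
    unfolding strips_def by blast
  have "a \<inter> b = strip (\<lambda>x. max (f x) (f' x)) (\<lambda>x. min (g x) (g' x))"
    unfolding * strip_def by auto
  then show "a \<inter> b \<in> strips"
    unfolding strips_def using * by (auto intro!: exI continuous_intros)
  define u where "u x = max (f' x) (g' x)" for x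
  define A where "A = strip f (\<lambda>x. min (g x) (f' x))"
  define B where "B = strip (\<lambda>x. max (f x) (u x)) g"
  have "A \<in> strips" "B \<in> strips"
    unfolding strips_def A_def B_def u_def using *
    by (auto intro!: exI continuous_intros)
  moreover have "A \<inter> B = {}" "a - b = A \<union> B"
    unfolding A_def B_def strip_def u_def * by auto
  ultimately show "\<exists>C\<subseteq>strips. finite C \<and> disjoint C \<and> a - b = \<Union> C"
    by (intro exI[of _ "{A, B}"]) (auto simp: disjoint_def)
qed

text \<open>In each fibre, countable additivity is that of Lebesgue measure; Dini's theorem makes the convergence
  of the section lengths uniform, so that it passes through \<open>\<Phi>\<close>.\<close>

lemma strips_countably_additive:
  fixes \<Phi> :: "('a::topological_space \<Rightarrow> real) \<Rightarrow> real"
  assumes comp: "compact (UNIV :: 'a set)" and npf: "normalized_positive_functional \<Phi>"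
  shows "countably_additive strips (\<lambda>A. ennreal (\<Phi> (section_length A)))"
proof (rule countably_additiveI)
  fix A :: "nat \<Rightarrow> ('a \<times> real) set"
  assume A: "range A \<subseteq> strips" "disjoint_family A" "\<Union> (range A) \<in> strips"
  note cont = continuous_section_length
  have cA: "continuous_on UNIV (section_length (A i))" for i
    using A cont by blast
  have cU: "continuous_on UNIV (section_length (\<Union>(range A)))"
    using A cont by blast
  have fin: "{t. (x, t) \<in> B} \<in> sets lborel \<and> emeasure lborel {t. (x, t) \<in> B} = ennreal (section_length B x)"
    if "B \<in> strips" for B :: "('a \<times> real) set" and x
  proof -
    obtain f g where "B = strip f g" using \<open>B \<in> strips\<close> unfolding strips_def by blast
    then show ?thesis by (cases "f x \<le> g x") (auto simp: strip_section section_length_def)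
  qed
  have nn: "section_length B x \<ge> 0" for B :: "('a \<times> real) set" and x
    by (simp add: section_length_def)
  have sums: "(\<lambda>i. section_length (A i) x) sums section_length (\<Union>(range A)) x" for x
  proof -
    have "(\<lambda>i. emeasure lborel {t. (x, t) \<in> A i}) sums emeasure lborel (\<Union>i. {t. (x, t) \<in> A i})"
    proof (rule sums_emeasure)
      show "disjoint_family (\<lambda>i. {t. (x, t) \<in> A i})"
        using A(2) by (auto simp: disjoint_family_on_def)
      show "{t. (x, t) \<in> A i} \<in> sets lborel" for i using fin A by blast
    qed
    moreover have "(\<Union>i. {t. (x, t) \<in> A i}) = {t. (x, t) \<in> \<Union>(range A)}" by auto
    moreover have "emeasure lborel {t. (x, t) \<in> A i} = ennreal (section_length (A i) x)" for i
      using fin A(1) by blast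
    moreover have "emeasure lborel {t. (x, t) \<in> \<Union>(range A)} = ennreal (section_length (\<Union>(range A)) x)"
      using fin A(3) by blast
    ultimately have "(\<lambda>i. ennreal (section_length (A i) x)) sums ennreal (section_length (\<Union>(range A)) x)"
      by simp
    then show ?thesis using nn by (simp add: sums_ennreal)
  qed
  define R where "R n x = section_length (\<Union>(range A)) x - (\<Sum>i<n. section_length (A i) x)" for n x
  have Rc: "continuous_on UNIV (R n)" for n
    unfolding R_def using cA cU by (intro continuous_intros) auto
  have Rdec: "decseq (\<lambda>n. R n x)" for x
    by (rule decseq_SucI) (simp add: R_def nn)
  have Rlim: "(\<lambda>n. R n x) \<longlonglongrightarrow> 0" for x
    unfolding R_def using tendsto_diff[OF tendsto_const sums[unfolded sums_def, of x], of "section_length (\<Union>(range A)) x"]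
    by simp
  have R0: "R n x \<ge> 0" for n x
    using Rlim Rdec by (rule decseq_ge[rotated])
  have PhiR: "\<Phi> (R n) = \<Phi> (section_length (\<Union>(range A))) - (\<Sum>i<n. \<Phi> (section_length (A i)))" for n
    unfolding R_def using cA cU
    by (subst npf_diff[OF npf]) (auto intro!: continuous_intros simp: npf_sum[OF npf])
  have "(\<lambda>n. \<Phi> (R n)) \<longlonglongrightarrow> 0"
  proof (rule LIMSEQ_I)
    fix e :: real assume "e > 0"
    then obtain n where n: "\<And>x. R n x < e/2"
      using Dini_to_zero[OF comp Rc Rdec Rlim, of "e/2"] by auto
    have "norm (\<Phi> (R m) - 0) < e" if "m \<ge> n" for m
    proof -
      have "\<bar>\<Phi> (R m)\<bar> \<le> e/2"
      proof (rule npf_bounds[OF npf Rc])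
        show "\<bar>R m x\<bar> \<le> e/2" for x
          using n[of x] R0[of m x] decseqD[OF Rdec[of x] that] by simp
      qed
      then show ?thesis using \<open>e > 0\<close> by simp
    qed
    then show "\<exists>no. \<forall>n\<ge>no. norm (\<Phi> (R n) - 0) < e" by blast
  qed
  then have "(\<lambda>n. \<Phi> (section_length (\<Union>(range A))) - \<Phi> (R n)) \<longlonglongrightarrow> \<Phi> (section_length (\<Union>(range A))) - 0"
    by (intro tendsto_intros)
  then have "(\<lambda>i. \<Phi> (section_length (A i))) sums \<Phi> (section_length (\<Union>(range A)))"
    unfolding sums_def PhiR by simp
  then have "(\<lambda>i. ennreal (\<Phi> (section_length (A i)))) sums ennreal (\<Phi> (section_length (\<Union>(range A))))"
    by (subst sums_ennreal) (auto intro!: npf_nonneg[OF npf] cA cU nn)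
  then show "(\<Sum>i. ennreal (\<Phi> (section_length (A i)))) = ennreal (\<Phi> (section_length (\<Union>(range A))))"
    by (rule sums_unique[symmetric])
qed

lemma tendsto_truncated_multiple:
  fixes a :: real
  assumes "0 \<le> a"
  shows "(\<lambda>n. min 1 (real n * a)) \<longlonglongrightarrow> (if 0 < a then 1 else 0)"
proof (cases "a > 0")
  case True
  then obtain m where m: "real m * a > 1" using reals_Archimedean3 by blast
  have "eventually (\<lambda>n. min 1 (real n * a) = 1) sequentially"
    unfolding eventually_sequentially
  proof (intro exI[of _ m] allI impI)
    fix n assume "m \<le> n"
    then have "real m * a \<le> real n * a" using True by (intro mult_right_mono) auto
    then show "min 1 (real n * a) = 1" using m by simp
  qed
  then show ?thesis using True by (simp add: tendsto_eventually)
qed (use assms in auto)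

text \<open>The measure on \<open>'a \<times> real\<close> obtained from the strips is restricted to \<open>Y\<close>, the part between heights 0
  and 1, and projected to the base. An open set is the set where the distance to its complement is positive,
  and its preimage is a countable union of strips; so the projection is Borel measurable.\<close>

lemma riesz_representation:
  fixes \<Phi> :: "('a::metric_space \<Rightarrow> real) \<Rightarrow> real"
  assumes comp: "compact (UNIV :: 'a set)" and npf: "normalized_positive_functional \<Phi>"
  shows "\<exists>\<mu>\<in>prob_measures. \<forall>f. continuous_on UNIV f \<longrightarrow> integral\<^sup>L \<mu> f = \<Phi> f"
proof -
  interpret semiring_of_sets "UNIV :: ('a \<times> real) set" strips by (rule semiring_strips)
  have "section_length ({} :: ('a \<times> real) set) = (\<lambda>_. 0)"
    by (auto simp: section_length_def)
  then have pos: "positive strips (\<lambda>A. ennreal (\<Phi> (section_length A)))"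
    by (simp add: positive_def npf_const[OF npf])
  obtain \<nu> where nu: "\<And>s. s \<in> strips \<Longrightarrow> \<nu> s = ennreal (\<Phi> (section_length s))"
    "measure_space UNIV (sigma_sets UNIV strips) \<nu>"
    using caratheodory[OF pos strips_countably_additive[OF comp npf]] by blast
  define N where "N = measure_of UNIV strips \<nu>"
  have setsN: "sets N = sigma_sets UNIV strips" and spaceN: "space N = UNIV"
    by (simp_all add: N_def sets_measure_of space_measure_of)
  have eN: "emeasure N A = \<nu> A" if "A \<in> sigma_sets UNIV strips" for A
    using nu(2) that
    by (intro emeasure_measure_of[OF N_def]) (auto simp: measure_space_def setsN)
  have eN_strip: "emeasure N (strip f g) = ennreal (\<Phi> (\<lambda>x. max 0 (g x - f x)))"
    if "continuous_on UNIV f" "continuous_on UNIV g" for f g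
  proof -
    have "strip f g \<in> strips" using that unfolding strips_def by blast
    then show ?thesis using eN nu(1) by (simp add: sigma_sets.Basic section_length_strip)
  qed
  have strip_in: "strip f g \<in> sets N" if "continuous_on UNIV f" "continuous_on UNIV g" for f g
    unfolding setsN using that by (intro sigma_sets.Basic) (auto simp: strips_def)
  define Y where "Y = strip (\<lambda>_::'a. 0::real) (\<lambda>_. 1)"
  have Y: "Y \<in> sets N" unfolding Y_def by (rule strip_in) auto
  have pos_as_union: "({x. 0 < f x} \<times> UNIV) \<inter> Y = (\<Union>n. strip (\<lambda>_. 0) (\<lambda>x. min 1 (real n * max 0 (f x))))" for f :: "'a \<Rightarrow> real"
  proof (intro equalityI subsetI)
    fix z assume "z \<in> ({x. 0 < f x} \<times> UNIV) \<inter> Y"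
    then obtain x t where z: "z = (x, t)" "f x > 0" "0 \<le> t" "t < 1"
      by (auto simp: Y_def strip_def)
    then obtain n where "1 < real n * f x" using reals_Archimedean3 by blast
    then have "z \<in> strip (\<lambda>_. 0) (\<lambda>x. min 1 (real n * max 0 (f x)))"
      using z by (auto simp: strip_def)
    then show "z \<in> (\<Union>n. strip (\<lambda>_. 0) (\<lambda>x. min 1 (real n * max 0 (f x))))" by blast
  next
    fix z assume "z \<in> (\<Union>n. strip (\<lambda>_. 0) (\<lambda>x. min 1 (real n * max 0 (f x))))"
    then obtain n x t where z: "z = (x, t)" "0 \<le> t" "t < min 1 (real n * max 0 (f x))"
      by (auto simp: strip_def)
    then have "real n * max 0 (f x) > 0" by linarith
    then have "f x > 0" by (auto simp: zero_less_mult_iff max_def split: if_splits)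
    then show "z \<in> ({x. 0 < f x} \<times> UNIV) \<inter> Y"
      using z by (auto simp: Y_def strip_def)
  qed
  define N' where "N' = restrict_space N Y"
  have spN': "space N' = Y" using Y by (simp add: N'_def space_restrict_space spaceN)
  have meas: "fst \<in> measurable N' (borel :: 'a measure)"
  proof (rule borel_measurableI)
    fix U :: "'a set" assume U: "open U"
    show "fst -` U \<inter> space N' \<in> sets N'"
    proof (cases "U = UNIV")
      case True
      then show ?thesis using sets.top[of N'] by simp
    next
      case False
      define f where "f x = infdist x (- U)" for x
      have f: "continuous_on UNIV f" unfolding f_def by (intro continuous_intros)
      have cl: "closed (- U)" "- U \<noteq> {}" using False U by auto
      have U_eq: "U = {x. 0 < f x}"
      proof (intro equalityI subsetI)
        fix x assume "x \<in> U"
        then show "x \<in> {x. 0 < f x}" unfolding f_def using infdist_pos_not_in_closed[OF cl] by simp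
      next
        fix x assume "x \<in> {x. 0 < f x}"
        then show "x \<in> U" unfolding f_def using infdist_zero[of x "- U"] by (cases "x \<in> U") auto
      qed
      have "fst -` U \<inter> Y = ({x. 0 < f x} \<times> UNIV) \<inter> Y" using U_eq by auto
      also have "\<dots> \<in> sets N" unfolding pos_as_union using f
        by (intro sets.countable_UN) (auto intro!: strip_in continuous_intros)
      finally show ?thesis
        unfolding N'_def using Y by (auto simp: sets_restrict_space_iff space_restrict_space spaceN)
    qed
  qed
  define \<mu> where "\<mu> = distr N' borel fst"
  have eY: "emeasure N Y = 1"
    unfolding Y_def by (subst eN_strip) (auto simp: npf_const[OF npf])
  have emu: "emeasure \<mu> A = emeasure N ((A \<times> UNIV) \<inter> Y)" if "A \<in> sets borel" for A
  proof -
    have "fst -` A \<inter> space N' = (A \<times> UNIV) \<inter> Y" using spN' by auto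
    moreover have "fst -` A \<inter> space N' \<in> sets N'" using meas that by (rule measurable_sets)
    ultimately show ?thesis
      unfolding \<mu>_def N'_def using Y meas that
      by (subst emeasure_distr) (auto simp: N'_def emeasure_restrict_space spaceN)
  qed
  interpret mu: prob_space \<mu>
  proof
    have "emeasure \<mu> UNIV = 1" using emu[of UNIV] eY by simp
    then show "emeasure \<mu> (space \<mu>) = 1" by (simp add: \<mu>_def)
  qed
  have mu_in: "\<mu> \<in> prob_measures"
    by (simp add: prob_measures_def mu.prob_space_axioms) (simp add: \<mu>_def)
  have sets_mu[measurable_cong]: "sets \<mu> = sets borel" by (simp add: \<mu>_def)
  \<comment> \<open>The truncated multiples of \<open>f\<close> increase to the indicator function of \<open>{x. 0 < f x}\<close>,
    and their subgraphs increase to the part of \<open>Y\<close> above this set.\<close>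
  have mu_pos: "(\<lambda>n. \<Phi> (\<lambda>x. min 1 (real n * max 0 (f x)))) \<longlonglongrightarrow> measure \<mu> {x. 0 < f x}"
    and mu_pos_le: "\<And>n. \<Phi> (\<lambda>x. min 1 (real n * max 0 (f x))) \<le> measure \<mu> {x. 0 < f x}"
    if f: "continuous_on UNIV f" for f
  proof -
    let ?g = "\<lambda>n x. min 1 (real n * max 0 (f x))"
    have c: "continuous_on UNIV (?g n)" for n using f by (intro continuous_intros)
    have inc: "incseq (\<lambda>n. strip (\<lambda>_. 0) (?g n))"
    proof (rule incseq_SucI)
      fix n
      have "?g n x \<le> ?g (Suc n) x" for x
        by (intro min.mono mult_right_mono) auto
      then show "strip (\<lambda>_. 0) (?g n) \<subseteq> strip (\<lambda>_. 0) (?g (Suc n))"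
        unfolding strip_def using less_le_trans by blast
    qed
    have "(\<lambda>n. emeasure N (strip (\<lambda>_. 0) (?g n))) \<longlonglongrightarrow> emeasure N (\<Union>n. strip (\<lambda>_. 0) (?g n))"
      by (rule Lim_emeasure_incseq) (use inc c strip_in in auto)
    moreover have "open {x. 0 < f x}" using f by (intro open_Collect_less) auto
    moreover have "emeasure N (strip (\<lambda>_. 0) (?g n)) = ennreal (\<Phi> (?g n))" for n
      using eN_strip[of "\<lambda>_. 0" "?g n"] c by (simp add: max_absorb2)
    ultimately have *: "(\<lambda>n. ennreal (\<Phi> (?g n))) \<longlonglongrightarrow> ennreal (measure \<mu> {x. 0 < f x})"
      using emu[of "{x. 0 < f x}"] pos_as_union[of f]
      by (simp add: mu.emeasure_eq_measure)
    have nn: "\<Phi> (?g n) \<ge> 0" for n using c by (intro npf_nonneg[OF npf]) auto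
    show lim: "(\<lambda>n. \<Phi> (?g n)) \<longlonglongrightarrow> measure \<mu> {x. 0 < f x}"
      using * nn by (subst (asm) tendsto_ennreal_iff) auto
    have "incseq (\<lambda>n. \<Phi> (?g n))"
      by (intro incseq_SucI npf_mono[OF npf] c min.mono mult_right_mono) auto
    then show "\<Phi> (?g n) \<le> measure \<mu> {x. 0 < f x}" for n using lim by (rule incseq_le)
  qed
  have int: "integrable \<mu> f" if "continuous_on UNIV f" for f :: "'a \<Rightarrow> real"
  proof -
    have "bounded (range f)" using comp that compact_continuous_image compact_imp_bounded by blast
    then obtain b where "\<And>x. \<bar>f x\<bar> \<le> b" by (auto simp: bounded_iff)
    then show ?thesis
      using borel_measurable_continuous_onI[OF that]
      by (intro mu.integrable_const_bound[of _ b]) (auto simp: measurable_cong_sets[OF sets_mu refl])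
  qed
  \<comment> \<open>It suffices to bound integrals from above, since \<open>f\<close> may be replaced by its negative.
    After adding a constant, \<open>g \<ge> 0\<close> is cut into horizontal slices \<open>s k\<close> of height \<open>e\<close>. The slice
    \<open>s (Suc k)\<close> lives on a superlevel set of \<open>g\<close> on which \<open>s k\<close> is full, so the integral of one slice
    is controlled by the functional at the slice below. Shifting by one slice costs only \<open>e\<close>.\<close>
  have upper: "integral\<^sup>L \<mu> f \<le> \<Phi> f" if f: "continuous_on UNIV f" for f
  proof (rule field_le_epsilon)
    fix e :: real assume "e > 0"
    have "bounded (range f)" using comp f compact_continuous_image compact_imp_bounded by blast
    then obtain b where b: "\<And>x. \<bar>f x\<bar> \<le> b" by (auto simp: bounded_iff)
    define g where "g x = f x + b" for x
    have g: "continuous_on UNIV g" unfolding g_def using f by (intro continuous_intros)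
    have g_bounds: "0 \<le> g x \<and> g x \<le> 2 * b" for x
      using b[of x] unfolding g_def by linarith
    note g = g g_bounds[THEN conjunct1] g_bounds[THEN conjunct2]
    obtain m where m: "2 * b < real m * e" using reals_Archimedean3[OF \<open>e > 0\<close>] by blast
    define s where "s k x = min e (max 0 (g x - real k * e))" for k x
    have sc: "continuous_on UNIV (s k)" for k unfolding s_def using g by (intro continuous_intros)
    have s_sum: "(\<Sum>k<n. s k x) = min (real n * e) (g x)" for n x
    proof (induction n)
      case 0 then show ?case using g by simp
    next
      case (Suc n)
      then show ?case using \<open>e > 0\<close> g(2)[of x] by (auto simp: s_def min_def max_def algebra_simps)
    qed
    have g_eq: "g = (\<lambda>x. \<Sum>k<m. s k x)"
    proof
      fix x
      have "g x \<le> real m * e" using g(3)[of x] m by linarith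
      then show "g x = (\<Sum>k<m. s k x)" unfolding s_sum by simp
    qed
    have key: "integral\<^sup>L \<mu> (s (Suc k)) \<le> \<Phi> (s k)" for k
    proof -
      let ?A = "{x. 0 < g x - real (Suc k) * e}"
      have A: "?A \<in> sets borel" 
        using g by (intro borel_open open_Collect_less continuous_intros) auto
      have "integral\<^sup>L \<mu> (s (Suc k)) \<le> (\<integral>x. e * indicator ?A x \<partial>\<mu>)"
      proof (rule integral_mono)
        show "integrable \<mu> (s (Suc k))" by (intro int sc)
        show "integrable \<mu> (\<lambda>x. e * indicator ?A x)"
          using A by (intro integrable_mult_right integrable_real_indicator)
            (auto simp: sets_mu mu.emeasure_eq_measure)
        show "s (Suc k) x \<le> e * indicator ?A x" for x
          using \<open>e > 0\<close> by (cases "x \<in> ?A") (auto simp: s_def)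
      qed
      also have "\<dots> = e * measure \<mu> ?A" using A by (simp add: sets_mu)
      also have "\<dots> \<le> \<Phi> (s k)"
      proof (rule LIMSEQ_le_const2)
        show "(\<lambda>n. e * \<Phi> (\<lambda>x. min 1 (real n * max 0 (g x - real (Suc k) * e)))) \<longlonglongrightarrow> e * measure \<mu> ?A"
          using g by (intro tendsto_intros mu_pos continuous_intros)
        have "e * \<Phi> (\<lambda>x. min 1 (real n * max 0 (g x - real (Suc k) * e))) \<le> \<Phi> (s k)" for n
        proof -
          have "e * \<Phi> (\<lambda>x. min 1 (real n * max 0 (g x - real (Suc k) * e)))
            = \<Phi> (\<lambda>x. e * min 1 (real n * max 0 (g x - real (Suc k) * e)))"
            using g by (intro npf_scale[OF npf, symmetric] continuous_intros)
          also have "\<dots> \<le> \<Phi> (s k)"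
          proof (rule npf_mono[OF npf _ sc])
            show "continuous_on UNIV (\<lambda>x. e * min 1 (real n * max 0 (g x - real (Suc k) * e)))"
              using g by (intro continuous_intros)
            fix x
            show "e * min 1 (real n * max 0 (g x - real (Suc k) * e)) \<le> s k x"
            proof (cases "g x - real (Suc k) * e \<le> 0")
              case True
              then show ?thesis using \<open>e > 0\<close> by (simp add: s_def max_absorb1)
            next
              case False
              then have "s k x = e" using \<open>e > 0\<close> by (auto simp: s_def algebra_simps)
              then show ?thesis using \<open>e > 0\<close> by (simp add: mult_le_cancel_left1)
            qed
          qed
          finally show ?thesis .
        qed
        then show "\<exists>N. \<forall>n\<ge>N. e * \<Phi> (\<lambda>x. min 1 (real n * max 0 (g x - real (Suc k) * e))) \<le> \<Phi> (s k)"
          by blast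
      qed
      finally show ?thesis .
    qed
    have "integral\<^sup>L \<mu> g \<le> (\<integral>x. e + (\<Sum>k<m. s (Suc k) x) \<partial>\<mu>)"
    proof (rule integral_mono)
      show "integrable \<mu> g" "integrable \<mu> (\<lambda>x. e + (\<Sum>k<m. s (Suc k) x))"
        by (auto intro!: int continuous_intros g sc)
      fix x
      have "e + (\<Sum>k<m. s (Suc k) x) = e - s 0 x + (\<Sum>k<Suc m. s k x)"
        by (subst sum.lessThan_Suc_shift) simp
      also have "\<dots> \<ge> (\<Sum>k<Suc m. s k x)" using \<open>e > 0\<close> by (simp add: s_def)
      also have "(\<Sum>k<Suc m. s k x) \<ge> (\<Sum>k<m. s k x)" using \<open>e > 0\<close> by (simp add: s_def)
      finally show "g x \<le> e + (\<Sum>k<m. s (Suc k) x)" using fun_cong[OF g_eq, of x] by simp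
    qed
    also have "\<dots> = e + (\<Sum>k<m. integral\<^sup>L \<mu> (s (Suc k)))"
      using mu.prob_space by (simp add: int sc continuous_on_sum Bochner_Integration.integral_add Bochner_Integration.integral_sum)
    also have "\<dots> \<le> e + (\<Sum>k<m. \<Phi> (s k))" using key by (intro add_left_mono sum_mono) auto
    also have "(\<Sum>k<m. \<Phi> (s k)) = \<Phi> g" 
      using npf_sum[OF npf, of "{..<m}" s] sc g_eq by simp
    finally have "integral\<^sup>L \<mu> g \<le> \<Phi> g + e" by simp
    moreover have "\<Phi> g = \<Phi> f + b" unfolding g_def using f by (simp add: npf_add[OF npf] npf_const[OF npf])
    moreover have "integral\<^sup>L \<mu> g = integral\<^sup>L \<mu> f + b"
      unfolding g_def using int[OF f] mu.prob_space by simp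
    ultimately show "integral\<^sup>L \<mu> f \<le> \<Phi> f + e" by simp
  qed
  have "integral\<^sup>L \<mu> f = \<Phi> f" if f: "continuous_on UNIV f" for f
  proof (rule antisym)
    show "integral\<^sup>L \<mu> f \<le> \<Phi> f" using upper f .
    have "integral\<^sup>L \<mu> (\<lambda>x. (-1) * f x) \<le> \<Phi> (\<lambda>x. (-1) * f x)"
      using f by (intro upper continuous_intros)
    moreover have "\<Phi> (\<lambda>x. (-1) * f x) = - \<Phi> f" using npf_scale[OF npf f, of "-1"] by simp
    ultimately show "\<Phi> f \<le> integral\<^sup>L \<mu> f" by simp
  qed
  then show ?thesis using mu_in by blast
qed

lemma continuous_bounded:
  fixes f :: "'a::topological_space \<Rightarrow> real"
  assumes "compact (UNIV :: 'a set)" "continuous_on UNIV f"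
  obtains b where "\<And>x. \<bar>f x\<bar> \<le> b" "0 \<le> b"
proof -
  have "bounded (range f)" using assms compact_continuous_image compact_imp_bounded by blast
  then obtain b where "\<And>x. \<bar>f x\<bar> \<le> b" by (auto simp: bounded_iff)
  then show ?thesis using that[of b] by (metis abs_ge_zero order_trans)
qed

lemma prob_measuresD:
  assumes "\<mu> \<in> prob_measures"
  shows "prob_space \<mu>" "sets \<mu> = sets borel" "space \<mu> = UNIV" "borel_measurable \<mu> = borel_measurable borel"
  using assms sets_eq_imp_space_eq[of \<mu> borel] measurable_cong_sets[of \<mu> borel borel borel]
  by (auto simp: prob_measures_def)

lemma integrable_continuous:
  fixes f :: "'a::topological_space \<Rightarrow> real"
  assumes "compact (UNIV :: 'a set)" "\<mu> \<in> prob_measures" "continuous_on UNIV f"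
  shows "integrable \<mu> f"
proof -
  interpret prob_space \<mu> using assms prob_measuresD by blast
  obtain b where "\<And>x. \<bar>f x\<bar> \<le> b" using continuous_bounded assms by blast
  then show ?thesis
    using borel_measurable_continuous_onI[OF assms(3)]
    by (intro integrable_const_bound[of _ b]) (auto simp: prob_measuresD[OF assms(2)])
qed

text \<open>The indicator function of an open set is an increasing limit of continuous functions, and open sets
  generate the Borel sets.\<close>

lemma prob_measures_eqI:
  fixes \<mu> \<nu> :: "'a::metric_space measure"
  assumes comp: "compact (UNIV :: 'a set)" and mu: "\<mu> \<in> prob_measures" and nu: "\<nu> \<in> prob_measures"
    and eq: "\<And>f :: 'a \<Rightarrow> real. continuous_on UNIV f \<Longrightarrow> integral\<^sup>L \<mu> f = integral\<^sup>L \<nu> f"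
  shows "\<mu> = \<nu>"
proof (rule measure_eqI_generator_eq)
  note m = prob_measuresD[OF mu] and n = prob_measuresD[OF nu]
  interpret m: prob_space \<mu> by (rule m)
  interpret n: prob_space \<nu> by (rule n)
  show "Int_stable (Collect open :: 'a set set)" by (auto simp: Int_stable_def)
  show "Collect open \<subseteq> Pow (UNIV :: 'a set)" by simp
  show "sets \<mu> = sigma_sets UNIV (Collect open)" "sets \<nu> = sigma_sets UNIV (Collect open)"
    using m n by (simp_all add: borel_def)
  show "range (\<lambda>_::nat. UNIV :: 'a set) \<subseteq> Collect open" "(\<Union>i::nat. UNIV) = (UNIV :: 'a set)" 
    "emeasure \<mu> UNIV \<noteq> \<infinity>" by auto
  fix U :: "'a set" assume "U \<in> Collect open"
  then have U: "open U" by simp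
  show "emeasure \<mu> U = emeasure \<nu> U"
  proof (cases "U = UNIV")
    case True
    then show ?thesis using m.emeasure_space_1 n.emeasure_space_1 m n by simp
  next
    case False
    then have cl: "closed (- U)" "- U \<noteq> {}" using U by auto
    define g where "g k x = min 1 (real k * infdist x (- U))" for k x
    have gc: "continuous_on UNIV (g k)" for k unfolding g_def by (intro continuous_intros)
    have ind: "(if 0 < infdist x (- U) then 1 else 0) = (indicator U x :: real)" for x
      using infdist_pos_not_in_closed[OF cl, of x] infdist_zero[of x "- U"]
      by (cases "x \<in> U") auto
    have lim: "(\<lambda>k. integral\<^sup>L \<rho> (g k)) \<longlonglongrightarrow> measure \<rho> U" if r: "\<rho> \<in> prob_measures" for \<rho>
    proof -
      interpret r: prob_space \<rho> using r prob_measuresD by blast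
      have "(\<lambda>k. integral\<^sup>L \<rho> (g k)) \<longlonglongrightarrow> integral\<^sup>L \<rho> (indicator U)"
      proof (rule integral_dominated_convergence[where w="\<lambda>_. 1"])
        show "AE x in \<rho>. (\<lambda>k. g k x) \<longlonglongrightarrow> indicator U x"
          unfolding g_def using tendsto_truncated_multiple[OF infdist_nonneg, of _ "- U"] ind by simp
        show "g k \<in> borel_measurable \<rho>" for k
          using borel_measurable_continuous_onI[OF gc] by (simp add: prob_measuresD[OF r])
        show "indicator U \<in> borel_measurable \<rho>" using U by (simp add: prob_measuresD[OF r])
        show "AE x in \<rho>. norm (g k x) \<le> 1" for k
          by (auto simp: g_def infdist_nonneg)
      qed auto
      then show ?thesis using U by (simp add: prob_measuresD[OF r])
    qed
    have "measure \<mu> U = measure \<nu> U"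
      by (rule LIMSEQ_unique[OF lim[OF mu]]) (simp add: eq[OF gc] lim[OF nu])
    then show ?thesis by (simp add: m.emeasure_eq_measure n.emeasure_eq_measure)
  qed
qed

text \<open>The normalized positive functionals form a closed subset of a product of compact intervals, indexed
  by the continuous functions. By Riesz representation the space of probability measures is a continuous image of that set.\<close>

theorem compact_weak_star_topology:
  assumes comp: "compact (UNIV :: 'a::metric_space set)"
  shows "compact_space (weak_star_topology :: 'a measure topology)"
proof -
  define b where "b f = (SOME b. \<forall>x::'a. \<bar>f x\<bar> \<le> b)" for f :: "'a \<Rightarrow> real"
  have b: "\<bar>f x\<bar> \<le> b f" if "continuous_on UNIV f" for f x
  proof -
    have "\<exists>b. \<forall>x. \<bar>f x\<bar> \<le> b" using continuous_bounded[OF comp that] by metis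
    then show ?thesis unfolding b_def by (rule someI2_ex) blast
  qed
  \<comment> \<open>At discontinuous functions the value is fixed to be 0, to keep the product compact.\<close>
  define K where "K = PiE UNIV (\<lambda>f::'a\<Rightarrow>real. if continuous_on UNIV f then {- b f..b f} else {0})"
  have "compactin (product_topology (\<lambda>_. euclidean) UNIV) K"
    unfolding K_def by (subst compactin_PiE) auto
  then have K: "compact K" by (simp add: euclidean_product_topology)
  define S where "S = K \<inter> Collect normalized_positive_functional"
  have ev: "continuous_on UNIV (\<lambda>\<Phi>::('a\<Rightarrow>real)\<Rightarrow>real. \<Phi> f)" for f
    by (rule continuous_on_product_coordinates)
  have "closed (Collect (normalized_positive_functional :: (('a\<Rightarrow>real)\<Rightarrow>real) \<Rightarrow> bool))"
    unfolding normalized_positive_functional_def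
    by (intro closed_Collect_conj closed_Collect_all closed_Collect_imp open_Collect_const 
        closed_Collect_eq closed_Collect_le continuous_intros ev)
  then have S: "compact S" unfolding S_def using compact_Int_closed[OF K] by blast
  define T where "T \<Phi> = (SOME \<mu>. \<mu> \<in> prob_measures \<and> (\<forall>f. continuous_on UNIV f \<longrightarrow> integral\<^sup>L \<mu> f = \<Phi> f))"
    for \<Phi> :: "('a\<Rightarrow>real)\<Rightarrow>real"
  have T: "T \<Phi> \<in> prob_measures \<and> (\<forall>f. continuous_on UNIV f \<longrightarrow> integral\<^sup>L (T \<Phi>) f = \<Phi> f)"
    if "\<Phi> \<in> S" for \<Phi>
    unfolding T_def using riesz_representation[OF comp, of \<Phi>] that
    by (intro someI_ex[where P="\<lambda>\<mu>. \<mu> \<in> prob_measures \<and> (\<forall>f. continuous_on UNIV f \<longrightarrow> integral\<^sup>L \<mu> f = \<Phi> f)"])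
      (auto simp: S_def)
  have "continuous_map (top_of_set S) weak_star_topology T"
    unfolding weak_star_topology_def
  proof (rule continuous_on_generated_topo)
    fix W assume "W \<in> {{\<sigma> \<in> prob_measures. integral\<^sup>L \<sigma> f \<in> U} | (f :: 'a \<Rightarrow> real) U.
        continuous_on UNIV f \<and> open U}"
    then obtain f :: "'a \<Rightarrow> real" and U where W: "W = {\<sigma> \<in> prob_measures. integral\<^sup>L \<sigma> f \<in> U}" "continuous_on UNIV f" "open U"
      by blast
    have "T -` W \<inter> topspace (top_of_set S) = S \<inter> (\<lambda>\<Phi>. \<Phi> f) -` U"
      using T W by auto
    moreover have "openin (top_of_set S) \<dots>"
      using continuous_openin_preimage_gen[OF continuous_on_subset[OF ev] \<open>open U\<close>] by auto
    ultimately show "openin (top_of_set S) (T -` W \<inter> topspace (top_of_set S))" by simp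
  next
    have "T ` S \<subseteq> topspace weak_star_topology" using T by auto
    then show "T ` topspace (top_of_set S) \<subseteq> \<Union> {{\<sigma> \<in> prob_measures. integral\<^sup>L \<sigma> f \<in> U} | (f :: 'a \<Rightarrow> real) U.
        continuous_on UNIV f \<and> open U}"
      unfolding weak_star_topology_def topology_generated_by_topspace by simp
  qed
  moreover have "compactin (top_of_set S) S" using S by (simp add: compactin_subtopology)
  ultimately have "compactin weak_star_topology (T ` S)" by (rule image_compactin[rotated])
  moreover have "T ` S = prob_measures"
  proof (intro equalityI subsetI)
    fix \<sigma> :: "'a measure" assume s: "\<sigma> \<in> prob_measures"
    interpret prob_space \<sigma> using s prob_measuresD by blast
    note int = integrable_continuous[OF comp s]
    define \<Phi> where "\<Phi> f = (if continuous_on UNIV f then integral\<^sup>L \<sigma> f else 0)" for f :: "'a \<Rightarrow> real"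
    have "normalized_positive_functional \<Phi>"
      unfolding normalized_positive_functional_def \<Phi>_def
      using int by (auto simp: continuous_intros prob_space)
    moreover have "\<Phi> \<in> K"
    proof -
      have "\<bar>integral\<^sup>L \<sigma> f\<bar> \<le> b f" if "continuous_on UNIV f" for f
      proof -
        have "\<bar>integral\<^sup>L \<sigma> f\<bar> \<le> (\<integral>x. \<bar>f x\<bar> \<partial>\<sigma>)" by (rule integral_abs_bound)
        also have "\<dots> \<le> (\<integral>x. b f \<partial>\<sigma>)" using int that b by (intro integral_mono) auto
        finally show ?thesis by (simp add: prob_space)
      qed
      then show ?thesis unfolding K_def \<Phi>_def by (fastforce simp: abs_le_iff)
    qed
    ultimately have "\<Phi> \<in> S" by (simp add: S_def)
    moreover from T[OF this] have "T \<Phi> = \<sigma>"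
      by (intro prob_measures_eqI[OF comp _ s]) (auto simp: \<Phi>_def)
    ultimately show "\<sigma> \<in> T ` S" by blast
  qed (use T in auto)
  ultimately show ?thesis by (simp add: compact_space_def)
qed

section \<open>Integrals against mixtures and empirical measures\<close>

lemma nn_integral_finite_combination:
  fixes \<mu> :: "'a::topological_space measure" and N :: "'i \<Rightarrow> 'a measure"
  assumes sets: "sets \<mu> = sets borel" "\<And>i. i \<in> I \<Longrightarrow> sets (N i) = sets borel"
    and em: "\<And>A. A \<in> sets borel \<Longrightarrow> emeasure \<mu> A = (\<Sum>i\<in>I. c i * emeasure (N i) A)"
    and f: "f \<in> borel_measurable borel"
  shows "integral\<^sup>N \<mu> f = (\<Sum>i\<in>I. c i * integral\<^sup>N (N i) f)"
proof -
  note M = measurable_cong_sets[OF sets(1) refl] measurable_cong_sets[OF sets(2) refl]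
  show ?thesis using f
  proof (induction rule: borel_measurable_induct)
    case (cong f g)
    then have "f = g" by auto
    then show ?case using cong by simp
  next
    case (set A)
    then show ?case using em sets by simp
  next
    case (mult u v)
    then show ?case
      by (simp add: M nn_integral_cmult sum_distrib_left mult.left_commute cong: sum.cong)
  next
    case (add u v)
    then show ?case
      by (simp add: M nn_integral_add sum.distrib distrib_left cong: sum.cong)
  next
    case (seq U)
    have "integral\<^sup>N \<mu> (SUP i. U i) = (SUP i. integral\<^sup>N \<mu> (U i))"
      using seq(1,3) by (simp add: SUP_apply[abs_def] M nn_integral_monotone_convergence_SUP)
    also have "\<dots> = (SUP j. \<Sum>i\<in>I. c i * integral\<^sup>N (N i) (U j))" using seq by simp
    also have "\<dots> = (\<Sum>i\<in>I. SUP j. c i * integral\<^sup>N (N i) (U j))"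
    proof (rule ennreal_SUP_sum)
      show "incseq (\<lambda>j. c i * integral\<^sup>N (N i) (U j))" for i
      proof (rule incseq_SucI)
        show "c i * integral\<^sup>N (N i) (U j) \<le> c i * integral\<^sup>N (N i) (U (Suc j))" for j
          using incseq_SucD[OF seq(3), of j] by (intro mult_left_mono nn_integral_mono) (auto simp: le_fun_def)
      qed
    qed
    also have "\<dots> = (\<Sum>i\<in>I. c i * integral\<^sup>N (N i) (SUP j. U j))"
      using seq by (intro sum.cong refl)
        (simp add: SUP_apply[abs_def] M nn_integral_monotone_convergence_SUP SUP_mult_left_ennreal)
    finally show ?case .
  qed
qed

text \<open>Adding a constant makes the integrand nonnegative, which reduces the claim to the integral of nonnegative functions;
  the normalizations \<open>sum c I = 1\<close> and of the measures make the constants match.\<close>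

lemma integral_finite_combination:
  fixes \<mu> :: "'a::topological_space measure" and N :: "'i \<Rightarrow> 'a measure" and f :: "'a \<Rightarrow> real"
  assumes comp: "compact (UNIV :: 'a set)"
    and mu: "\<mu> \<in> prob_measures" and N: "\<And>i. i \<in> I \<Longrightarrow> N i \<in> prob_measures"
    and c: "\<And>i. i \<in> I \<Longrightarrow> 0 \<le> c i" and fin: "finite I" and c1: "(\<Sum>i\<in>I. c i) = 1"
    and em: "\<And>A. A \<in> sets borel \<Longrightarrow> emeasure \<mu> A = (\<Sum>i\<in>I. ennreal (c i) * emeasure (N i) A)"
    and f: "continuous_on UNIV f"
  shows "integral\<^sup>L \<mu> f = (\<Sum>i\<in>I. c i * integral\<^sup>L (N i) f)"
proof -
  obtain b where b: "\<And>x. \<bar>f x\<bar> \<le> b" using continuous_bounded[OF comp f] by blast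
  define g where "g x = f x + b" for x
  have g: "continuous_on UNIV g" "\<And>x. 0 \<le> g x"
  proof -
    show "continuous_on UNIV g" unfolding g_def using f by (intro continuous_intros)
    show "0 \<le> g x" for x using b[of x] unfolding g_def by linarith
  qed
  have eq: "integral\<^sup>N \<rho> (\<lambda>x. ennreal (g x)) = ennreal (integral\<^sup>L \<rho> g) \<and> integral\<^sup>L \<rho> g = integral\<^sup>L \<rho> f + b
      \<and> 0 \<le> integral\<^sup>L \<rho> g"
    if r: "\<rho> \<in> prob_measures" for \<rho>
  proof -
    interpret r: prob_space \<rho> using r prob_measuresD by blast
    show ?thesis
      using integrable_continuous[OF comp r f] integrable_continuous[OF comp r g(1)] g(2)
      by (auto simp: nn_integral_eq_integral) (simp add: g_def[abs_def] r.prob_space)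
  qed
  have nn: "0 \<le> c i * integral\<^sup>L (N i) g" if "i \<in> I" for i
    using eq[OF N[OF that]] c[OF that] by (intro mult_nonneg_nonneg) blast+
  have "ennreal (integral\<^sup>L \<mu> g) = (\<Sum>i\<in>I. ennreal (c i) * integral\<^sup>N (N i) (\<lambda>x. ennreal (g x)))"
    using eq[OF mu] nn_integral_finite_combination[OF prob_measuresD(2)[OF mu] prob_measuresD(2)[OF N] em, of "\<lambda>x. ennreal (g x)"]
      borel_measurable_continuous_onI[OF g(1)] by simp
  also have "\<dots> = (\<Sum>i\<in>I. ennreal (c i * integral\<^sup>L (N i) g))"
  proof (intro sum.cong refl)
    fix i assume "i \<in> I"
    then have "N i \<in> prob_measures" "0 \<le> c i" using N c by auto
    note * = eq[OF this(1)] this(2)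
    show "ennreal (c i) * integral\<^sup>N (N i) (\<lambda>x. ennreal (g x)) = ennreal (c i * integral\<^sup>L (N i) g)"
      using * by (simp add: ennreal_mult)
  qed
  also have "\<dots> = ennreal (\<Sum>i\<in>I. c i * integral\<^sup>L (N i) g)"
    by (intro sum_ennreal nn)
  finally have "integral\<^sup>L \<mu> g = (\<Sum>i\<in>I. c i * integral\<^sup>L (N i) g)"
    using eq[OF mu] by (subst (asm) ennreal_inj) (auto intro!: sum_nonneg nn)
  also have "\<dots> = (\<Sum>i\<in>I. c i * integral\<^sup>L (N i) f + c i * b)"
    using eq[OF N] by (intro sum.cong) (auto simp: distrib_left)
  also have "\<dots> = (\<Sum>i\<in>I. c i * integral\<^sup>L (N i) f) + b"
    by (simp add: sum.distrib c1 flip: sum_distrib_right)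
  finally show ?thesis using eq[OF mu] by simp
qed

lemma mix_measure_in_prob_measures:
  assumes "\<sigma> \<in> prob_measures" "\<tau> \<in> prob_measures" "t \<in> {0..1}"
  shows "mix_measure t \<sigma> \<tau> \<in> prob_measures"
proof -
  have s: "sets (mix_measure t \<sigma> \<tau>) = sets borel"
    by (simp add: mix_measure_def sets.sigma_sets_eq[of borel, simplified])
  have "emeasure (mix_measure t \<sigma> \<tau>) UNIV = ennreal t * 1 + ennreal (1 - t) * 1"
    using prob_measuresD[OF assms(1)] prob_measuresD[OF assms(2)]
      prob_space.emeasure_space_1[of \<sigma>] prob_space.emeasure_space_1[of \<tau>]
    by (subst emeasure_mix_measure) auto
  also have "\<dots> = 1" using assms(3) by (simp flip: ennreal_plus)
  finally have "prob_space (mix_measure t \<sigma> \<tau>)"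
    using sets_eq_imp_space_eq[OF s] by (intro prob_spaceI) simp
  then show ?thesis using s by (simp add: prob_measures_def)
qed

lemma integral_mix_measure:
  fixes f :: "'a::topological_space \<Rightarrow> real"
  assumes "compact (UNIV :: 'a set)" "\<sigma> \<in> prob_measures" "\<tau> \<in> prob_measures" "t \<in> {0..1}"
    "continuous_on UNIV f"
  shows "integral\<^sup>L (mix_measure t \<sigma> \<tau>) f = t * integral\<^sup>L \<sigma> f + (1 - t) * integral\<^sup>L \<tau> f"
  using integral_finite_combination[OF assms(1) mix_measure_in_prob_measures[OF assms(2-4)],
      of UNIV "\<lambda>b. if b then \<sigma> else \<tau>" "\<lambda>b. if b then t else 1 - t" f] assms
  by (simp add: UNIV_bool emeasure_mix_measure prob_measuresD add.commute)

lemma empirical_measure_in_prob_measures: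
  assumes "n > 0"
  shows "empirical_measure n y \<in> prob_measures"
proof -
  have s: "sets (empirical_measure n y) = sets borel"
    by (simp add: empirical_measure_def sets.sigma_sets_eq[of borel, simplified])
  have "emeasure (empirical_measure n y) UNIV = of_nat n / of_nat n"
    by (subst emeasure_empirical_measure) auto
  also have "\<dots> = 1" using assms by (intro ennreal_divide_self) (auto simp: of_nat_less_top)
  finally have "prob_space (empirical_measure n y)"
    using sets_eq_imp_space_eq[OF s] by (intro prob_spaceI) simp
  then show ?thesis using s by (simp add: prob_measures_def)
qed

lemma integral_empirical_measure:
  fixes f :: "'a::t2_space \<Rightarrow> real"
  assumes comp: "compact (UNIV :: 'a set)" and n: "n > 0" and f: "continuous_on UNIV f"
  shows "integral\<^sup>L (empirical_measure n y) f = (\<Sum>k=1..n. f (y k)) / real n"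
proof -
  have r: "return borel (y k) \<in> prob_measures" for k
    by (simp add: prob_measures_def prob_space_return)
  have "integral\<^sup>L (empirical_measure n y) f = (\<Sum>k=1..n. (1 / real n) * integral\<^sup>L (return borel (y k)) f)"
  proof (rule integral_finite_combination[OF comp empirical_measure_in_prob_measures[OF n] r])
    fix A :: "'a set" assume A: "A \<in> sets borel"
    have "ennreal (1 / real n) = 1 / of_nat n"
      using n by (subst divide_ennreal[symmetric]) (auto simp: ennreal_of_nat_eq_real_of_nat)
    then show "emeasure (empirical_measure n y) A = (\<Sum>k=1..n. ennreal (1 / real n) * emeasure (return borel (y k)) A)"
      using A by (simp add: emeasure_empirical_measure sum_distrib_left[symmetric] ennreal_times_divide mult.commute
          divide_ennreal_def)
  qed (use n f in auto)
  also have "\<dots> = (\<Sum>k=1..n. (1 / real n) * f (y k))"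
    using borel_measurable_continuous_onI[OF f] by (intro sum.cong refl) (subst integral_return, auto)
  finally show ?thesis by (simp add: sum_divide_distrib)
qed

section \<open>Feynman--Kac operators\<close>

lemma lipschitz_imp_continuous:
  fixes f :: "'a::metric_space \<Rightarrow> real"
  assumes "\<And>x y. \<bar>f x - f y\<bar> \<le> l * dist x y" "0 \<le> l"
  shows "continuous_on UNIV f"
proof -
  have "l-lipschitz_on UNIV f" using assms by (auto simp: lipschitz_on_def dist_real_def)
  then show ?thesis by (rule lipschitz_on_continuous_on)
qed

lemma exp_le_quadratic:
  fixes u :: real
  assumes "\<bar>u\<bar> \<le> 1"
  shows "exp u \<le> 1 + u + u\<^sup>2"
proof (cases "0 \<le> u")
  case True
  then show ?thesis using exp_bound[of u] assms by simp
next
  case False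
  have "1 - u + u\<^sup>2 / 2 \<le> exp (- u)"
    using exp_lower_Taylor_quadratic[of "-u"] False by simp
  moreover have "1 \<le> (1 + u + u\<^sup>2) * (1 - u + u\<^sup>2 / 2)"
  proof -
    have "(1 + u + u\<^sup>2) * (1 - u + u\<^sup>2 / 2) = 1 + u\<^sup>2 * (1 / 2 - u / 2 + u\<^sup>2 / 2)"
      by (simp add: field_simps power2_eq_square)
    moreover have "0 \<le> 1 / 2 - u / 2 + u\<^sup>2 / 2" using False by simp
    ultimately show ?thesis by simp
  qed
  moreover have "0 \<le> 1 + u + u\<^sup>2" using assms by (simp add: abs_le_iff)
  ultimately have "1 \<le> (1 + u + u\<^sup>2) * exp (- u)"
    by (meson mult_left_mono order_trans)
  then show ?thesis by (simp add: exp_minus field_simps)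
qed


definition feynman_kac ::
    "('a \<Rightarrow> 'a measure) \<Rightarrow> ('a \<Rightarrow> real) \<Rightarrow> ('a \<Rightarrow> real) \<Rightarrow> 'a \<Rightarrow> real" where
  "feynman_kac P V f x = (\<integral>y. exp (V y) * f y \<partial>P x)"

definition growth :: "('a \<Rightarrow> 'a measure) \<Rightarrow> ('a \<Rightarrow> real) \<Rightarrow> nat \<Rightarrow> real" where
  "growth P V n = (SUP x. (feynman_kac P V ^^ n) (\<lambda>_. 1) x)"

text \<open>By subadditivity of \<open>ln (growth P V n)\<close>, this infimum is the limit of \<open>ln (growth P V n) / n\<close>.\<close>

definition pressure :: "('a \<Rightarrow> 'a measure) \<Rightarrow> ('a \<Rightarrow> real) \<Rightarrow> real" where
  "pressure P V = (INF n\<in>{1..}. ln (growth P V n) / real n)"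

text \<open>The coupling is recorded through its law on \<open>'a \<times> 'a\<close>. Irreducibility is stated for the iterates
  of the operator with potential 0, applied to a nonnegative continuous function that is at least \<open>a\<close> on a ball;
  in this form it passes directly to other potentials.\<close>

locale squeezing_kernel =
  fixes P :: "'a::metric_space \<Rightarrow> 'a measure" and q C :: real
  assumes compact_UNIV: "compact (UNIV :: 'a set)"
    and kernel: "P x \<in> prob_measures"
    and feller: "continuous_on UNIV f \<Longrightarrow> continuous_on UNIV (\<lambda>x. \<integral>y. f y \<partial>P x :: real)"
    and q_nonneg: "0 \<le> q" and q_less_1: "q < 1" and C_nonneg: "0 \<le> C"
    and coupling: "\<exists>\<Gamma> \<in> prob_measures. distr \<Gamma> borel fst = P x \<and> distr \<Gamma> borel snd = P y \<and>
      measure \<Gamma> {z. q * dist x y < dist (fst z) (snd z)} \<le> C * dist x y"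
    and irreducible: "0 < \<epsilon> \<Longrightarrow> \<exists>N. \<exists>p>0. \<forall>g y a x. continuous_on UNIV g \<longrightarrow> (\<forall>z. 0 \<le> g z) \<longrightarrow>
      0 \<le> a \<longrightarrow> (\<forall>z\<in>ball y \<epsilon>. a \<le> g z) \<longrightarrow> p * a \<le> (feynman_kac P (\<lambda>_. 0) ^^ N) g x"
begin

abbreviation "T V \<equiv> feynman_kac P V"
abbreviation "M V \<equiv> growth P V"
abbreviation "\<Lambda> V \<equiv> pressure P V"

lemma integrable_kernel: "continuous_on UNIV f \<Longrightarrow> integrable (P x) (f :: 'a \<Rightarrow> real)"
  using integrable_continuous compact_UNIV kernel by blast

lemma bounded_by:
  fixes f :: "'a \<Rightarrow> real"
  assumes "continuous_on UNIV f"
  obtains b where "\<And>x. \<bar>f x\<bar> \<le> b" "0 \<le> b"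
  using continuous_bounded[OF compact_UNIV assms] by blast

lemma attains_max:
  fixes f :: "'a \<Rightarrow> real"
  assumes "continuous_on UNIV f"
  obtains x where "\<And>y. f y \<le> f x"
  using continuous_attains_sup[OF compact_UNIV UNIV_not_empty assms] by blast

lemma attains_min:
  fixes f :: "'a \<Rightarrow> real"
  assumes "continuous_on UNIV f"
  obtains x where "\<And>y. f x \<le> f y"
  using continuous_attains_inf[OF compact_UNIV UNIV_not_empty assms] by blast

context
  fixes V :: "'a \<Rightarrow> real"
  assumes V: "continuous_on UNIV V"
begin


lemma fk_integrable: "continuous_on UNIV f \<Longrightarrow> integrable (P x) (\<lambda>y. exp (V y) * f y)"
  by (intro integrable_kernel continuous_intros V)

lemma fk_continuous: "continuous_on UNIV f \<Longrightarrow> continuous_on UNIV (T V f)"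
  unfolding feynman_kac_def by (intro feller continuous_intros V)

lemma fk_add:
  "continuous_on UNIV f \<Longrightarrow> continuous_on UNIV g \<Longrightarrow> T V (\<lambda>x. f x + g x) x = T V f x + T V g x"
  unfolding feynman_kac_def distrib_left
  by (intro Bochner_Integration.integral_add fk_integrable)

lemma fk_cmult: "T V (\<lambda>x. c * f x) x = c * T V f x"
  unfolding feynman_kac_def by (simp add: mult.left_commute)

lemma fk_mono:
  assumes "continuous_on UNIV f" "continuous_on UNIV g" "\<And>x. f x \<le> g x"
  shows "T V f x \<le> T V g x"
  unfolding feynman_kac_def
  using assms by (intro integral_mono fk_integrable mult_left_mono) auto

lemma fk_iter_continuous: "continuous_on UNIV f \<Longrightarrow> continuous_on UNIV ((T V ^^ n) f)"
  by (induction n) (auto intro: fk_continuous)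

lemma fk_iter_add:
  assumes "continuous_on UNIV f" "continuous_on UNIV g"
  shows "(T V ^^ n) (\<lambda>x. f x + g x) = (\<lambda>x. (T V ^^ n) f x + (T V ^^ n) g x)"
  by (induction n) (auto simp: fk_add fk_iter_continuous assms)

lemma fk_iter_cmult: "(T V ^^ n) (\<lambda>x. c * f x) = (\<lambda>x. c * (T V ^^ n) f x)"
  by (induction n) (auto simp: fk_cmult)

lemma fk_iter_mono:
  assumes "continuous_on UNIV f" "continuous_on UNIV g" "\<And>x. f x \<le> g x"
  shows "(T V ^^ n) f x \<le> (T V ^^ n) g x"
  by (induction n arbitrary: x) (auto intro: fk_mono fk_iter_continuous assms)

lemma fk_iter_bound:
  assumes "continuous_on UNIV f" "\<And>x. \<bar>f x\<bar> \<le> b"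
  shows "\<bar>(T V ^^ n) f x\<bar> \<le> b * (T V ^^ n) (\<lambda>_. 1) x"
proof -
  have *: "-b * 1 \<le> f x" "f x \<le> b * 1" for x using assms(2)[of x] by auto
  have "(T V ^^ n) f x \<le> (T V ^^ n) (\<lambda>x. b * 1) x"
    by (rule fk_iter_mono) (use assms * in auto)
  moreover have "(T V ^^ n) (\<lambda>x. -b * 1) x \<le> (T V ^^ n) f x"
    by (rule fk_iter_mono) (use assms * in auto)
  ultimately show ?thesis unfolding fk_iter_cmult by linarith
qed

lemma fk_dominated_convergence:
  assumes "\<And>n. continuous_on UNIV (f n)" "continuous_on UNIV g" "\<And>n x. \<bar>f n x\<bar> \<le> b"
    "\<And>x. (\<lambda>n. f n x) \<longlonglongrightarrow> g x"
  shows "(\<lambda>n. T V (f n) x) \<longlonglongrightarrow> T V g x"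
  unfolding feynman_kac_def
proof (rule integral_dominated_convergence[where w="\<lambda>y. exp (V y) * b"])
  show "integrable (P x) (\<lambda>y. exp (V y) * b)" by (rule fk_integrable) auto
  show "(\<lambda>y. exp (V y) * g y) \<in> borel_measurable (P x)"
    "\<And>n. (\<lambda>y. exp (V y) * f n y) \<in> borel_measurable (P x)"
    using fk_integrable assms by blast+
  show "AE y in P x. (\<lambda>n. exp (V y) * f n y) \<longlonglongrightarrow> exp (V y) * g y"
    using assms by (auto intro!: tendsto_intros)
  show "AE y in P x. norm (exp (V y) * f n y) \<le> exp (V y) * b" for n
    using assms by (auto simp: abs_mult)
qed

lemma fk_shift: "(feynman_kac P (\<lambda>x. V x - c) ^^ n) f x = exp (- (real n * c)) * (T V ^^ n) f x"
proof -
  have 1: "feynman_kac P (\<lambda>x. V x - c) g x = exp (- c) * T V g x" for g x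
    unfolding feynman_kac_def by (simp add: exp_diff exp_minus field_simps)
  have "(feynman_kac P (\<lambda>x. V x - c) ^^ n) f = (\<lambda>x. exp (- (real n * c)) * (T V ^^ n) f x)"
    by (induction n) (auto simp: 1 fk_cmult exp_add[symmetric] distrib_right simp flip: mult.assoc)
  then show ?thesis by simp
qed

lemma fk_potential_mono:
  assumes V': "continuous_on UNIV V'" and le: "\<And>x. V' x \<le> V x + d"
    and g: "continuous_on UNIV g" "\<And>z. 0 \<le> g z"
  shows "(feynman_kac P V' ^^ n) g x \<le> exp (real n * d) * (T V ^^ n) g x"
proof -
  have 1: "feynman_kac P V' f x \<le> exp d * T V f x"
    if f: "continuous_on UNIV f" "\<And>z. 0 \<le> f z" for f x
  proof -
    have "feynman_kac P V' f x \<le> (\<integral>y. exp d * (exp (V y) * f y) \<partial>P x)"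
      unfolding feynman_kac_def
    proof (rule integral_mono)
      show "integrable (P x) (\<lambda>y. exp (V' y) * f y)"
        "integrable (P x) (\<lambda>y. exp d * (exp (V y) * f y))"
        by (intro integrable_kernel continuous_intros V V' f)+
      fix y
      have "exp (V' y) * f y \<le> exp (V y + d) * f y"
        using le f by (intro mult_right_mono) auto
      then show "exp (V' y) * f y \<le> exp d * (exp (V y) * f y)" by (simp add: exp_add mult_ac)
    qed
    then show ?thesis by (simp add: feynman_kac_def)
  qed
  have nn: "0 \<le> (T V ^^ n) g z" for n z
    using fk_iter_mono[of "\<lambda>_. 0" g n z] fk_iter_cmult[of n 0 "\<lambda>_. 0"] g by simp
  have nn': "0 \<le> (feynman_kac P V' ^^ n) g z \<and> continuous_on UNIV ((feynman_kac P V' ^^ n) g)" for n z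
  proof (induction n arbitrary: z)
    case (Suc n)
    then show ?case using V' g
      by (auto simp: feynman_kac_def intro!: Bochner_Integration.integral_nonneg feller continuous_intros)
  qed (use g in auto)
  show ?thesis
  proof (induction n arbitrary: x)
    case (Suc n)
    have "(feynman_kac P V' ^^ Suc n) g x \<le> exp d * T V ((feynman_kac P V' ^^ n) g) x"
      using 1 nn' by simp
    also have "\<dots> \<le> exp d * T V (\<lambda>x. exp (real n * d) * (T V ^^ n) g x) x"
      using Suc nn' by (intro mult_left_mono fk_mono continuous_intros fk_iter_continuous g) auto
    also have "\<dots> = exp (real (Suc n) * d) * (T V ^^ Suc n) g x"
      by (simp add: fk_cmult exp_add distrib_right)
    finally show ?case .
  qed simp
qed

text \<open>A bounded potential changes the \<open>N\<close>-step kernel by at most a constant factor, so the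
  lower bound from irreducibility is preserved.\<close>

lemma fk_doeblin:
  assumes "0 < \<epsilon>"
  obtains N p where "0 < p" "\<And>g y a x. continuous_on UNIV g \<Longrightarrow> (\<And>z. 0 \<le> g z) \<Longrightarrow>
      0 \<le> a \<Longrightarrow> (\<And>z. dist y z < \<epsilon> \<Longrightarrow> a \<le> g z) \<Longrightarrow> p * a \<le> (T V ^^ N) g x"
proof -
  obtain N p where p: "0 < p" "\<And>g y a x. continuous_on UNIV g \<Longrightarrow> (\<And>z. 0 \<le> g z) \<Longrightarrow>
      0 \<le> a \<Longrightarrow> (\<And>z. z \<in> ball y \<epsilon> \<Longrightarrow> a \<le> g z) \<Longrightarrow> p * a \<le> (feynman_kac P (\<lambda>_. 0) ^^ N) g x"
    using irreducible[OF assms] by metis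
  obtain b where b: "\<And>x. \<bar>V x\<bar> \<le> b" using bounded_by[OF V] by blast
  show thesis
  proof (rule that[of "exp (- (real N * b)) * p" N])
    show "0 < exp (- (real N * b)) * p" using p by simp
    fix g :: "'a \<Rightarrow> real" and y x and a :: real assume g: "continuous_on UNIV g" "\<And>z. 0 \<le> g z" "0 \<le> a" "\<And>z. dist y z < \<epsilon> \<Longrightarrow> a \<le> g z"
    have "p * a \<le> (feynman_kac P (\<lambda>_. 0) ^^ N) g x" using g by (intro p) auto
    also have "\<dots> \<le> exp (real N * b) * (T V ^^ N) g x"
    proof (rule fk_potential_mono)
      show "0 \<le> V z + b" for z using b[of z] by linarith
    qed (use g in auto)
    finally show "exp (- (real N * b)) * p * a \<le> (T V ^^ N) g x"
      by (simp add: exp_minus field_simps)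
  qed
qed

section \<open>Growth rate and pressure\<close>


lemma growth_upper: "(T V ^^ n) (\<lambda>_. 1) x \<le> M V n"
  and growth_attained: "\<exists>x. (T V ^^ n) (\<lambda>_. 1) x = M V n"
proof -
  have "continuous_on UNIV ((T V ^^ n) (\<lambda>_. 1))" by (intro fk_iter_continuous) auto
  then obtain z where z: "\<And>y. (T V ^^ n) (\<lambda>_. 1) y \<le> (T V ^^ n) (\<lambda>_. 1) z"
    using attains_max by blast
  have "M V n = (T V ^^ n) (\<lambda>_. 1) z"
    unfolding growth_def by (rule cSup_eq_maximum) (use z in auto)
  with z show "(T V ^^ n) (\<lambda>_. 1) x \<le> M V n" "\<exists>x. (T V ^^ n) (\<lambda>_. 1) x = M V n" by auto
qed

lemma fk_iter_one_lower:
  assumes "\<And>x. \<bar>V x\<bar> \<le> b"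
  shows "exp (- (real n * b)) \<le> (T V ^^ n) (\<lambda>_. 1) x"
proof -
  have one: "(feynman_kac P (\<lambda>_. 0) ^^ n) (\<lambda>_. 1) = (\<lambda>_. 1 :: real)"
  proof (induction n)
    case (Suc n)
    have "measure (P x) (space (P x)) = 1" for x
      using prob_space.prob_space prob_measuresD(1)[OF kernel] by blast
    then show ?case unfolding funpow.simps comp_def Suc by (simp add: feynman_kac_def)
  qed simp
  have "0 \<le> V z + b" for z using assms[of z] by linarith
  then have "(feynman_kac P (\<lambda>_. 0) ^^ n) (\<lambda>_. 1) x \<le> exp (real n * b) * (T V ^^ n) (\<lambda>_. 1) x"
    by (intro fk_potential_mono) auto
  then show ?thesis unfolding one by (simp add: exp_minus field_simps)
qed

lemma fk_iter_one_pos: "0 < (T V ^^ n) (\<lambda>_. 1) x"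
proof -
  obtain b where "\<And>x. \<bar>V x\<bar> \<le> b" using bounded_by[OF V] by blast
  from fk_iter_one_lower[OF this, of n x] show ?thesis by (meson exp_gt_zero less_le_trans)
qed

lemma growth_pos: "0 < M V n"
  using growth_attained fk_iter_one_pos by metis

lemma growth_0: "M V 0 = 1"
  using growth_attained[of 0] by simp

lemma fk_iter_le_growth:
  assumes "continuous_on UNIV f" "\<And>x. \<bar>f x\<bar> \<le> b" "0 \<le> b"
  shows "\<bar>(T V ^^ n) f x\<bar> \<le> b * M V n"
  using fk_iter_bound[OF assms(1,2), of n x] mult_left_mono[OF growth_upper assms(3), of n x] by linarith

lemma growth_submult: "M V (m + n) \<le> M V m * M V n"
proof -
  obtain x where x: "(T V ^^ (m + n)) (\<lambda>_. 1) x = M V (m + n)" using growth_attained by blast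
  have "(T V ^^ m) ((T V ^^ n) (\<lambda>_. 1)) x \<le> M V n * M V m"
    using fk_iter_le_growth[of "(T V ^^ n) (\<lambda>_. 1)" "M V n" m x] growth_pos[of n] growth_upper[of n]
      fk_iter_one_pos[of n]
    by (force simp: fk_iter_continuous less_imp_le)
  then show ?thesis using x by (simp add: funpow_add mult.commute)
qed

lemma growth_power: "M V (k * n) \<le> M V n ^ k"
proof (induction k)
  case (Suc k)
  have "M V (Suc k * n) \<le> M V n * M V (k * n)" using growth_submult[of n "k * n"] by simp
  also have "\<dots> \<le> M V n * M V n ^ k" using Suc growth_pos[of n] by (intro mult_left_mono) auto
  finally show ?case by simp
qed (simp add: growth_0)

lemma growth_lower_exp:
  assumes "\<And>x. \<bar>V x\<bar> \<le> b"
  shows "exp (- (real n * b)) \<le> M V n"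
  using fk_iter_one_lower[OF assms] growth_upper order_trans by blast

lemma growth_upper_exp:
  assumes "\<And>x. V x \<le> b"
  shows "M V n \<le> exp (real n * b)"
proof -
  obtain x where x: "(T V ^^ n) (\<lambda>_. 1) x = M V n" using growth_attained by blast
  have le: "(T V ^^ n) (\<lambda>_. 1) x \<le> exp (real n * b)" for x
  proof (induction n arbitrary: x)
    case (Suc n)
    interpret p: prob_space "P x" using prob_measuresD(1)[OF kernel] .
    have "T V ((T V ^^ n) (\<lambda>_. 1)) x \<le> (\<integral>y. exp b * exp (real n * b) \<partial>P x)"
      unfolding feynman_kac_def[of P V "(T V ^^ n) (\<lambda>_. 1)"]
      using assms Suc fk_iter_one_pos[of n]
      by (intro integral_mono fk_integrable fk_iter_continuous integrable_kernel mult_mono)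
        (auto simp: less_imp_le)
    then show ?case by (simp add: p.prob_space exp_add distrib_left distrib_right mult.commute)
  qed simp
  show ?thesis using le x by metis
qed

lemma pressure_bdd_below: "bdd_below ((\<lambda>n. ln (M V n) / real n) ` {1..})"
proof -
  obtain b where b: "\<And>x. \<bar>V x\<bar> \<le> b" using bounded_by[OF V] by blast
  have "- b \<le> ln (M V n) / real n" if "n \<ge> 1" for n
  proof -
    have "- (real n * b) \<le> ln (M V n)"
      using growth_lower_exp[OF b, of n] growth_pos[of n] by (simp add: ln_ge_iff)
    then show ?thesis using that by (simp add: field_simps)
  qed
  then show ?thesis by (auto intro!: bdd_belowI[of _ "-b"])
qed

lemma pressure_le: "n \<ge> 1 \<Longrightarrow> pressure P V \<le> ln (M V n) / real n"
  unfolding pressure_def by (rule cINF_lower[OF pressure_bdd_below]) auto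

lemma exp_pressure_le_growth: "exp (real n * pressure P V) \<le> M V n"
proof (cases "n = 0")
  case False
  then have "real n * pressure P V \<le> ln (M V n)" using pressure_le[of n] by (simp add: field_simps)
  then show ?thesis using growth_pos[of n] by (simp add: ln_ge_iff)
qed (simp add: growth_0)

lemma pressure_greatest:
  assumes "\<And>n. n \<ge> 1 \<Longrightarrow> a * real n \<le> ln (M V n)"
  shows "a \<le> pressure P V"
  unfolding pressure_def
  using assms by (intro cINF_greatest) (auto simp: field_simps)

lemma pressure_least:
  assumes "\<And>n. M V n \<le> B * exp (real n * a)"
  shows "pressure P V \<le> a"
proof (rule LIMSEQ_le_const)
  have B: "B > 0" using assms[of 0] growth_0 by simp
  have "(\<lambda>n. ln B / real n + a) \<longlonglongrightarrow> 0 + a"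
    by (intro tendsto_intros lim_const_over_n)
  then show "(\<lambda>n. ln B / real n + a) \<longlonglongrightarrow> a" by simp
  have "pressure P V \<le> ln B / real n + a" if "n \<ge> 1" for n
  proof -
    have "ln (M V n) \<le> ln (B * exp (real n * a))" using assms[of n] growth_pos[of n] by (intro ln_mono) auto
    also have "\<dots> = ln B + real n * a" using B by (simp add: ln_mult)
    finally have "ln (M V n) / real n \<le> (ln B + real n * a) / real n" by (intro divide_right_mono) auto
    then show ?thesis using pressure_le[OF that] that by (simp add: add_divide_distrib)
  qed
  then show "\<exists>N. \<forall>n\<ge>N. pressure P V \<le> ln B / real n + a" by blast
qed

text \<open>Division with remainder by an \<open>n\<close> for which \<open>ln (M V n) / n\<close> is close to the infimum, together with submultiplicativity.\<close>

lemma growth_subexponential: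
  assumes "0 < \<delta>"
  obtains B where "\<And>k. M V k \<le> B * exp (real k * (pressure P V + \<delta>))"
proof -
  let ?L = "pressure P V + \<delta>"
  obtain n where n: "n \<ge> 1" "ln (M V n) / real n < ?L"
  proof -
    have "pressure P V < ?L" using assms by simp
    then show thesis
      unfolding pressure_def[of P V] using that pressure_bdd_below
      by (subst (asm) cINF_less_iff) (auto simp: pressure_def)
  qed
  then have "ln (M V n) \<le> real n * ?L" by (simp add: field_simps)
  then have Mn: "M V n \<le> exp (real n * ?L)" using growth_pos[of n] by (metis exp_le_cancel_iff exp_ln)
  obtain b where b: "\<And>x. \<bar>V x\<bar> \<le> b" "0 \<le> b" using bounded_by[OF V] by blast
  have b': "V x \<le> b" for x using b(1)[of x] by simp
  show thesis
  proof (rule that)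
    fix k
    have "M V k = M V ((k div n) * n + k mod n)" by simp
    also have "\<dots> \<le> M V n ^ (k div n) * M V (k mod n)"
      using growth_power growth_submult growth_pos
      by (meson less_imp_le mult_right_mono order_trans)
    also have "\<dots> \<le> exp (real n * ?L) ^ (k div n) * exp (real (k mod n) * b)"
      using growth_upper_exp[OF b', of "k mod n"] growth_pos[of n] growth_pos[of "k mod n"]
      by (intro mult_mono power_mono Mn) auto
    also have "\<dots> = exp (real (k div n * n) * ?L + real (k mod n) * b)"
      by (simp add: exp_add exp_of_nat_mult[symmetric] mult_ac)
    also have "\<dots> \<le> exp (real n * (b + \<bar>?L\<bar>) + real k * ?L)"
    proof -
      have k: "real k = real (k div n * n) + real (k mod n)"
        by (metis div_mult_mod_eq of_nat_add)
      have r: "real (k mod n) \<le> real n" using n by (simp add: less_imp_le)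
      have "real (k mod n) * (b - ?L) \<le> real (k mod n) * (b + \<bar>?L\<bar>)" by (intro mult_left_mono) auto
      also have "\<dots> \<le> real n * (b + \<bar>?L\<bar>)" using r b by (intro mult_right_mono) auto
      finally have "real (k mod n) * (b - ?L) \<le> real n * (b + \<bar>?L\<bar>)" .
      then show ?thesis unfolding k by (simp add: algebra_simps)
    qed
    finally show "M V k \<le> exp (real n * (b + \<bar>?L\<bar>)) * exp (real k * ?L)" by (simp add: exp_add)
  qed
qed


lemma fk_sum:
  assumes "\<And>k. k \<in> K \<Longrightarrow> continuous_on UNIV (g k)"
  shows "T V (\<lambda>x. \<Sum>k\<in>K. c k * g k x) y = (\<Sum>k\<in>K. c k * T V (g k) y)"
  using assms
proof (induction K rule: infinite_finite_induct)
  case (insert i K)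
  then show ?case
    by (simp add: fk_add fk_cmult continuous_on_mult_left continuous_on_sum)
qed (simp_all add: feynman_kac_def)

end

section \<open>Squeezing makes the normalized iterates equi-Lipschitz\<close>

context
  fixes V :: "'a \<Rightarrow> real" and l b :: real
  assumes V_lipschitz: "\<And>x y. \<bar>V x - V y\<bar> \<le> l * dist x y" and l_nonneg: "0 \<le> l"
    and V_bound: "\<And>x. \<bar>V x\<bar> \<le> b"
begin

lemmas V_continuous = lipschitz_imp_continuous[OF V_lipschitz l_nonneg]

abbreviation "K \<equiv> exp b * (q * l + 2 * C)"

lemma K_nonneg: "0 \<le> K"
  using l_nonneg q_nonneg C_nonneg by simp

lemma exp_potential_lipschitz: "\<bar>exp (V x) - exp (V y)\<bar> \<le> exp b * l * dist x y"
proof -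
  have *: "exp s - exp t \<le> exp b * \<bar>s - t\<bar>" if "s \<le> b" for s t
  proof -
    have "exp s - exp t = exp s * (1 - exp (t - s))" by (simp add: exp_diff right_diff_distrib)
    also have "\<dots> \<le> exp s * \<bar>s - t\<bar>"
    proof (rule mult_left_mono)
      show "1 - exp (t - s) \<le> \<bar>s - t\<bar>" using exp_ge_add_one_self[of "t - s"] by linarith
    qed simp
    also have "\<dots> \<le> exp b * \<bar>s - t\<bar>" using that by (intro mult_right_mono) auto
    finally show ?thesis .
  qed
  have "V x \<le> b" "V y \<le> b" using V_bound[of x] V_bound[of y] by auto
  then have "\<bar>exp (V x) - exp (V y)\<bar> \<le> exp b * \<bar>V x - V y\<bar>"
    using *[of "V x" "V y"] *[of "V y" "V x"] by (simp add: abs_minus_commute abs_le_iff)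
  also have "\<dots> \<le> exp b * (l * dist x y)" by (intro mult_left_mono V_lipschitz) auto
  finally show ?thesis by (simp add: mult.assoc)
qed

text \<open>On a coupled pair at distance at most \<open>q * dist x y\<close> the gradient bound for \<open>f\<close> is used at the second
  point, whose law is \<open>P y\<close>; this produces \<open>q * T V G y\<close>. On the exceptional event, of probability at most
  \<open>C * dist x y\<close>, the trivial bound by \<open>F\<close> suffices.\<close>

lemma gradient_step:
  assumes f: "continuous_on UNIV f" and F: "\<And>x. \<bar>f x\<bar> \<le> F"
    and G: "continuous_on UNIV G" "\<And>x. 0 \<le> G x"
    and grad: "\<And>x y. \<bar>f x - f y\<bar> \<le> dist x y * G y"
  shows "\<bar>T V f x - T V f y\<bar> \<le> dist x y * (K * F + q * T V G y)"
proof -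
  note V = V_continuous
  let ?d = "dist x y"
  obtain \<Gamma> :: "('a \<times> 'a) measure" where \<Gamma>: "\<Gamma> \<in> prob_measures"
    "distr \<Gamma> borel fst = P x" "distr \<Gamma> borel snd = P y"
    "measure \<Gamma> {z. q * ?d < dist (fst z) (snd z)} \<le> C * ?d"
    using coupling by blast
  note gm = prob_measuresD[OF \<Gamma>(1)]
  interpret g: prob_space \<Gamma> by (rule gm)
  have comp2: "compact (UNIV :: ('a \<times> 'a) set)"
    using compact_Times[OF compact_UNIV compact_UNIV] by simp
  note int2 = integrable_continuous[OF comp2 \<Gamma>(1)]
  define u where "u z = exp (V (fst z)) * f (fst z)" for z :: "'a \<times> 'a"
  define v where "v z = exp (V (snd z)) * f (snd z)" for z :: "'a \<times> 'a"
  define w where "w z = exp (V (snd z)) * G (snd z)" for z :: "'a \<times> 'a"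
  define B where "B = {z :: 'a \<times> 'a. q * ?d < dist (fst z) (snd z)}"
  have fs: "fst \<in> measurable \<Gamma> borel" "snd \<in> measurable \<Gamma> borel"
    using gm by (auto simp: measurable_cong_sets[OF gm(2) refl] intro!: borel_measurable_continuous_onI continuous_intros)
  have B: "B \<in> sets \<Gamma>"
    unfolding B_def gm by (intro borel_open open_Collect_less continuous_intros)
  have comp_cont: "continuous_on UNIV (\<lambda>z. h (fst z))" "continuous_on UNIV (\<lambda>z. h (snd z))"
    if "continuous_on UNIV h" for h :: "'a \<Rightarrow> real"
    using that by (auto intro!: continuous_intros continuous_on_compose2[OF that])
  have cont: "continuous_on UNIV u" "continuous_on UNIV v" "continuous_on UNIV w"
    unfolding u_def v_def w_def by (intro continuous_intros comp_cont V f G)+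
  have meas: "(\<lambda>x. exp (V x) * h x) \<in> borel_measurable borel" if "continuous_on UNIV h" for h
    by (intro borel_measurable_continuous_onI continuous_intros V that)
  have Tx: "T V f x = integral\<^sup>L \<Gamma> u" unfolding feynman_kac_def \<Gamma>(2)[symmetric] u_def
    by (rule integral_distr[OF fs(1) meas[OF f]])
  have Ty: "T V f y = integral\<^sup>L \<Gamma> v" unfolding feynman_kac_def \<Gamma>(3)[symmetric] v_def
    by (rule integral_distr[OF fs(2) meas[OF f]])
  have TG: "T V G y = integral\<^sup>L \<Gamma> w" unfolding feynman_kac_def \<Gamma>(3)[symmetric] w_def
    by (rule integral_distr[OF fs(2) meas[OF G(1)]])
  have F0: "0 \<le> F" using F[of undefined] by linarith
  have expV: "exp (V z) \<le> exp b" for z using V_bound[of z] by simp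
  have pointwise: "\<bar>u z - v z\<bar> \<le> ?d * (q * (exp b * l * F)) + ?d * q * w z + 2 * exp b * F * indicator B z" for z
  proof (cases "z \<in> B")
    case True
    have "\<bar>u z\<bar> \<le> exp b * F" "\<bar>v z\<bar> \<le> exp b * F"
      unfolding u_def v_def abs_mult using expV F F0 by (auto intro!: mult_mono)
    then have "\<bar>u z - v z\<bar> \<le> 2 * exp b * F" by linarith
    moreover have "0 \<le> ?d * (q * (exp b * l * F))" "0 \<le> ?d * q * w z"
      using q_nonneg l_nonneg F0 G(2) by (auto simp: w_def)
    ultimately show ?thesis using True by simp
  next
    case False
    obtain z1 z2 where z: "z = (z1, z2)" by (cases z)
    have dz: "dist z1 z2 \<le> q * ?d" using False unfolding B_def z by simp
    have "u z - v z = (exp (V z1) - exp (V z2)) * f z1 + exp (V z2) * (f z1 - f z2)"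
      unfolding u_def v_def z by (simp add: algebra_simps)
    then have "\<bar>u z - v z\<bar> \<le> \<bar>exp (V z1) - exp (V z2)\<bar> * \<bar>f z1\<bar> + exp (V z2) * \<bar>f z1 - f z2\<bar>"
      by (metis abs_triangle_ineq abs_mult abs_exp_cancel)
    also have "\<dots> \<le> (exp b * l * (q * ?d)) * F + exp (V z2) * ((q * ?d) * G z2)"
    proof (intro add_mono mult_mono)
      show "\<bar>exp (V z1) - exp (V z2)\<bar> \<le> exp b * l * (q * ?d)"
        using order_trans[OF exp_potential_lipschitz[of z1 z2] mult_left_mono[OF dz, of "exp b * l"]] l_nonneg
        by simp
      show "\<bar>f z1 - f z2\<bar> \<le> q * ?d * G z2"
        using grad[of z1 z2] mult_right_mono[OF dz G(2)[of z2]] by linarith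
    qed (use F F0 l_nonneg q_nonneg in auto)
    finally show ?thesis using False unfolding w_def z by (simp add: mult_ac)
  qed
  have "\<bar>T V f x - T V f y\<bar> = \<bar>\<integral>z. u z - v z \<partial>\<Gamma>\<bar>"
    unfolding Tx Ty by (simp add: int2 cont)
  also have "\<dots> \<le> (\<integral>z. \<bar>u z - v z\<bar> \<partial>\<Gamma>)" by (rule integral_abs_bound)
  also have "\<dots> \<le> (\<integral>z. ?d * (q * (exp b * l * F)) + ?d * q * w z + 2 * exp b * F * indicator B z \<partial>\<Gamma>)"
  proof (rule integral_mono[OF _ _ pointwise])
    show "integrable \<Gamma> (\<lambda>z. \<bar>u z - v z\<bar>)" by (intro int2 continuous_intros cont)
    show "integrable \<Gamma> (\<lambda>z. ?d * (q * (exp b * l * F)) + ?d * q * w z + 2 * exp b * F * indicator B z)"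
      using B by (intro Bochner_Integration.integrable_add integrable_mult_right int2 cont integrable_real_indicator)
        (auto simp: g.emeasure_eq_measure)
  qed
  also have "\<dots> = ?d * (q * (exp b * l * F)) + ?d * q * T V G y + 2 * exp b * F * measure \<Gamma> B"
    unfolding TG using B int2[OF cont(3)] g.emeasure_eq_measure
    by (simp add: g.prob_space integrable_real_indicator)
  also have "\<dots> \<le> ?d * (q * (exp b * l * F)) + ?d * q * T V G y + 2 * exp b * F * (C * ?d)"
    using \<Gamma>(4) F0 unfolding B_def by (intro add_left_mono mult_left_mono) auto
  also have "\<dots> = ?d * (K * F + q * T V G y)" by (simp add: algebra_simps)
  finally show ?thesis .
qed

text \<open>The recursion of the gradient bounds is solved explicitly by the function \<open>G\<close> in the proof: a coupling
  that fails with \<open>k\<close> steps elapsed contributes the weight \<open>(T V ^^ k) (\<lambda>_. 1)\<close> collected before, the factor \<open>q ^ k\<close>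
  for the small distance at that time, and the supremum \<open>M V (n - 1 - k)\<close> for the remaining time.\<close>

lemma lipschitz_iter:
  assumes f: "continuous_on UNIV f" and F: "\<And>x. \<bar>f x\<bar> \<le> F"
    and L: "\<And>x y. \<bar>f x - f y\<bar> \<le> L * dist x y" "0 \<le> L"
  shows "\<bar>(T V ^^ n) f x - (T V ^^ n) f y\<bar>
    \<le> (K * F * (\<Sum>k<n. q ^ k * M V (n - 1 - k) * M V k) + q ^ n * L * M V n) * dist x y"
proof -
  note V = V_continuous
  have F0: "0 \<le> F" using F[of undefined] by linarith
  define I where "I k = (T V ^^ k) (\<lambda>_. 1)" for k
  have I: "continuous_on UNIV (I k)" "0 \<le> I k x" "I k x \<le> M V k" for k x
    unfolding I_def using fk_iter_one_pos[OF V, of k x]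
    by (auto intro!: fk_iter_continuous growth_upper V simp: less_imp_le)
  define G where "G n y = (\<Sum>k<n. K * F * q ^ k * M V (n - 1 - k) * I k y) + q ^ n * L * I n y" for n y
  have Gc: "continuous_on UNIV (G n)" for n
    unfolding G_def by (intro continuous_intros I)
  have G0: "0 \<le> G n y" for n y
    unfolding G_def
    by (intro add_nonneg_nonneg sum_nonneg mult_nonneg_nonneg[OF mult_nonneg_nonneg] I(2) F0 L(2)
        K_nonneg
        zero_le_power q_nonneg less_imp_le[OF growth_pos[OF V]])
  have TG: "K * (F * M V n) + q * T V (G n) y = G (Suc n) y" for n y
  proof -
    have "G n = (\<lambda>y. (\<Sum>k<n. (K * F * q ^ k * M V (n - 1 - k)) * I k y) + q ^ n * L * I n y)"
      by (simp add: G_def fun_eq_iff)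
    then have "T V (G n) y = (\<Sum>k<n. K * F * q ^ k * M V (n - 1 - k) * T V (I k) y) + q ^ n * L * T V (I n) y"
      using I by (simp add: fk_add[OF V] fk_sum[OF V] fk_cmult[OF V] continuous_intros)
    also have "\<dots> = (\<Sum>k<n. K * F * q ^ k * M V (n - 1 - k) * I (Suc k) y) + q ^ n * L * I (Suc n) y"
      by (simp add: I_def)
    finally show ?thesis
      unfolding G_def
      by (subst sum.lessThan_Suc_shift) (simp add: I_def distrib_left sum_distrib_left mult_ac)
  qed
  have "\<bar>(T V ^^ n) f x - (T V ^^ n) f y\<bar> \<le> dist x y * G n y" for x y
  proof (induction n arbitrary: x y)
    case 0 then show ?case using L(1)[of x y] by (simp add: G_def I_def mult.commute)
  next
    case (Suc n)
    have "\<bar>T V ((T V ^^ n) f) x - T V ((T V ^^ n) f) y\<bar> \<le> dist x y * (K * (F * M V n) + q * T V (G n) y)"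
      by (rule gradient_step[OF _ _ Gc G0 Suc]) (intro fk_iter_continuous fk_iter_le_growth V f F F0)+
    then show ?case unfolding TG by simp
  qed
  also have "G n y \<le> K * F * (\<Sum>k<n. q ^ k * M V (n - 1 - k) * M V k) + q ^ n * L * M V n"
    unfolding G_def sum_distrib_left
  proof (intro add_mono sum_mono)
    fix k
    have "0 \<le> K * F * q ^ k * M V (n - 1 - k)"
      by (intro K_nonneg F0 zero_le_power q_nonneg less_imp_le[OF growth_pos[OF V]] mult_nonneg_nonneg)
    then have "K * F * q ^ k * M V (n - 1 - k) * I k y \<le> K * F * q ^ k * M V (n - 1 - k) * M V k"
      using I by (intro mult_left_mono)
    then show "K * F * q ^ k * M V (n - 1 - k) * I k y \<le> K * F * (q ^ k * M V (n - 1 - k) * M V k)"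
      by (simp add: mult_ac)
    show "q ^ n * L * I n y \<le> q ^ n * L * M V n"
      using I q_nonneg L(2) by (intro mult_left_mono) auto
  qed
  then have "dist x y * G n y \<le> \<dots> * dist x y" by (subst mult.commute) (intro mult_right_mono, auto)
  finally show ?thesis .
qed


text \<open>Subexponential growth of \<open>M V k * exp (- k * \<Lambda> V)\<close> is beaten by the geometric factor; \<open>\<delta>\<close> is chosen with
  \<open>q * exp \<delta> < 1\<close>, replacing \<open>q\<close> by \<open>max q (1/2)\<close> because \<open>q\<close> may vanish.\<close>

lemma discounted_growth_summable:
  obtains A where "0 \<le> A" "\<And>n. (\<Sum>k<n. q ^ k * (M V k * exp (- (real k * \<Lambda> V)))) \<le> A"
proof -
  note V = V_continuous
  define r where "r = max q (1/2)"
  have r: "0 < r" "r < 1" "q \<le> r" using q_less_1 by (auto simp: r_def)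
  define \<delta> where "\<delta> = - ln r / 2"
  have d: "0 < \<delta>" using r by (simp add: \<delta>_def)
  have r_eq: "r = exp (- 2 * \<delta>)" using r by (simp add: \<delta>_def)
  obtain B where B: "\<And>k. M V k \<le> B * exp (real k * (\<Lambda> V + \<delta>))" using growth_subexponential[OF V d] by blast
  have B0: "B > 0" using B[of 0] growth_0[OF V] by simp
  have le: "q ^ k * (M V k * exp (- (real k * \<Lambda> V))) \<le> B * exp (- \<delta>) ^ k" for k
  proof -
    have "q ^ k * (M V k * exp (- (real k * \<Lambda> V))) \<le> r ^ k * ((B * exp (real k * (\<Lambda> V + \<delta>))) * exp (- (real k * \<Lambda> V)))"
      using r q_nonneg B growth_pos[OF V, of k] B0 by (intro mult_mono power_mono) auto
    also have "\<dots> = B * exp (- \<delta>) ^ k"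
      unfolding r_eq by (simp add: exp_of_nat_mult[symmetric] exp_add[symmetric] algebra_simps) 
    finally show ?thesis .
  qed
  have sm: "summable (\<lambda>k. B * exp (- \<delta>) ^ k)" using d by (intro summable_mult summable_geometric) auto
  show thesis
  proof (rule that)
    show "0 \<le> (\<Sum>k. B * exp (- \<delta>) ^ k)" using B0 by (intro suminf_nonneg sm) auto
    fix n
    have "(\<Sum>k<n. q ^ k * (M V k * exp (- (real k * \<Lambda> V)))) \<le> (\<Sum>k<n. B * exp (- \<delta>) ^ k)"
      by (intro sum_mono le)
    also have "\<dots> \<le> (\<Sum>k. B * exp (- \<delta>) ^ k)" using B0 by (intro sum_le_suminf sm) auto
    finally show "(\<Sum>k<n. q ^ k * (M V k * exp (- (real k * \<Lambda> V)))) \<le> \<dots>" .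
  qed
qed

text \<open>If the normalized suprema \<open>a n\<close> were unbounded, take the first \<open>n\<close> at which they exceed \<open>B\<close>. Then
  \<open>a k \<le> a n\<close> for all \<open>k < n\<close>, and the Lipschitz constant of \<open>(T V ^^ n) (\<lambda>_. 1)\<close> is at most \<open>L * M V n\<close> with
  \<open>L\<close> independent of \<open>B\<close>. So this function exceeds \<open>M V n / 2\<close> on a ball of radius \<open>1 / (2 * L)\<close>, and by irreducibility
  \<open>(T V ^^ (N + n)) (\<lambda>_. 1)\<close> exceeds a fixed fraction of \<open>M V n\<close> everywhere. Iterating this lower bound
  gives \<open>p * (M V n / 2) \<le> exp ((N + n) * \<Lambda> V)\<close>, that is, \<open>a n \<le> 2 * exp (N * \<Lambda> V) / p\<close>, a number fixed before
  \<open>B\<close> was chosen.\<close>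

lemma growth_bounded:
  obtains A where "\<And>n. M V n \<le> A * exp (real n * \<Lambda> V)"
proof (rule ccontr)
  assume "\<not> thesis"
  note V = V_continuous
  define a where "a n = M V n * exp (- (real n * \<Lambda> V))" for n
  have M_a: "M V n = a n * exp (real n * \<Lambda> V)" for n by (simp add: a_def exp_minus)
  have apos: "a n > 0" for n using growth_pos[OF V] by (simp add: a_def)
  have unb: "\<exists>n. a n > B" for B
  proof (rule ccontr)
    assume "\<not> (\<exists>n. a n > B)"
    then have "M V n \<le> B * exp (real n * \<Lambda> V)" for n unfolding M_a by (simp add: not_less)
    then show False using that \<open>\<not> thesis\<close> by blast
  qed
  obtain A where A: "0 \<le> A" "\<And>n. (\<Sum>k<n. q ^ k * a k) \<le> A"
    using discounted_growth_summable unfolding a_def by blast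
  define L where "L = K * exp (- \<Lambda> V) * A + 1"
  have L: "L > 0" using K_nonneg A by (simp add: L_def add_nonneg_pos)
  obtain N p where p: "0 < p" "\<And>g y a x. continuous_on UNIV g \<Longrightarrow> (\<And>z. 0 \<le> g z) \<Longrightarrow>
      0 \<le> a \<Longrightarrow> (\<And>z. dist y z < 1 / (2 * L) \<Longrightarrow> a \<le> g z) \<Longrightarrow> p * a \<le> (T V ^^ N) g x"
    using fk_doeblin[OF V, of "1 / (2 * L)"] L by (metis divide_pos_pos mult_pos_pos zero_less_numeral zero_less_one)
  define B where "B = max 1 (2 * exp (real N * \<Lambda> V) / p)"
  define n where "n = (LEAST n. a n > B)"
  have n: "a n > B" unfolding n_def using unb[of B] by (rule LeastI_ex)
  have before: "a k \<le> a n" if "k < n" for k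
    using not_less_Least[of k "\<lambda>n. a n > B"] that n unfolding n_def[symmetric] by auto
  have "a 0 \<le> B" by (simp add: a_def B_def growth_0[OF V])
  then have n0: "n \<noteq> 0" using n by (metis not_less)
  let ?g = "(T V ^^ n) (\<lambda>_. 1)"
  have sum_le: "(\<Sum>k<n. q ^ k * M V (n - 1 - k) * M V k) \<le> exp (- \<Lambda> V) * A * M V n"
  proof -
    have "(\<Sum>k<n. q ^ k * M V (n - 1 - k) * M V k) \<le> (\<Sum>k<n. exp (- \<Lambda> V) * M V n * (q ^ k * a k))"
    proof (rule sum_mono)
      fix k assume "k \<in> {..<n}"
      then have k: "k < n" by simp
      have e: "exp (real (n - 1 - k) * \<Lambda> V) * exp (real k * \<Lambda> V) = exp (- \<Lambda> V) * exp (real n * \<Lambda> V)"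
        using k by (simp add: exp_add[symmetric] of_nat_diff algebra_simps)
      have "q ^ k * M V (n - 1 - k) * M V k
        = q ^ k * a (n - 1 - k) * a k * (exp (real (n - 1 - k) * \<Lambda> V) * exp (real k * \<Lambda> V))"
        unfolding M_a by (simp add: mult_ac)
      also have "\<dots> \<le> q ^ k * a n * a k * (exp (- \<Lambda> V) * exp (real n * \<Lambda> V))"
        unfolding e using q_nonneg apos[of k] before[of "n - 1 - k"] n0
        by (intro mult_right_mono mult_left_mono) auto
      also have "\<dots> = exp (- \<Lambda> V) * M V n * (q ^ k * a k)" unfolding M_a by (simp add: mult_ac)
      finally show "q ^ k * M V (n - 1 - k) * M V k \<le> exp (- \<Lambda> V) * M V n * (q ^ k * a k)" .
    qed
    also have "\<dots> = exp (- \<Lambda> V) * M V n * (\<Sum>k<n. q ^ k * a k)" by (simp add: sum_distrib_left)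
    also have "\<dots> \<le> exp (- \<Lambda> V) * M V n * A" using A growth_pos[OF V, of n] by (intro mult_left_mono) auto
    finally show ?thesis by (simp add: mult_ac)
  qed
  have lip: "\<bar>?g x - ?g y\<bar> \<le> L * M V n * dist x y" for x y
  proof -
    have "\<bar>?g x - ?g y\<bar> \<le> (K * 1 * (\<Sum>k<n. q ^ k * M V (n - 1 - k) * M V k) + q ^ n * 0 * M V n) * dist x y"
      by (rule lipschitz_iter) auto
    also have "\<dots> \<le> L * M V n * dist x y"
    proof (rule mult_right_mono)
      have "K * (\<Sum>k<n. q ^ k * M V (n - 1 - k) * M V k) \<le> K * (exp (- \<Lambda> V) * A * M V n)"
        using sum_le K_nonneg by (rule mult_left_mono)
      also have "\<dots> \<le> L * M V n" using growth_pos[OF V, of n] by (simp add: L_def algebra_simps)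
      finally show "K * 1 * (\<Sum>k<n. q ^ k * M V (n - 1 - k) * M V k) + q ^ n * 0 * M V n \<le> L * M V n" by simp
    qed auto
    finally show ?thesis .
  qed
  obtain y where y: "?g y = M V n" using growth_attained[OF V] by blast
  have ball: "M V n / 2 \<le> ?g z" if "dist y z < 1 / (2 * L)" for z
  proof -
    have "M V n - ?g z \<le> L * M V n * dist y z" using lip[of y z] y by linarith
    also have "\<dots> \<le> L * M V n * (1 / (2 * L))"
      using that L growth_pos[OF V, of n] by (intro mult_left_mono) auto
    also have "\<dots> = M V n / 2" using L by simp
    finally show ?thesis by simp
  qed
  let ?m = "N + n" and ?\<beta> = "p * (M V n / 2)"
  have \<beta>: "?\<beta> > 0" using p growth_pos[OF V, of n] by simp
  have lower: "?\<beta> \<le> (T V ^^ ?m) (\<lambda>_. 1) x" for x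
    unfolding funpow_add comp_def
    using growth_pos[OF V, of n] fk_iter_one_pos[OF V, of n]
    by (intro p(2)[OF fk_iter_continuous[OF V] _ _ ball]) (auto simp: less_imp_le)
  have pow: "?\<beta> ^ j \<le> (T V ^^ (j * ?m)) (\<lambda>_. 1) x" for j x
  proof (induction j arbitrary: x)
    case (Suc j)
    have "?\<beta> ^ Suc j \<le> ?\<beta> ^ j * (T V ^^ ?m) (\<lambda>_. 1) x"
      using lower[of x] \<beta> by (simp add: mult_left_mono mult.commute)
    also have "\<dots> = (T V ^^ ?m) (\<lambda>x. ?\<beta> ^ j * 1) x" unfolding fk_iter_cmult[OF V] ..
    also have "\<dots> \<le> (T V ^^ ?m) ((T V ^^ (j * ?m)) (\<lambda>_. 1)) x"
      using Suc by (intro fk_iter_mono[OF V] fk_iter_continuous[OF V]) auto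
    also have "\<dots> = (T V ^^ (Suc j * ?m)) (\<lambda>_. 1) x" by (simp add: funpow_add)
    finally show ?case .
  qed simp
  have "ln ?\<beta> / real ?m \<le> \<Lambda> V"
  proof (rule pressure_greatest[OF V])
    fix i :: nat assume "i \<ge> 1"
    have "?\<beta> ^ i \<le> M V (i * ?m)" using pow growth_upper[OF V] order_trans by blast
    also have "\<dots> \<le> M V i ^ ?m" using growth_power[OF V, of ?m i] by (simp add: mult.commute)
    finally have "ln (?\<beta> ^ i) \<le> ln (M V i ^ ?m)" using \<beta> growth_pos[OF V, of i] by (intro ln_mono) auto
    then have "real i * ln ?\<beta> \<le> real ?m * ln (M V i)" using \<beta> growth_pos[OF V, of i] by (simp only: ln_realpow)
    then show "ln ?\<beta> / real ?m * real i \<le> ln (M V i)" using n0 by (simp add: field_simps)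
  qed
  then have "ln ?\<beta> \<le> real ?m * \<Lambda> V" using n0 by (simp add: field_simps)
  then have "?\<beta> \<le> exp (real ?m * \<Lambda> V)" using \<beta> by (metis exp_le_cancel_iff exp_ln)
  then have "p * a n * exp (real n * \<Lambda> V) \<le> 2 * exp (real N * \<Lambda> V) * exp (real n * \<Lambda> V)"
    unfolding M_a by (simp add: exp_add distrib_right)
  then have "a n \<le> 2 * exp (real N * \<Lambda> V) / p" using p by (simp add: field_simps)
  then show False using n by (simp add: B_def)
qed

text \<open>With the growth bounded from above, the Lipschitz estimate becomes uniform in \<open>n\<close>. Since the
  supremum of the normalized iterates is at least 1, they are at least \<open>1/2\<close> on a ball of fixed radius, and
  irreducibility spreads this bound over the whole space \<open>N\<close> steps later; the first \<open>N\<close> iterates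
  are bounded below trivially.\<close>

lemma normalized_estimates:
  defines "U \<equiv> feynman_kac P (\<lambda>x. V x - \<Lambda> V)"
  obtains c A L where "0 < c" "0 \<le> L" "\<And>n x. c \<le> (U ^^ n) (\<lambda>_. 1) x" "\<And>n x. (U ^^ n) (\<lambda>_. 1) x \<le> A"
    "\<And>f F k n x y. continuous_on UNIV f \<Longrightarrow> (\<And>z. \<bar>f z\<bar> \<le> F) \<Longrightarrow> 0 \<le> k \<Longrightarrow>
       (\<And>z w. \<bar>f z - f w\<bar> \<le> k * dist z w) \<Longrightarrow> \<bar>(U ^^ n) f x - (U ^^ n) f y\<bar> \<le> L * (F + k) * dist x y"
proof -
  note V = V_continuous
  have U: "(U ^^ n) f x = exp (- (real n * \<Lambda> V)) * (T V ^^ n) f x" for n f x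
    unfolding U_def by (rule fk_shift[OF V])
  obtain A where A: "\<And>n. M V n \<le> A * exp (real n * \<Lambda> V)" using growth_bounded by blast
  have A1: "1 \<le> A" using A[of 0] growth_0[OF V] by simp
  have upper: "(U ^^ n) (\<lambda>_. 1) x \<le> A" for n x
    using growth_upper[OF V, of n x] A[of n] unfolding U by (simp add: exp_minus field_simps)
  define L where "L = K * exp (- \<Lambda> V) * A * A / (1 - q) + A + 1"
  have L0: "0 < L" unfolding L_def using K_nonneg A1 q_less_1 by (intro add_nonneg_pos) auto
  have q1: "q ^ n \<le> 1" for n using q_nonneg q_less_1 by (simp add: power_le_one)
  have lip: "\<bar>(U ^^ n) f x - (U ^^ n) f y\<bar> \<le> L * (F + k) * dist x y"
    if f: "continuous_on UNIV f" "\<And>z. \<bar>f z\<bar> \<le> F" "0 \<le> k" "\<And>z w. \<bar>f z - f w\<bar> \<le> k * dist z w"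
    for f F k n x y
  proof -
    have F0: "0 \<le> F" using f(2)[of undefined] by linarith
    have "\<bar>(T V ^^ n) f x - (T V ^^ n) f y\<bar>
      \<le> (K * F * (\<Sum>k<n. q ^ k * M V (n - 1 - k) * M V k) + q ^ n * k * M V n) * dist x y"
      by (rule lipschitz_iter) (use f in auto)
    also have "\<dots> \<le> (exp (real n * \<Lambda> V) * (L * (F + k))) * dist x y"
    proof (rule mult_right_mono)
      have "(\<Sum>k<n. q ^ k * M V (n - 1 - k) * M V k) \<le> (\<Sum>k<n. q ^ k * (exp (- \<Lambda> V) * exp (real n * \<Lambda> V) * A * A))"
      proof (rule sum_mono)
        fix k assume "k \<in> {..<n}"
        then have k: "k < n" by simp
        have "M V (n - 1 - k) * M V k \<le> (A * exp (real (n - 1 - k) * \<Lambda> V)) * (A * exp (real k * \<Lambda> V))"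
          using A A1 growth_pos[OF V] by (intro mult_mono) (auto simp: less_imp_le)
        also have "\<dots> = exp (- \<Lambda> V) * exp (real n * \<Lambda> V) * A * A"
          using k by (simp add: exp_add[symmetric] of_nat_diff algebra_simps)
        finally show "q ^ k * M V (n - 1 - k) * M V k \<le> q ^ k * (exp (- \<Lambda> V) * exp (real n * \<Lambda> V) * A * A)"
          using q_nonneg by (simp add: mult.assoc mult_left_mono)
      qed
      also have "\<dots> = (\<Sum>k<n. q ^ k) * (exp (- \<Lambda> V) * exp (real n * \<Lambda> V) * A * A)"
        by (simp add: sum_distrib_right)
      also have "\<dots> \<le> (1 / (1 - q)) * (exp (- \<Lambda> V) * exp (real n * \<Lambda> V) * A * A)"
      proof (rule mult_right_mono)
        have "(\<Sum>k<n. q ^ k) = (1 - q ^ n) / (1 - q)" using q_less_1 by (simp add: sum_gp_strict)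
        also have "\<dots> \<le> 1 / (1 - q)" using q_less_1 q_nonneg by (intro divide_right_mono) auto
        finally show "(\<Sum>k<n. q ^ k) \<le> 1 / (1 - q)" .
      qed (use A1 in auto)
      finally have s: "(\<Sum>k<n. q ^ k * M V (n - 1 - k) * M V k) \<le> (1 / (1 - q)) * (exp (- \<Lambda> V) * exp (real n * \<Lambda> V) * A * A)" .
      have "K * F * (\<Sum>k<n. q ^ k * M V (n - 1 - k) * M V k) + q ^ n * k * M V n
        \<le> K * F * ((1 / (1 - q)) * (exp (- \<Lambda> V) * exp (real n * \<Lambda> V) * A * A)) + 1 * k * (A * exp (real n * \<Lambda> V))"
        using s K_nonneg F0 f(3) q1 A growth_pos[OF V, of n] q_nonneg A1
        by (intro add_mono mult_left_mono mult_mono) auto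
      also have "\<dots> = exp (real n * \<Lambda> V) * ((K * exp (- \<Lambda> V) * A * A / (1 - q)) * F + A * k)"
        by (simp add: algebra_simps)
      also have "\<dots> \<le> exp (real n * \<Lambda> V) * (L * F + L * k)"
        using F0 f(3) A1 K_nonneg q_less_1
        by (intro mult_left_mono add_mono mult_right_mono) (auto simp: L_def)
      finally show "K * F * (\<Sum>k<n. q ^ k * M V (n - 1 - k) * M V k) + q ^ n * k * M V n
        \<le> exp (real n * \<Lambda> V) * (L * (F + k))" by (simp add: distrib_left)
    qed auto
    finally have "exp (- (real n * \<Lambda> V)) * \<bar>(T V ^^ n) f x - (T V ^^ n) f y\<bar>
      \<le> exp (- (real n * \<Lambda> V)) * ((exp (real n * \<Lambda> V) * (L * (F + k))) * dist x y)"
      by (intro mult_left_mono) auto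
    also have "\<dots> = L * (F + k) * dist x y"
      by (simp add: exp_minus)
    finally show ?thesis
      unfolding U right_diff_distrib[symmetric] abs_mult by simp
  qed
  have U_cont: "continuous_on UNIV (\<lambda>x. V x - \<Lambda> V)" using V by (intro continuous_intros)
  obtain N p where p: "0 < p" "\<And>g y a x. continuous_on UNIV g \<Longrightarrow> (\<And>z. 0 \<le> g z) \<Longrightarrow>
      0 \<le> a \<Longrightarrow> (\<And>z. dist y z < 1 / (2 * L) \<Longrightarrow> a \<le> g z) \<Longrightarrow> p * a \<le> (U ^^ N) g x"
    using fk_doeblin[OF U_cont, of "1 / (2 * L)"] L0 unfolding U_def
    by (metis divide_pos_pos mult_pos_pos zero_less_numeral zero_less_one)
  have large: "p / 2 \<le> (U ^^ (N + n)) (\<lambda>_. 1) x" for n x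
  proof -
    obtain y where y: "(T V ^^ n) (\<lambda>_. 1) y = M V n" using growth_attained[OF V] by blast
    have y1: "1 \<le> (U ^^ n) (\<lambda>_. 1) y"
      unfolding U y using exp_pressure_le_growth[OF V, of n] by (simp add: exp_minus field_simps)
    have "p * (1 / 2) \<le> (U ^^ N) ((U ^^ n) (\<lambda>_. 1)) x"
    proof (rule p(2))
      show "continuous_on UNIV ((U ^^ n) (\<lambda>_. 1))"
        unfolding U_def by (intro fk_iter_continuous U_cont) auto
      show "0 \<le> (U ^^ n) (\<lambda>_. 1) z" for z
        using fk_iter_one_pos[OF V, of n z] by (simp add: U less_imp_le)
      fix z assume z: "dist y z < 1 / (2 * L)"
      have "\<bar>(U ^^ n) (\<lambda>_. 1) y - (U ^^ n) (\<lambda>_. 1) z\<bar> \<le> L * (1 + 0) * dist y z"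
        by (rule lip) auto
      also have "\<dots> \<le> L * (1 + 0) * (1 / (2 * L))" using z L0 by (intro mult_left_mono) auto
      also have "\<dots> = 1 / 2" using L0 by simp
      finally show "1 / 2 \<le> (U ^^ n) (\<lambda>_. 1) z" using y1 by linarith
    qed auto
    then show ?thesis by (simp add: funpow_add)
  qed
  obtain b' where b': "\<And>x. \<bar>V x - \<Lambda> V\<bar> \<le> b'" "0 \<le> b'" using bounded_by[OF U_cont] by blast
  have small: "exp (- (real N * b')) \<le> (U ^^ n) (\<lambda>_. 1) x" if "n < N" for n x
  proof -
    have "exp (- (real n * b')) \<le> (U ^^ n) (\<lambda>_. 1) x"
      unfolding U_def by (rule fk_iter_one_lower[OF U_cont b'(1)])
    moreover have "exp (- (real N * b')) \<le> exp (- (real n * b'))"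
      using that b'(2) by (simp add: mult_right_mono)
    ultimately show ?thesis by linarith
  qed
  show thesis
  proof (rule that[OF _ less_imp_le[OF L0] _ upper lip])
    show "0 < min (p / 2) (exp (- (real N * b')))" using p by simp
    show "min (p / 2) (exp (- (real N * b'))) \<le> (U ^^ n) (\<lambda>_. 1) x" for n x
    proof (cases "n < N")
      case True then show ?thesis using small[of n x] by simp
    next
      case False then show ?thesis using large[of "n - N" x] by (simp add: min.coboundedI1)
    qed
  qed
qed

end

end

section \<open>Eigenfunctions and differentiability of the pressure\<close>

context squeezing_kernel
begin

lemma pressure_zero: "pressure P (\<lambda>_. 0) = 0"
proof -
  have c: "continuous_on UNIV (\<lambda>_::'a. 0::real)" by simp
  have "growth P (\<lambda>_. 0) n = 1" for n
    using growth_lower_exp[OF c, of 0 n] growth_upper_exp[OF c, of 0 n] by simp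
  then show ?thesis
    using pressure_least[OF c, of 1 0] pressure_greatest[OF c, of 0] by (intro antisym) auto
qed

lemma pressure_mono:
  assumes V: "continuous_on UNIV V" and V': "continuous_on UNIV V'" and le: "\<And>x. V' x \<le> V x + d"
  shows "pressure P V' \<le> pressure P V + d"
proof -
  have "pressure P V' - d \<le> pressure P V"
  proof (rule pressure_greatest[OF V])
    fix n :: nat assume n: "n \<ge> 1"
    obtain x where x: "(T V' ^^ n) (\<lambda>_. 1) x = growth P V' n" using growth_attained[OF V'] by blast
    have "growth P V' n \<le> exp (real n * d) * (T V ^^ n) (\<lambda>_. 1) x"
      unfolding x[symmetric] by (intro fk_potential_mono[OF V V' le]) auto
    also have "\<dots> \<le> exp (real n * d) * growth P V n" by (intro mult_left_mono growth_upper V) auto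
    finally have "ln (growth P V' n) \<le> ln (exp (real n * d) * growth P V n)"
      using growth_pos[OF V', of n] by (intro ln_mono) auto
    also have "\<dots> = real n * d + ln (growth P V n)" using growth_pos[OF V, of n] by (simp add: ln_mult)
    finally have "ln (growth P V' n) \<le> real n * d + ln (growth P V n)" .
    moreover have "real n * pressure P V' \<le> ln (growth P V' n)"
      using pressure_le[OF V' n] n by (simp add: field_simps)
    ultimately show "(pressure P V' - d) * real n \<le> ln (growth P V n)" by (simp add: algebra_simps)
  qed
  then show ?thesis by simp
qed

lemma pressure_le_of_supersolution:
  assumes V: "continuous_on UNIV V" and f: "continuous_on UNIV f" "0 < c" "\<And>x. c \<le> f x"
    and le: "\<And>x. T V f x \<le> exp a * f x"
  shows "pressure P V \<le> a"
proof -
  obtain b where b: "\<And>x. \<bar>f x\<bar> \<le> b" using bounded_by[OF f(1)] by blast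
  have iter: "(T V ^^ n) f x \<le> exp (real n * a) * f x" for n x
  proof (induction n arbitrary: x)
    case (Suc n)
    have "T V ((T V ^^ n) f) x \<le> T V (\<lambda>x. exp (real n * a) * f x) x"
      using Suc by (intro fk_mono[OF V] fk_iter_continuous[OF V] continuous_intros f)
    also have "\<dots> = exp (real n * a) * T V f x" by (rule fk_cmult[OF V])
    also have "\<dots> \<le> exp (real n * a) * (exp a * f x)" by (intro mult_left_mono le) auto
    finally show ?case by (simp add: exp_add distrib_right distrib_left mult_ac)
  qed simp
  show ?thesis
  proof (rule pressure_least[OF V])
    fix n
    obtain x where x: "(T V ^^ n) (\<lambda>_. 1) x = growth P V n" using growth_attained[OF V] by blast
    have "c * growth P V n = (T V ^^ n) (\<lambda>x. c * 1) x" unfolding fk_iter_cmult[OF V] x ..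
    also have "\<dots> \<le> (T V ^^ n) f x" using f by (intro fk_iter_mono[OF V]) auto
    also have "\<dots> \<le> exp (real n * a) * f x" by (rule iter)
    also have "\<dots> \<le> exp (real n * a) * b" using b[of x] by (intro mult_left_mono) auto
    finally show "growth P V n \<le> b / c * exp (real n * a)" using f(2) by (simp add: field_simps)
  qed
qed

context
  fixes V :: "'a \<Rightarrow> real" and l :: real
  assumes V_lipschitz: "\<And>x y. \<bar>V x - V y\<bar> \<le> l * dist x y" and l_nonneg: "0 \<le> l"
begin

lemmas cont_V = lipschitz_imp_continuous[OF V_lipschitz l_nonneg]

abbreviation "U \<equiv> feynman_kac P (\<lambda>x. V x - pressure P V)"

lemma cont_V_normalized: "continuous_on UNIV (\<lambda>x. V x - pressure P V)"
  using cont_V by (intro continuous_intros)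

lemmas U_rules = fk_continuous[OF cont_V_normalized] fk_iter_continuous[OF cont_V_normalized]

lemma normalized_estimates_lipschitz:
  obtains c A L where "0 < c" "0 \<le> L" "\<And>n x. c \<le> (U ^^ n) (\<lambda>_. 1) x" "\<And>n x. (U ^^ n) (\<lambda>_. 1) x \<le> A"
    "\<And>f F k n x y. continuous_on UNIV f \<Longrightarrow> (\<And>z. \<bar>f z\<bar> \<le> F) \<Longrightarrow> 0 \<le> k \<Longrightarrow>
       (\<And>z w. \<bar>f z - f w\<bar> \<le> k * dist z w) \<Longrightarrow> \<bar>(U ^^ n) f x - (U ^^ n) f y\<bar> \<le> L * (F + k) * dist x y"
proof -
  obtain b where b: "\<And>x. \<bar>V x\<bar> \<le> b" using bounded_by[OF cont_V] by blast
  show thesis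
    by (rule normalized_estimates[OF V_lipschitz l_nonneg b]) (rule that; blast)
qed

text \<open>The upper limit of the normalized iterates of 1 is a subsolution \<open>h0 \<le> U h0\<close> by dominated convergence; iterating
  \<open>U\<close> increases it, within bounds, to a fixed point. The equi-Lipschitz estimates make all functions that occur continuous.\<close>

lemma eigenfunction:
  obtains h c k where "\<And>x y. \<bar>h x - h y\<bar> \<le> k * dist x y" "0 \<le> k" "0 < c" "\<And>x. c \<le> h x" "U h = h"
proof -
  obtain c A L where est: "0 < c" "0 \<le> L" "\<And>n x. c \<le> (U ^^ n) (\<lambda>_. 1) x" "\<And>n x. (U ^^ n) (\<lambda>_. 1) x \<le> A"
    "\<And>f F k n x y. continuous_on UNIV f \<Longrightarrow> (\<And>z. \<bar>f z\<bar> \<le> F) \<Longrightarrow> 0 \<le> k \<Longrightarrow>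
       (\<And>z w. \<bar>f z - f w\<bar> \<le> k * dist z w) \<Longrightarrow> \<bar>(U ^^ n) f x - (U ^^ n) f y\<bar> \<le> L * (F + k) * dist x y"
    using normalized_estimates_lipschitz by metis
  note W = cont_V_normalized
  define f where "f n = (U ^^ n) (\<lambda>_. 1)" for n
  have f_bounds: "c \<le> f n x" "f n x \<le> A" for n x unfolding f_def by (rule est(3), rule est(4))
  have fc: "continuous_on UNIV (f n)" for n unfolding f_def by (intro U_rules) auto
  have f_lip: "\<bar>f n x - f n y\<bar> \<le> L * dist x y" for n x y
  proof -
    have "\<bar>f n x - f n y\<bar> \<le> L * (1 + 0) * dist x y" unfolding f_def by (rule est(5)) auto
    then show ?thesis by simp
  qed
  have A0: "0 < A" using f_bounds[of 0 undefined] est(1) by linarith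
  \<comment> \<open>\<open>s m\<close> decreases to the upper limit, and \<open>U (s m) \<ge> s (Suc m)\<close>.\<close>
  define s where "s m x = (SUP n\<in>{m..}. f n x)" for m x
  have bdd: "bdd_above ((\<lambda>n. f n x) ` {m..})" for m x using f_bounds by (auto intro!: bdd_aboveI[of _ A])
  have s_upper: "f n x \<le> s m x" if "m \<le> n" for n m x
    unfolding s_def by (rule cSUP_upper[OF _ bdd]) (use that in auto)
  have s_least: "s m x \<le> t" if "\<And>n. m \<le> n \<Longrightarrow> f n x \<le> t" for m x t
    unfolding s_def by (rule cSUP_least) (use that in auto)
  have s_bounds: "c \<le> s m x" "s m x \<le> A" for m x
    using order_trans[OF f_bounds(1) s_upper[of m m x]] s_least[of m x A] f_bounds by auto
  have s_lip: "\<bar>s m x - s m y\<bar> \<le> L * dist x y" for m x y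
  proof -
    have "s m x \<le> s m y + L * dist x y" for x y
    proof (rule s_least)
      fix n assume "m \<le> n"
      then show "f n x \<le> s m y + L * dist x y"
        using f_lip[of n x y] s_upper[of m n y] by linarith
    qed
    from this[of x y] this[of y x] show ?thesis by (simp add: dist_commute abs_le_iff)
  qed
  have sc: "continuous_on UNIV (s m)" for m by (rule lipschitz_imp_continuous[OF s_lip est(2)])
  have s_dec: "decseq (\<lambda>m. s m x)" for x
    by (rule decseq_SucI) (auto intro!: s_least s_upper)
  have "convergent (\<lambda>m. s m x)" for x
    by (rule decseq_convergent[OF s_dec, of c]) (use s_bounds convergentI in auto)
  then have s_lim: "(\<lambda>m. s m x) \<longlonglongrightarrow> lim (\<lambda>m. s m x)" for x by (simp add: convergent_LIMSEQ_iff)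
  define h0 where "h0 x = lim (\<lambda>m. s m x)" for x
  note s_lim = s_lim[folded h0_def]
  have h0_le: "h0 x \<le> s m x" for x m unfolding h0_def using s_dec s_lim[unfolded h0_def] by (rule decseq_ge)
  have h0_bounds: "c \<le> h0 x" "h0 x \<le> A" for x
    using LIMSEQ_le_const[OF s_lim] h0_le[of x 0] s_bounds[of 0 x] s_bounds by (fastforce, linarith)
  have lip_lim: "\<bar>g x - g y\<bar> \<le> k * dist x y"
    if "\<And>n. \<bar>G n x - G n y\<bar> \<le> k * dist x y" "\<And>x. (\<lambda>n. G n x) \<longlonglongrightarrow> g x" for G g k and x y :: 'a
    by (rule LIMSEQ_le_const2[OF tendsto_rabs[OF tendsto_diff[OF that(2) that(2)]]]) (use that(1) in auto)
  have h0_lip: "\<bar>h0 x - h0 y\<bar> \<le> L * dist x y" for x y by (rule lip_lim[OF s_lip s_lim])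
  have h0c: "continuous_on UNIV h0" by (rule lipschitz_imp_continuous[OF h0_lip est(2)])
  have sub: "h0 x \<le> U h0 x" for x
  proof (rule LIMSEQ_le_const)
    show "(\<lambda>m. U (s m) x) \<longlonglongrightarrow> U h0 x"
      by (rule fk_dominated_convergence[OF W sc h0c _ s_lim, of A])
        (use s_bounds in \<open>simp add: abs_le_iff, smt (verit, best) est(1)\<close>)
    have "h0 x \<le> U (s m) x" for m
    proof (rule order_trans[OF h0_le[of x "Suc m"]], rule s_least)
      fix n assume n: "Suc m \<le> n"
      have "f n x = U (f (n - 1)) x" using n by (cases n) (auto simp: f_def)
      also have "\<dots> \<le> U (s m) x" using n by (intro fk_mono[OF W] fc sc s_upper) auto
      finally show "f n x \<le> U (s m) x" .
    qed
    then show "\<exists>N. \<forall>n\<ge>N. h0 x \<le> U (s n) x" by blast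
  qed
  define g where "g n = (U ^^ n) h0" for n
  have gc: "continuous_on UNIV (g n)" for n unfolding g_def by (intro U_rules h0c)
  have abs_h0: "\<bar>h0 x\<bar> \<le> A" for x using h0_bounds[of x] est(1) by simp
  have g_step: "g n x \<le> g (Suc n) x" for n x
  proof -
    have "g n x \<le> (U ^^ n) (U h0) x" unfolding g_def
      by (intro fk_iter_mono[OF W] U_rules h0c sub)
    then show ?thesis by (simp add: g_def funpow_swap1)
  qed
  then have g_inc: "incseq (\<lambda>n. g n x)" for x by (rule incseq_SucI)
  have g_lower: "c \<le> g n x" for n x
    using incseqD[OF g_inc[of x], of 0 n] h0_bounds[of x] by (simp add: g_def)
  have g_upper: "g n x \<le> A * A" for n x
  proof -
    have "\<bar>g n x\<bar> \<le> A * (U ^^ n) (\<lambda>_. 1) x" unfolding g_def by (rule fk_iter_bound[OF W h0c abs_h0])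
    also have "\<dots> \<le> A * A" using est(4) A0 by (intro mult_left_mono) auto
    finally show ?thesis by linarith
  qed
  have g_lip: "\<bar>g n x - g n y\<bar> \<le> (L * (A + L)) * dist x y" for n x y
    unfolding g_def by (rule est(5)[OF h0c abs_h0 est(2) h0_lip])
  have "convergent (\<lambda>n. g n x)" for x
    by (rule incseq_convergent[OF g_inc[of x], of "A * A"]) (use g_upper convergentI in auto)
  then have g_lim: "(\<lambda>n. g n x) \<longlonglongrightarrow> lim (\<lambda>n. g n x)" for x by (simp add: convergent_LIMSEQ_iff)
  define h where "h x = lim (\<lambda>n. g n x)" for x
  note g_lim = g_lim[folded h_def]
  have k0: "0 \<le> L * (A + L)" using est(2) A0 by simp
  have h_lip: "\<bar>h x - h y\<bar> \<le> (L * (A + L)) * dist x y" for x y by (rule lip_lim[OF g_lip g_lim])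
  have hc: "continuous_on UNIV h" by (rule lipschitz_imp_continuous[OF h_lip k0])
  have h_lower: "c \<le> h x" for x by (rule LIMSEQ_le_const[OF g_lim]) (use g_lower in auto)
  have "U h x = h x" for x
  proof (rule LIMSEQ_unique)
    show "(\<lambda>n. U (g n) x) \<longlonglongrightarrow> U h x"
    proof (rule fk_dominated_convergence[OF W gc hc _ g_lim])
      show "\<bar>g n x\<bar> \<le> A * A" for n x using g_upper[of n x] g_lower[of n x] est(1) by simp
    qed
    have "(\<lambda>n. g (Suc n) x) \<longlonglongrightarrow> h x" using g_lim by (rule LIMSEQ_Suc)
    then show "(\<lambda>n. U (g n) x) \<longlonglongrightarrow> h x" by (simp add: g_def)
  qed
  then show thesis using that[OF h_lip k0 est(1) h_lower] by auto
qed

text \<open>The functions \<open>\<phi> n\<close> are the iterates of \<open>W\<close> under a Markov operator, so their maximum decreases and their minimum increases.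
  They are equi-Lipschitz. If their oscillation stayed above \<open>\<eta>\<close>, each \<open>\<phi> n\<close> would stay \<open>\<eta> / 2\<close> below its upper bound on a ball of
  fixed radius, and by irreducibility \<open>N\<close> steps would lower the upper bound by a fixed amount \<open>\<kappa>\<close>, infinitely often.\<close>

lemma doob_transform_converges:
  assumes h: "\<And>x y. \<bar>h x - h y\<bar> \<le> k * dist x y" "0 \<le> k" "0 < c" "\<And>x. c \<le> h x" "U h = h"
    and W: "\<And>x y. \<bar>W x - W y\<bar> \<le> w * dist x y" "0 \<le> w"
  obtains m where "\<And>\<eta>. 0 < \<eta> \<Longrightarrow> \<exists>n. \<forall>x. \<bar>(U ^^ n) (\<lambda>x. h x * W x) x / h x - m\<bar> \<le> \<eta>"
proof -
  note Vn = cont_V_normalized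
  obtain c1 A1 L where L: "0 \<le> L" 
    "\<And>f F k n x y. continuous_on UNIV f \<Longrightarrow> (\<And>z. \<bar>f z\<bar> \<le> F) \<Longrightarrow> 0 \<le> k \<Longrightarrow>
       (\<And>z w. \<bar>f z - f w\<bar> \<le> k * dist z w) \<Longrightarrow> \<bar>(U ^^ n) f x - (U ^^ n) f y\<bar> \<le> L * (F + k) * dist x y"
    using normalized_estimates_lipschitz by metis
  have hc: "continuous_on UNIV h" and Wc: "continuous_on UNIV W"
    using lipschitz_imp_continuous h W by blast+
  have hpos: "0 < h x" for x using h(3) h(4)[of x] by linarith
  obtain H where H: "\<And>x. \<bar>h x\<bar> \<le> H" "0 \<le> H" using bounded_by[OF hc] by blast
  obtain B where B: "\<And>x. \<bar>W x\<bar> \<le> B" "0 \<le> B" using bounded_by[OF Wc] by blast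
  have H': "0 < H" using H(1)[of undefined] hpos[of undefined] by linarith
  define \<phi> where "\<phi> n x = (U ^^ n) (\<lambda>x. h x * W x) x / h x" for n x
  have \<phi>c: "continuous_on UNIV (\<phi> n)" for n
    unfolding \<phi>_def using hpos hc Wc
    by (intro continuous_intros U_rules) (auto simp: less_imp_neq[symmetric])
  have h\<phi>: "h x * \<phi> n x = (U ^^ n) (\<lambda>x. h x * W x) x" for n x using hpos[of x] by (simp add: \<phi>_def)
  have Uh: "(U ^^ n) h = h" for n by (induction n) (auto simp: h(5))
  have step: "h x * \<phi> (n + j) x = (U ^^ j) (\<lambda>x. h x * \<phi> n x) x" for n j x
    unfolding h\<phi> by (simp add: funpow_add add.commute[of n])
  have upper: "\<phi> (n + j) x \<le> b" if "\<And>x. \<phi> n x \<le> b" for n j x b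
  proof -
    have "h x * \<phi> (n + j) x \<le> (U ^^ j) (\<lambda>x. b * h x) x"
      unfolding step using that hpos
      by (intro fk_iter_mono[OF Vn] continuous_intros hc \<phi>c) (simp add: less_imp_le mult.commute mult_right_mono)
    also have "\<dots> = h x * b" unfolding fk_iter_cmult[OF Vn] Uh by simp
    finally show ?thesis using hpos[of x] by simp
  qed
  have lower: "a \<le> \<phi> (n + j) x" if "\<And>x. a \<le> \<phi> n x" for n j x a
  proof -
    have "h x * a = (U ^^ j) (\<lambda>x. a * h x) x" unfolding fk_iter_cmult[OF Vn] Uh by simp
    also have "\<dots> \<le> h x * \<phi> (n + j) x"
      unfolding step using that hpos
      by (intro fk_iter_mono[OF Vn] continuous_intros hc \<phi>c) (simp add: less_imp_le mult.commute mult_right_mono)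
    finally show ?thesis using hpos[of x] by simp
  qed
  have \<phi>0: "\<phi> 0 x = W x" for x using hpos[of x] by (simp add: \<phi>_def)
  have \<phi>_bound: "\<bar>\<phi> n x\<bar> \<le> B" for n x
    using upper[of 0 B n x] lower[of "-B" 0 n x] B(1) by (auto simp: \<phi>0 abs_le_iff minus_le_iff)
  have "\<exists>D\<ge>0. \<forall>n x y. \<bar>\<phi> n x - \<phi> n y\<bar> \<le> D * dist x y"
  proof -
    have hW: "continuous_on UNIV (\<lambda>x. h x * W x)" by (intro continuous_intros hc Wc)
    have hWb: "\<bar>h x * W x\<bar> \<le> H * B" for x
      unfolding abs_mult using H B by (intro mult_mono) auto
    have hWl: "\<bar>h x * W x - h y * W y\<bar> \<le> (H * w + B * k) * dist x y" for x y
    proof -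
      have "h x * W x - h y * W y = h x * (W x - W y) + W y * (h x - h y)" by (simp add: algebra_simps)
      then have "\<bar>h x * W x - h y * W y\<bar> \<le> \<bar>h x\<bar> * \<bar>W x - W y\<bar> + \<bar>W y\<bar> * \<bar>h x - h y\<bar>"
        by (metis abs_triangle_ineq abs_mult)
      also have "\<dots> \<le> H * (w * dist x y) + B * (k * dist x y)"
        using H B W h by (intro add_mono mult_mono) auto
      finally show ?thesis by (simp add: algebra_simps)
    qed
    define D' where "D' = L * (H * B + (H * w + B * k))"
    have D'0: "0 \<le> D'" unfolding D'_def using L H B W(2) h(2) by simp
    have ulip: "\<bar>h x * \<phi> n x - h y * \<phi> n y\<bar> \<le> D' * dist x y" for n x y
      unfolding h\<phi> D'_def
      by (rule L(2)[OF hW hWb _ hWl]) (use H B W(2) h(2) in auto)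
    have "\<bar>\<phi> n x - \<phi> n y\<bar> \<le> ((D' + B * k) / c) * dist x y" for n x y
    proof -
      have "h x * (\<phi> n x - \<phi> n y) = (h x * \<phi> n x - h y * \<phi> n y) - \<phi> n y * (h x - h y)"
        by (simp add: algebra_simps)
      then have "h x * \<bar>\<phi> n x - \<phi> n y\<bar> \<le> \<bar>h x * \<phi> n x - h y * \<phi> n y\<bar> + \<bar>\<phi> n y\<bar> * \<bar>h x - h y\<bar>"
        using hpos[of x] by (metis abs_mult abs_of_pos abs_triangle_ineq4)
      also have "\<dots> \<le> D' * dist x y + B * (k * dist x y)"
        using ulip \<phi>_bound B h by (intro add_mono mult_mono) auto
      finally have "h x * \<bar>\<phi> n x - \<phi> n y\<bar> \<le> (D' + B * k) * dist x y" by (simp add: algebra_simps)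
      moreover have "c * \<bar>\<phi> n x - \<phi> n y\<bar> \<le> h x * \<bar>\<phi> n x - \<phi> n y\<bar>"
        using h(4) by (intro mult_right_mono) auto
      ultimately show ?thesis using h(3) by (simp add: field_simps)
    qed
    moreover have "0 \<le> (D' + B * k) / c" using D'0 B h by simp
    ultimately show ?thesis by blast
  qed
  then obtain D where D: "0 \<le> D" "\<And>n x y. \<bar>\<phi> n x - \<phi> n y\<bar> \<le> D * dist x y" by blast
  have osc: "\<exists>n a b. b - a \<le> \<eta> \<and> (\<forall>x. a \<le> \<phi> n x \<and> \<phi> n x \<le> b)" if \<eta>: "0 < \<eta>" for \<eta>
  proof (rule ccontr)
    assume neg: "\<not> ?thesis"
    define \<epsilon> where "\<epsilon> = \<eta> / (2 * (D + 1))"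
    have \<epsilon>: "0 < \<epsilon>" using \<eta> D by (simp add: \<epsilon>_def)
    obtain N p where p: "0 < p" "\<And>g y a x. continuous_on UNIV g \<Longrightarrow> (\<And>z. 0 \<le> g z) \<Longrightarrow>
      0 \<le> a \<Longrightarrow> (\<And>z. dist y z < \<epsilon> \<Longrightarrow> a \<le> g z) \<Longrightarrow> p * a \<le> (U ^^ N) g x"
      using fk_doeblin[OF Vn \<epsilon>] by metis
    define \<kappa> where "\<kappa> = p * (c * (\<eta> / 2)) / H"
    have \<kappa>: "0 < \<kappa>" using p h(3) \<eta> H' by (simp add: \<kappa>_def)
    have dec: "\<phi> (n + N) x \<le> b - \<kappa>" if b: "\<And>x. \<phi> n x \<le> b" for n b x
    proof -
      obtain y where y: "\<And>z. \<phi> n y \<le> \<phi> n z" using attains_min[OF \<phi>c] by blast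
      have gap: "\<eta> < b - \<phi> n y" using neg b y by (metis not_le)
      have "p * (c * (\<eta> / 2)) \<le> (U ^^ N) (\<lambda>x. h x * (b - \<phi> n x)) x"
      proof (rule p(2))
        show "continuous_on UNIV (\<lambda>x. h x * (b - \<phi> n x))" by (intro continuous_intros hc \<phi>c)
        show "0 \<le> h z * (b - \<phi> n z)" for z using hpos[of z] b[of z] by simp
        show "0 \<le> c * (\<eta> / 2)" using h(3) \<eta> by simp
        fix z assume z: "dist y z < \<epsilon>"
        have "\<phi> n z - \<phi> n y \<le> D * dist y z" using D(2)[of n y z] by linarith
        also have "\<dots> \<le> (D + 1) * \<epsilon>" using z D by (intro mult_mono) auto
        also have "\<dots> = \<eta> / 2" using D by (simp add: \<epsilon>_def field_simps)
        finally have "\<eta> / 2 \<le> b - \<phi> n z" using gap by simp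
        then show "c * (\<eta> / 2) \<le> h z * (b - \<phi> n z)" using h(3,4) \<eta> hpos[of z] by (intro mult_mono) auto
      qed
      also have "(\<lambda>x. h x * (b - \<phi> n x)) = (\<lambda>x. b * h x + (-1) * (h x * \<phi> n x))"
        by (simp add: algebra_simps fun_eq_iff)
      also have "(U ^^ N) \<dots> x = b * h x - h x * \<phi> (n + N) x"
        unfolding step by (subst fk_iter_add[OF Vn])
          (auto intro!: continuous_intros hc \<phi>c simp: fk_iter_cmult[OF Vn] Uh fk_iter_cmult[OF Vn, where c="-1", simplified])
      finally have "p * (c * (\<eta> / 2)) \<le> h x * (b - \<phi> (n + N) x)" by (simp add: algebra_simps)
      moreover have "h x * (b - \<phi> (n + N) x) \<le> H * (b - \<phi> (n + N) x)"
        using H(1)[of x] upper[OF b, of N x] by (intro mult_right_mono) auto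
      ultimately have "\<kappa> \<le> b - \<phi> (n + N) x" unfolding \<kappa>_def using H' by (simp add: field_simps)
      then show ?thesis by simp
    qed
    have "\<phi> (j * N) x \<le> B - real j * \<kappa>" for j x
    proof (induction j arbitrary: x)
      case 0 then show ?case using B(1)[of x] by (simp add: \<phi>0)
    next
      case (Suc j)
      have "\<phi> (j * N + N) x \<le> B - real j * \<kappa> - \<kappa>" by (rule dec[OF Suc])
      then show ?case by (simp add: algebra_simps)
    qed
    moreover obtain j where "2 * B < real j * \<kappa>" using reals_Archimedean3[OF \<kappa>] by blast
    ultimately have "\<phi> (j * N) undefined \<le> B - real j * \<kappa>" "2 * B < real j * \<kappa>" by blast+
    then show False using \<phi>_bound[of "j * N" undefined] by linarith
  qed
  define t where "t n = (SUP x. \<phi> n x)" for n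
  have t_upper: "\<phi> n x \<le> t n" for n x
    unfolding t_def using \<phi>_bound by (intro cSUP_upper) (auto intro!: bdd_aboveI[of _ B] simp: abs_le_iff)
  have t_least: "t n \<le> b" if "\<And>x. \<phi> n x \<le> b" for n b
    unfolding t_def by (rule cSUP_least) (use that in auto)
  have t_bdd: "bdd_below (range t)"
  proof (rule bdd_belowI)
    fix y assume "y \<in> range t"
    then obtain n where "y = t n" by blast
    then show "- B \<le> y" using t_upper[of n undefined] \<phi>_bound[of n undefined] by linarith
  qed
  show thesis
  proof (rule that[of "INF n. t n"])
    fix \<eta> :: real assume "0 < \<eta>"
    then obtain n a b where n: "b - a \<le> \<eta>" "\<And>x. a \<le> \<phi> n x" "\<And>x. \<phi> n x \<le> b" using osc by blast
    have "(INF n. t n) \<le> b" by (rule order_trans[OF cINF_lower[OF t_bdd] t_least[OF n(3)]]) auto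
    moreover have "a \<le> (INF n. t n)"
    proof (rule cINF_greatest)
      fix j
      have "a \<le> \<phi> (n + j) undefined" by (rule lower[OF n(2)])
      also have "\<dots> = \<phi> (j + n) undefined" by (simp add: add.commute)
      also have "\<dots> \<le> t j" by (rule upper[OF t_upper])
      finally show "a \<le> t j" .
    qed auto
    ultimately have "\<bar>\<phi> n x - (INF n. t n)\<bar> \<le> \<eta>" for x
      using n(1) n(2,3)[of x] by linarith
    then show "\<exists>n. \<forall>x. \<bar>(U ^^ n) (\<lambda>x. h x * W x) x / h x - (INF n. t n)\<bar> \<le> \<eta>"
      unfolding \<phi>_def by blast
  qed
qed

text \<open>Only the upper bound is stated, for \<open>t\<close> of both signs; it identifies \<open>m\<close> as the derivative, since the pressure is convex.
  With \<open>s\<close> the sum of the first \<open>n\<close> iterates \<open>\<phi> j\<close> and \<open>g = s - W\<close>, the Markov operator maps \<open>s = W + g\<close> to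
  \<open>g + \<phi> n\<close>, which is \<open>g + m\<close> up to \<open>\<eta> / 2\<close>. So, to first order in \<open>t\<close>, it maps \<open>exp (t * (W + g))\<close> to
  \<open>exp (t * g)\<close> times \<open>exp (t * m)\<close>: the function \<open>h * exp (t * g)\<close> is a supersolution for \<open>V + t * W\<close>,
  with eigenvalue bounded by \<open>exp (pressure P V + t * m + \<bar>t\<bar> * \<eta>)\<close>.\<close>

theorem pressure_differentiable:
  assumes W: "\<And>x y. \<bar>W x - W y\<bar> \<le> w * dist x y" "0 \<le> w"
  obtains m where "\<And>\<eta>. 0 < \<eta> \<Longrightarrow> \<exists>\<delta>>0. \<forall>t. \<bar>t\<bar> \<le> \<delta> \<longrightarrow>
    pressure P (\<lambda>x. V x + t * W x) \<le> pressure P V + t * m + \<bar>t\<bar> * \<eta>"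
proof -
  note Vn = cont_V_normalized
  obtain h k c where h: "\<And>x y. \<bar>h x - h y\<bar> \<le> k * dist x y" "0 \<le> k" "0 < c" "\<And>x. c \<le> h x" "U h = h"
    by (rule eigenfunction) blast
  obtain m where m: "\<And>\<eta>. 0 < \<eta> \<Longrightarrow> \<exists>n. \<forall>x. \<bar>(U ^^ n) (\<lambda>x. h x * W x) x / h x - m\<bar> \<le> \<eta>"
    using doob_transform_converges[OF h W] by metis
  have hc: "continuous_on UNIV h" and Wc: "continuous_on UNIV W"
    using lipschitz_imp_continuous h W by blast+
  have hpos: "0 < h x" for x using h(3) h(4)[of x] by linarith
  show thesis
  proof (rule that[of m])
    fix \<eta> :: real assume \<eta>: "0 < \<eta>"
    then obtain n where n: "\<And>x. \<bar>(U ^^ n) (\<lambda>x. h x * W x) x / h x - m\<bar> \<le> \<eta> / 2"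
      using m[of "\<eta> / 2"] by auto
    define \<phi> where "\<phi> j x = (U ^^ j) (\<lambda>x. h x * W x) x / h x" for j x
    have \<phi>c: "continuous_on UNIV (\<phi> j)" for j
      unfolding \<phi>_def using hpos hc Wc
      by (intro continuous_intros U_rules) (auto simp: less_imp_neq[symmetric])
    have h\<phi>: "h x * \<phi> j x = (U ^^ j) (\<lambda>x. h x * W x) x" for j x using hpos[of x] by (simp add: \<phi>_def)
    have U\<phi>: "U (\<lambda>x. h x * \<phi> j x) x = h x * \<phi> (Suc j) x" for j x unfolding h\<phi> by simp
    define s where "s x = (\<Sum>j<n. \<phi> j x)" for x
    define g where "g x = s x - W x" for x
    have sc: "continuous_on UNIV s" unfolding s_def by (intro continuous_intros \<phi>c)
    have gc: "continuous_on UNIV g" unfolding g_def by (intro continuous_intros sc Wc)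
    have hs: "U (\<lambda>x. h x * s x) x = h x * (g x + \<phi> n x)" for x
    proof -
      have "U (\<lambda>x. h x * s x) x = U (\<lambda>x. \<Sum>j<n. 1 * (h x * \<phi> j x)) x"
        by (simp add: s_def sum_distrib_left)
      also have "\<dots> = (\<Sum>j<n. 1 * U (\<lambda>x. h x * \<phi> j x) x)"
        by (rule fk_sum[OF Vn]) (intro continuous_intros hc \<phi>c)
      also have "\<dots> = h x * (\<Sum>j<n. \<phi> (Suc j) x)" by (simp add: U\<phi> sum_distrib_left)
      also have "(\<Sum>j<n. \<phi> (Suc j) x) = (\<Sum>j<Suc n. \<phi> j x) - \<phi> 0 x"
        by (subst sum.lessThan_Suc_shift) simp
      also have "\<phi> 0 x = W x" using hpos[of x] by (simp add: \<phi>_def)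
      finally show ?thesis by (simp add: g_def s_def algebra_simps)
    qed
    obtain b where b: "\<And>x. \<bar>s x\<bar> \<le> b" "0 \<le> b" using bounded_by[OF sc] by blast
    define \<delta> where "\<delta> = min (1 / (b + 1)) (\<eta> / (2 * (b\<^sup>2 + 1)))"
    have \<delta>: "0 < \<delta>" unfolding \<delta>_def using b \<eta> by (auto intro!: divide_pos_pos add_nonneg_pos)
    have main: "pressure P (\<lambda>x. V x + t * W x) \<le> pressure P V + t * m + \<bar>t\<bar> * \<eta>" if t: "\<bar>t\<bar> \<le> \<delta>" for t
    proof -
      have t1: "\<bar>t * s x\<bar> \<le> 1" for x
      proof -
        have "\<bar>t * s x\<bar> \<le> (1 / (b + 1)) * b"
          unfolding abs_mult using t b by (intro mult_mono) (auto simp: \<delta>_def)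
        also have "\<dots> \<le> 1" using b by (simp add: field_simps)
        finally show ?thesis .
      qed
      have t2: "t\<^sup>2 * b\<^sup>2 \<le> \<bar>t\<bar> * (\<eta> / 2)"
      proof -
        have "\<bar>t\<bar> * b\<^sup>2 \<le> (\<eta> / (2 * (b\<^sup>2 + 1))) * (b\<^sup>2 + 1)"
          using t by (intro mult_mono) (auto simp: \<delta>_def)
        also have "\<dots> = \<eta> / 2"
        proof -
          have "b\<^sup>2 + 1 > 0" by (intro add_nonneg_pos) auto
          then show ?thesis by (simp add: field_simps)
        qed
        finally have "\<bar>t\<bar> * (\<bar>t\<bar> * b\<^sup>2) \<le> \<bar>t\<bar> * (\<eta> / 2)" by (intro mult_left_mono) auto
        then show ?thesis by (simp add: power2_eq_square flip: mult.assoc)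
      qed
      let ?\<Lambda> = "pressure P V"
      have Vt: "continuous_on UNIV (\<lambda>x. V x + t * W x)" by (intro continuous_intros cont_V Wc)
      define f where "f x = h x * exp (t * g x)" for x
      have fc: "continuous_on UNIV f" unfolding f_def by (intro continuous_intros hc gc)
      obtain z where z: "\<And>y. f z \<le> f y" using attains_min[OF fc] by blast
      have super: "T (\<lambda>x. V x + t * W x) f x \<le> exp (?\<Lambda> + t * m + \<bar>t\<bar> * \<eta>) * f x" for x
      proof -
        have "T (\<lambda>x. V x + t * W x) f x = exp ?\<Lambda> * U (\<lambda>y. h y * exp (t * s y)) x"
          unfolding feynman_kac_def f_def g_def
          by (simp add: exp_diff exp_add right_diff_distrib field_simps flip: integral_mult_right_zero)
        also have "U (\<lambda>y. h y * exp (t * s y)) x \<le> U (\<lambda>y. (1 + t\<^sup>2 * b\<^sup>2) * h y + t * (h y * s y)) x"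
        proof (rule fk_mono[OF Vn])
          fix y
          have "(t * s y)\<^sup>2 \<le> t\<^sup>2 * b\<^sup>2"
            unfolding power_mult_distrib using b by (intro mult_left_mono) (auto simp: abs_le_square_iff[symmetric])
          then have "exp (t * s y) \<le> 1 + t * s y + t\<^sup>2 * b\<^sup>2" using exp_le_quadratic[OF t1[of y]] by linarith
          then have "h y * exp (t * s y) \<le> h y * (1 + t * s y + t\<^sup>2 * b\<^sup>2)"
            using hpos[of y] by (intro mult_left_mono) auto
          then show "h y * exp (t * s y) \<le> (1 + t\<^sup>2 * b\<^sup>2) * h y + t * (h y * s y)" by (simp add: algebra_simps)
        qed (intro continuous_intros hc sc)+
        also have "\<dots> = (1 + t\<^sup>2 * b\<^sup>2) * h x + t * (h x * (g x + \<phi> n x))"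
          by (subst fk_add[OF Vn]) (auto intro!: continuous_intros hc sc simp: fk_cmult[OF Vn] h(5) hs)
        also have "\<dots> = h x * (1 + (t * g x + t * \<phi> n x + t\<^sup>2 * b\<^sup>2))" by (simp add: algebra_simps)
        also have "\<dots> \<le> h x * exp (t * g x + t * m + \<bar>t\<bar> * \<eta>)"
        proof (rule mult_left_mono)
          have "t * (\<phi> n x - m) \<le> \<bar>t\<bar> * \<bar>\<phi> n x - m\<bar>" by (metis abs_ge_self abs_mult)
          also have "\<dots> \<le> \<bar>t\<bar> * (\<eta> / 2)" using n[of x] by (intro mult_left_mono) (auto simp: \<phi>_def)
          finally have "t * g x + t * \<phi> n x + t\<^sup>2 * b\<^sup>2 \<le> t * g x + t * m + \<bar>t\<bar> * \<eta>"
            using t2 by (simp add: algebra_simps)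
          then have "1 + (t * g x + t * \<phi> n x + t\<^sup>2 * b\<^sup>2) \<le> 1 + (t * g x + t * m + \<bar>t\<bar> * \<eta>)" by simp
          also have "\<dots> \<le> exp (t * g x + t * m + \<bar>t\<bar> * \<eta>)" by (rule exp_ge_add_one_self)
          finally show "1 + (t * g x + t * \<phi> n x + t\<^sup>2 * b\<^sup>2) \<le> exp (t * g x + t * m + \<bar>t\<bar> * \<eta>)" .
        qed (use hpos[of x] in simp)
        finally show ?thesis by (simp add: f_def[abs_def] exp_add mult_ac)
      qed
      show ?thesis
        by (rule pressure_le_of_supersolution[OF Vt fc _ z super]) (simp add: f_def hpos)
    qed
    then show "\<exists>\<delta>>0. \<forall>t. \<bar>t\<bar> \<le> \<delta> \<longrightarrow>
      pressure P (\<lambda>x. V x + t * W x) \<le> pressure P V + t * m + \<bar>t\<bar> * \<eta>" using \<delta> by blast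
  qed
qed

lemma fk_iter_two_sided:
  obtains c A where "0 < c" "\<And>n x. c * exp (real n * pressure P V) \<le> (T V ^^ n) (\<lambda>_. 1) x"
    "\<And>n x. (T V ^^ n) (\<lambda>_. 1) x \<le> A * exp (real n * pressure P V)"
proof -
  obtain c A L where est: "0 < c" "\<And>n x. c \<le> (U ^^ n) (\<lambda>_. 1) x" "\<And>n x. (U ^^ n) (\<lambda>_. 1) x \<le> A"
    by (rule normalized_estimates_lipschitz) blast
  show thesis
  proof (rule that[OF est(1)])
    show "c * exp (real n * pressure P V) \<le> (T V ^^ n) (\<lambda>_. 1) x"
      and "(T V ^^ n) (\<lambda>_. 1) x \<le> A * exp (real n * pressure P V)" for n x
      using est(2)[of n x] est(3)[of n x] fk_shift[OF cont_V, where c="pressure P V" and n=n and f="\<lambda>_. 1" and x=x]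
      by (auto simp: exp_minus field_simps)
  qed
qed

end

end

section \<open>The random dynamical system\<close>

lemma continuous_map_empirical_measure:
  assumes comp: "compact (UNIV :: 'a::t2_space set)" and n: "n > 0"
  shows "continuous_map euclidean weak_star_topology (empirical_measure n :: (nat \<Rightarrow> 'a) \<Rightarrow> 'a measure)"
  unfolding weak_star_topology_def
proof (rule continuous_on_generated_topo)
  fix W assume "W \<in> {{\<sigma> \<in> prob_measures. integral\<^sup>L \<sigma> f \<in> U} | (f :: 'a \<Rightarrow> real) U.
        continuous_on UNIV f \<and> open U}"
  then obtain f :: "'a \<Rightarrow> real" and U where W: "W = {\<sigma> \<in> prob_measures. integral\<^sup>L \<sigma> f \<in> U}"
    "continuous_on UNIV f" "open U"
    by blast
  have "empirical_measure n -` W \<inter> topspace euclidean = (\<lambda>y. (\<Sum>k=1..n. f (y k)) / real n) -` U"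
    using empirical_measure_in_prob_measures[OF n] integral_empirical_measure[OF comp n W(2)]
    by (auto simp: W(1))
  moreover have "continuous_on UNIV (\<lambda>y :: nat \<Rightarrow> 'a. (\<Sum>k=1..n. f (y k)) / real n)"
    using n by (intro continuous_intros continuous_on_compose2[OF W(2)] continuous_on_product_coordinates) auto
  ultimately show "openin euclidean (empirical_measure n -` W \<inter> topspace euclidean)"
    using W(3) by (simp add: open_vimage)
next
  have "empirical_measure n y \<in> topspace weak_star_topology" for y :: "nat \<Rightarrow> 'a"
    using empirical_measure_in_prob_measures[OF n] by simp
  then show "empirical_measure n ` topspace euclidean \<subseteq> \<Union> {{\<sigma> \<in> prob_measures. integral\<^sup>L \<sigma> f \<in> U} | (f :: 'a \<Rightarrow> real) U.
        continuous_on UNIV f \<and> open U}"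
    unfolding weak_star_topology_def topology_generated_by_topspace by blast
qed

text \<open>The Borel structure on sequences is that of the countable product, so that measurability of the
  empirical measure of the random trajectory reduces to that of its coordinates.\<close>

lemma measurable_empirical_measure:
  assumes comp: "compact (UNIV :: 'a::polish_space set)" and n: "n > 0"
    and B: "B \<in> borel_sets_of (weak_star_topology :: 'a measure topology)"
  shows "empirical_measure n -` B \<in> sets (borel :: (nat \<Rightarrow> 'a) measure)"
  using B unfolding borel_sets_of_def
proof (induction rule: sigma_sets.induct)
  case (Basic a)
  then have "openin euclidean {y \<in> topspace euclidean. empirical_measure n y \<in> a}"
    by (intro openin_continuous_map_preimage[OF continuous_map_empirical_measure[OF comp n]]) auto
  then show ?case by (auto simp: vimage_def)
next
  case (Compl a)
  have "empirical_measure n -` (topspace weak_star_topology - a) = - (empirical_measure n -` a :: (nat \<Rightarrow> 'a) set)"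
    using empirical_measure_in_prob_measures[OF n] by auto
  then show ?case using Compl by (simp add: borel_comp)
next
  case (Union a)
  then show ?case by (auto simp: vimage_UN)
qed simp

locale random_dynamical_system =
  fixes S :: "'a::polish_space \<Rightarrow> 'e::polish_space \<Rightarrow> 'a"
    and M :: "'w measure"
    and \<eta> :: "nat \<Rightarrow> 'w \<Rightarrow> 'e"
  assumes compact_X: "compact (UNIV :: 'a set)"
    and iid: "iid_sequence M \<eta>"
    and cont: "continuous_on UNIV (\<lambda>(x, \<zeta>). S x \<zeta>)"

sublocale random_dynamical_system \<subseteq> prob_space M
  using iid by (simp add: iid_sequence_def)

context random_dynamical_system
begin

lemma indep: "indep_vars (\<lambda>_. borel) \<eta> UNIV"
  and noise_law: "distr M borel (\<eta> n) = distr M borel (\<eta> 0)"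
  using iid by (auto simp: iid_sequence_def)

lemma measurable_noise [measurable]: "\<eta> n \<in> borel_measurable M"
  using indep by (auto simp: indep_vars_def)

lemma measurable_S: "(\<lambda>p. S (fst p) (snd p)) \<in> borel_measurable (borel \<Otimes>\<^sub>M borel)"
  unfolding borel_prod using cont by (intro borel_measurable_continuous_onI) (simp add: case_prod_unfold)

lemma measurable_S' [measurable (raw)]:
  "f \<in> borel_measurable N \<Longrightarrow> g \<in> borel_measurable N \<Longrightarrow> (\<lambda>z. S (f z) (g z)) \<in> borel_measurable N"
  using measurable_compose[OF measurable_Pair measurable_S] by (simp only: fst_conv snd_conv)

lemma continuous_S: "continuous_on UNIV (\<lambda>x. S x \<zeta>)"
  by (rule continuous_on_compose2[OF cont, of UNIV "\<lambda>x. (x, \<zeta>)", simplified])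
    (auto intro!: continuous_intros)

abbreviation path :: "'a \<Rightarrow> 'w \<Rightarrow> nat \<Rightarrow> 'a" where
  "path x \<omega> \<equiv> orbit S (\<lambda>k. \<eta> k \<omega>) x"

lemma measurable_path_joint:
  assumes [measurable_cong]: "sets \<mu> = sets borel"
  shows "(\<lambda>z. path (fst z) (snd z) n) \<in> borel_measurable (\<mu> \<Otimes>\<^sub>M M)"
proof (induction n)
  case (Suc n)
  note [measurable] = Suc
  show ?case by simp
qed simp

lemma measurable_path [measurable]: "(\<lambda>\<omega>. path x \<omega> n) \<in> borel_measurable M"
  by (induction n) auto

abbreviation P :: "'a \<Rightarrow> 'a measure" where "P \<equiv> transition M \<eta> S 1"

lemma transition_one: "P x = distr M borel (\<lambda>\<omega>. S x (\<eta> 0 \<omega>))"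
  by (simp add: transition_def)

lemma transition_in_prob_measures: "transition M \<eta> S n x \<in> prob_measures"
  unfolding transition_def prob_measures_def by (auto intro!: prob_space_distr)

lemma integral_transition_one:
  fixes f :: "'a \<Rightarrow> real"
  assumes "continuous_on UNIV f"
  shows "(\<integral>y. f y \<partial>P x) = (\<integral>\<omega>. f (S x (\<eta> n \<omega>)) \<partial>M)"
proof -
  have [measurable]: "f \<in> borel_measurable borel" using assms by (rule borel_measurable_continuous_onI)
  have "(\<integral>y. f y \<partial>P x) = (\<integral>\<omega>. f (S x (\<eta> 0 \<omega>)) \<partial>M)"
    unfolding transition_one by (subst integral_distr) auto
  also have "\<dots> = (\<integral>\<zeta>. f (S x \<zeta>) \<partial>distr M borel (\<eta> 0))" by (subst integral_distr) auto
  also have "\<dots> = (\<integral>\<omega>. f (S x (\<eta> n \<omega>)) \<partial>M)" unfolding noise_law[of n, symmetric]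
    by (subst integral_distr) auto
  finally show ?thesis .
qed

lemma transition_feller:
  fixes f :: "'a \<Rightarrow> real"
  assumes f: "continuous_on UNIV f"
  shows "continuous_on UNIV (\<lambda>x. \<integral>y. f y \<partial>P x)"
  unfolding integral_transition_one[OF f, where n=0]
proof (rule continuous_on_sequentiallyI)
  fix u and a :: 'a assume u: "u \<longlonglongrightarrow> a"
  have [measurable]: "f \<in> borel_measurable borel" using f by (rule borel_measurable_continuous_onI)
  obtain b where b: "\<And>x. \<bar>f x\<bar> \<le> b" using continuous_bounded[OF compact_X f] by blast
  have fS: "isCont (\<lambda>x. f (S x \<zeta>)) a" for \<zeta>
    using continuous_on_compose2[OF f continuous_S] by (auto simp: continuous_on_eq_continuous_at)
  show "(\<lambda>n. \<integral>\<omega>. f (S (u n) (\<eta> 0 \<omega>)) \<partial>M) \<longlonglongrightarrow> (\<integral>\<omega>. f (S a (\<eta> 0 \<omega>)) \<partial>M)"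
    by (rule integral_dominated_convergence[where w="\<lambda>_. b"])
      (use b isCont_tendsto_compose[OF fS u] in auto)
qed

lemma orbit_cong: "(\<And>i. i < n \<Longrightarrow> g i = g' i) \<Longrightarrow> orbit S g x n = orbit S g' x n"
  by (induction n) auto

lemma measurable_orbit:
  "k \<le> n \<Longrightarrow> (\<lambda>g. orbit S g x k) \<in> borel_measurable (PiM {..<n} (\<lambda>_. borel))"
proof (induction k)
  case (Suc k)
  then have [measurable]: "(\<lambda>g. orbit S g x k) \<in> borel_measurable (PiM {..<n} (\<lambda>_. borel))" by simp
  have [measurable]: "(\<lambda>g. g k) \<in> borel_measurable (PiM {..<n} (\<lambda>_. borel :: 'e measure))"
    using Suc by (intro measurable_component_singleton) auto
  show ?case by simp
qed simp

definition weight :: "('a \<Rightarrow> real) \<Rightarrow> nat \<Rightarrow> (nat \<Rightarrow> 'a) \<Rightarrow> real" where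
  "weight V n y = exp (\<Sum>k=1..n. V (y k))"

text \<open>The last step is peeled off: \<open>\<eta> n\<close> is independent of the first \<open>n\<close> noise variables, which determine the path up to
  time \<open>n\<close>, so integrating it out replaces \<open>f\<close> by \<open>feynman_kac P V f\<close>.\<close>

lemma feynman_kac_formula:
  assumes V: "continuous_on UNIV V" and f: "continuous_on UNIV f"
  shows "(\<integral>\<omega>. weight V n (path x \<omega>) * f (path x \<omega> n) \<partial>M) = (feynman_kac P V ^^ n) f x"
  using f
proof (induction n arbitrary: f)
  case 0
  then show ?case by (simp add: weight_def prob_space)
next
  case (Suc n)
  have [measurable]: "V \<in> borel_measurable borel" "f \<in> borel_measurable borel"
    using V Suc.prems by (auto intro: borel_measurable_continuous_onI)
  obtain b where b: "\<And>x. \<bar>V x\<bar> \<le> b" "0 \<le> b" using continuous_bounded[OF compact_X V] by metis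
  obtain b' where b': "\<And>x. \<bar>f x\<bar> \<le> b'" "0 \<le> b'" using continuous_bounded[OF compact_X Suc.prems] by metis
  let ?PA = "PiM {..<n} (\<lambda>_. borel :: 'e measure)" and ?PB = "PiM {n} (\<lambda>_. borel :: 'e measure)"
  define X where "X \<omega> = restrict (\<lambda>i. \<eta> i \<omega>) {..<n}" for \<omega>
  define Y where "Y \<omega> = restrict (\<lambda>i. \<eta> i \<omega>) {n}" for \<omega>
  define h where "h g g' = weight V n (orbit S g x)
    * (exp (V (S (orbit S g x n) (g' n))) * f (S (orbit S g x n) (g' n)))" for g g' :: "nat \<Rightarrow> 'e"
  have ind: "indep_var ?PA X ?PB Y"
    unfolding X_def Y_def by (rule indep_var_restrict[OF indep]) auto
  have [measurable]: "X \<in> M \<rightarrow>\<^sub>M ?PA" using ind by (rule indep_var_rv1)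
  have [measurable]: "Y \<in> M \<rightarrow>\<^sub>M ?PB" using ind by (rule indep_var_rv2)
  have [measurable]: "(\<lambda>g. orbit S g x n) \<in> borel_measurable ?PA"
    by (rule measurable_orbit) simp
  have [measurable]: "(\<lambda>g. weight V n (orbit S g x)) \<in> borel_measurable ?PA"
  proof -
    have [measurable]: "(\<lambda>g. \<Sum>k=1..n. V (orbit S g x k)) \<in> borel_measurable ?PA"
      by (intro borel_measurable_sum measurable_compose[OF measurable_orbit]) auto
    show ?thesis unfolding weight_def by measurable
  qed
  have [measurable]: "(\<lambda>g. g n) \<in> borel_measurable ?PB"
    by (rule measurable_component_singleton) auto
  have orbit_X: "orbit S (X \<omega>) x k = path x \<omega> k" if "k \<le> n" for k \<omega>
    unfolding X_def using that by (intro orbit_cong) auto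
  have weight_X: "weight V n (orbit S (X \<omega>) x) = weight V n (path x \<omega>)" for \<omega>
    by (auto simp: orbit_X weight_def intro!: sum.cong)
  have Y_n: "Y \<omega> n = \<eta> n \<omega>" for \<omega> by (simp add: Y_def)
  note distr_eq = ind[unfolded indep_var_distribution_eq, THEN conjunct2, THEN conjunct2]
  let ?L = "distr M ?PA X" and ?N = "distr M ?PB Y"
  interpret L: prob_space ?L by (rule prob_space_distr) simp
  interpret N: prob_space ?N by (rule prob_space_distr) simp
  interpret LN: pair_prob_space ?L ?N ..
  have h_measurable [measurable]: "(\<lambda>p. h (fst p) (snd p)) \<in> borel_measurable (?PA \<Otimes>\<^sub>M ?PB)"
    unfolding h_def by measurable
  have h_bound: "\<bar>h g g'\<bar> \<le> exp (real n * b) * (exp b * b')" for g g'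
  proof -
    have "(\<Sum>k=1..n. V (orbit S g x k)) \<le> (\<Sum>k=1..n. b)" using b(1) by (intro sum_mono) (simp add: abs_le_iff)
    then have "weight V n (orbit S g x) \<le> exp (real n * b)" by (simp add: weight_def)
    moreover have "exp (V z) \<le> exp b" for z using b(1)[of z] by (simp add: abs_le_iff)
    ultimately show ?thesis
      unfolding h_def abs_mult using b'
      by (intro mult_mono) (auto simp: weight_def)
  qed
  have "(\<integral>\<omega>. weight V (Suc n) (path x \<omega>) * f (path x \<omega> (Suc n)) \<partial>M) = (\<integral>\<omega>. h (X \<omega>) (Y \<omega>) \<partial>M)"
    by (rule Bochner_Integration.integral_cong[OF refl])
      (simp add: h_def weight_X orbit_X Y_n, simp add: weight_def exp_add mult_ac)
  also have "\<dots> = (\<integral>p. h (fst p) (snd p) \<partial>distr M (?PA \<Otimes>\<^sub>M ?PB) (\<lambda>\<omega>. (X \<omega>, Y \<omega>)))"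
    by (subst integral_distr) auto
  also have "\<dots> = (\<integral>p. h (fst p) (snd p) \<partial>(?L \<Otimes>\<^sub>M ?N))" by (simp add: distr_eq)
  also have "\<dots> = (\<integral>g. \<integral>g'. h g g' \<partial>?N \<partial>?L)"
  proof (subst LN.integral_fst'[symmetric])
    show "integrable (?L \<Otimes>\<^sub>M ?N) (\<lambda>p. h (fst p) (snd p))"
      by (intro LN.P.integrable_const_bound[where B="exp (real n * b) * (exp b * b')"])
        (use h_bound h_measurable in \<open>auto simp: distr_eq[symmetric]\<close>)
  qed simp
  also have "\<dots> = (\<integral>g. weight V n (orbit S g x) * feynman_kac P V f (orbit S g x n) \<partial>?L)"
  proof (rule Bochner_Integration.integral_cong[OF refl])
    fix g :: "nat \<Rightarrow> 'e"
    have "(\<integral>g'. h g g' \<partial>?N) = (\<integral>\<omega>. h g (Y \<omega>) \<partial>M)"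
      unfolding h_def by (subst integral_distr) auto
    also have "\<dots> = weight V n (orbit S g x)
      * (\<integral>\<omega>. exp (V (S (orbit S g x n) (\<eta> n \<omega>))) * f (S (orbit S g x n) (\<eta> n \<omega>)) \<partial>M)"
      by (simp add: h_def Y_n)
    also have "\<dots> = weight V n (orbit S g x) * feynman_kac P V f (orbit S g x n)"
      unfolding feynman_kac_def using V Suc.prems
      by (subst integral_transition_one[where n=n]) (auto intro!: continuous_intros)
    finally show "(\<integral>g'. h g g' \<partial>?N) = weight V n (orbit S g x) * feynman_kac P V f (orbit S g x n)" .
  qed
  also have "\<dots> = (\<integral>\<omega>. weight V n (path x \<omega>) * feynman_kac P V f (path x \<omega> n) \<partial>M)"
  proof (subst integral_distr)
    have "continuous_on UNIV (feynman_kac P V f)"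
      unfolding feynman_kac_def using V Suc.prems by (intro transition_feller continuous_intros)
    then have [measurable]: "feynman_kac P V f \<in> borel_measurable borel" by (rule borel_measurable_continuous_onI)
    show "(\<lambda>g. weight V n (orbit S g x) * feynman_kac P V f (orbit S g x n)) \<in> borel_measurable ?PA"
      by measurable
  qed (auto simp: weight_X orbit_X)
  also have "\<dots> = (feynman_kac P V ^^ n) (feynman_kac P V f) x"
    unfolding feynman_kac_def[of P V f] using V Suc.prems
    by (intro Suc.IH transition_feller continuous_intros)
  finally show ?case by (simp add: funpow_swap1)
qed

lemma integral_path_le:
  assumes g: "continuous_on UNIV (g :: 'a \<Rightarrow> real)" "\<And>z. 0 \<le> g z" and a: "0 \<le> a" "\<And>z. z \<in> ball y \<epsilon> \<Longrightarrow> a \<le> g z"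
    and p: "p \<le> measure (transition M \<eta> S N x) (ball y \<epsilon>)"
  shows "p * a \<le> (feynman_kac P (\<lambda>_. 0) ^^ N) g x"
proof -
  let ?\<tau> = "transition M \<eta> S N x"
  note t = prob_measuresD[OF transition_in_prob_measures[of N x]]
  interpret t: prob_space ?\<tau> by (rule t)
  have [measurable]: "g \<in> borel_measurable borel" using g by (rule_tac borel_measurable_continuous_onI)
  have "p * a \<le> (\<integral>z. a * indicator (ball y \<epsilon>) z \<partial>?\<tau>)"
    using p a by (simp add: t mult.commute mult_left_mono)
  also have "\<dots> \<le> (\<integral>z. g z \<partial>?\<tau>)"
  proof (rule integral_mono)
    show "integrable ?\<tau> (\<lambda>z. a * indicator (ball y \<epsilon>) z)"
      by (intro integrable_mult_right integrable_real_indicator) (auto simp: t t.emeasure_eq_measure)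
    show "integrable ?\<tau> g" by (rule integrable_continuous[OF compact_X transition_in_prob_measures g(1)])
    show "a * indicator (ball y \<epsilon>) z \<le> g z" for z using a g(2) by (auto simp: indicator_def)
  qed
  also have "\<dots> = (\<integral>\<omega>. g (path x \<omega> N) \<partial>M)" unfolding transition_def by (subst integral_distr) auto
  also have "\<dots> = (feynman_kac P (\<lambda>_. 0) ^^ N) g x"
    using feynman_kac_formula[of "\<lambda>_. 0" g N x] g by (simp add: weight_def)
  finally show ?thesis .
qed

text \<open>The law of the pair \<open>(R x y, R' x y)\<close> under \<open>Q\<close> is the required measure on the product.\<close>

lemma squeezing_kernel_transition:
  assumes hyp_I: "uniformly_irreducible (transition M \<eta> S)"
    and hyp_C: "squeezing_coupling Q P"
  shows "\<exists>q C. squeezing_kernel P q C"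
proof -
  from hyp_C obtain q C R R' where Q: "prob_space Q" and q: "0 \<le> q" "q < 1" "0 < C"
    and meas: "(\<lambda>(x, x', \<omega>). R x x' \<omega>) \<in> borel \<Otimes>\<^sub>M borel \<Otimes>\<^sub>M Q \<rightarrow>\<^sub>M borel"
      "(\<lambda>(x, x', \<omega>). R' x x' \<omega>) \<in> borel \<Otimes>\<^sub>M borel \<Otimes>\<^sub>M Q \<rightarrow>\<^sub>M borel"
    and R: "\<And>x x'. distr Q borel (R x x') = P x" "\<And>x x'. distr Q borel (R' x x') = P x'"
      "\<And>x x'. measure Q {\<omega> \<in> space Q. dist (R x x' \<omega>) (R' x x' \<omega>) > q * dist x x'} \<le> C * dist x x'"
    unfolding squeezing_coupling_def by blast
  interpret Q: prob_space Q by (rule Q)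
  have "squeezing_kernel P q C"
  proof
    show "compact (UNIV :: 'a set)" by (rule compact_X)
    show "P x \<in> prob_measures" for x by (rule transition_in_prob_measures)
    show "continuous_on UNIV (\<lambda>x. \<integral>y. f y \<partial>P x)" if "continuous_on UNIV f" for f :: "'a \<Rightarrow> real"
      using that by (rule transition_feller)
    show "0 \<le> q" "q < 1" "0 \<le> C" using q by auto
    show "\<exists>\<Gamma> \<in> prob_measures. distr \<Gamma> borel fst = P x \<and> distr \<Gamma> borel snd = P y \<and>
      measure \<Gamma> {z. q * dist x y < dist (fst z) (snd z)} \<le> C * dist x y" for x y
    proof (rule bexI)
      have pair: "(\<lambda>\<omega>. (x, y, \<omega>)) \<in> Q \<rightarrow>\<^sub>M borel \<Otimes>\<^sub>M borel \<Otimes>\<^sub>M Q" by simp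
      have [measurable]: "R x y \<in> Q \<rightarrow>\<^sub>M borel" "R' x y \<in> Q \<rightarrow>\<^sub>M borel"
        using measurable_compose[OF pair meas(1)] measurable_compose[OF pair meas(2)] by simp_all
      let ?r = "\<lambda>\<omega>. (R x y \<omega>, R' x y \<omega>)"
      have r: "?r \<in> Q \<rightarrow>\<^sub>M borel" unfolding borel_prod[symmetric] by measurable
      have fs: "fst \<in> (borel :: ('a \<times> 'a) measure) \<rightarrow>\<^sub>M borel" "snd \<in> (borel :: ('a \<times> 'a) measure) \<rightarrow>\<^sub>M borel"
        by (auto intro!: borel_measurable_continuous_onI continuous_intros)
      show "distr Q borel ?r \<in> prob_measures"
        using r by (auto simp: prob_measures_def intro!: Q.prob_space_distr)
      have "{z :: 'a \<times> 'a. q * dist x y < dist (fst z) (snd z)} \<in> sets borel"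
        by (intro borel_open open_Collect_less continuous_intros)
      then have "measure (distr Q borel ?r) {z. q * dist x y < dist (fst z) (snd z)}
        = measure Q {\<omega> \<in> space Q. dist (R x y \<omega>) (R' x y \<omega>) > q * dist x y}"
        using r by (subst measure_distr) (auto intro!: arg_cong[where f="measure Q"])
      then show "distr (distr Q borel ?r) borel fst = P x \<and> distr (distr Q borel ?r) borel snd = P y \<and>
        measure (distr Q borel ?r) {z. q * dist x y < dist (fst z) (snd z)} \<le> C * dist x y"
        using R(3)[of x y] R(1,2)[of x y] fs r by (simp add: distr_distr comp_def)
    qed
    show "\<exists>N. \<exists>p>0. \<forall>g y a x. continuous_on UNIV g \<longrightarrow> (\<forall>z. 0 \<le> g z) \<longrightarrow>
      0 \<le> a \<longrightarrow> (\<forall>z\<in>ball y \<epsilon>. a \<le> g z) \<longrightarrow> p * a \<le> (feynman_kac P (\<lambda>_. 0) ^^ N) g x"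
      if eps: "0 < \<epsilon>" for \<epsilon>
    proof -
      obtain N p where "p > 0" "\<And>x y. measure (transition M \<eta> S N x) (ball y \<epsilon>) > p"
        using hyp_I eps unfolding uniformly_irreducible_def by blast
      then show ?thesis
        by (intro exI[of _ N] exI[of _ p] conjI allI impI integral_path_le) (auto intro: less_imp_le)
    qed
  qed
  then show ?thesis by blast
qed

section \<open>The joint law of the initial point and the noise\<close>

context
  fixes \<mu> :: "'a measure"
  assumes \<mu>: "\<mu> \<in> prob_measures"
begin

lemma sets_initial [measurable_cong]: "sets \<mu> = sets borel"
  using prob_measuresD[OF \<mu>] by simp

lemma pair_prob: "pair_prob_space \<mu> M"
  using prob_measuresD(1)[OF \<mu>] prob_space_axioms
  by (simp add: pair_prob_space_def pair_sigma_finite_def prob_space_imp_sigma_finite)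

abbreviation sample :: "'a \<times> 'w \<Rightarrow> nat \<Rightarrow> 'a" where
  "sample z \<equiv> path (fst z) (snd z)"

lemma measurable_sample [measurable]: "(\<lambda>z. sample z n) \<in> borel_measurable (\<mu> \<Otimes>\<^sub>M M)"
  by (rule measurable_path_joint) (rule sets_initial)

lemma empirical_event:
  assumes "n > 0" "B \<in> borel_sets_of weak_star_topology"
  shows "{z \<in> space (\<mu> \<Otimes>\<^sub>M M). empirical_measure n (sample z) \<in> B} \<in> sets (\<mu> \<Otimes>\<^sub>M M)"
proof -
  have "(\<lambda>z. sample z) \<in> borel_measurable (\<mu> \<Otimes>\<^sub>M M)"
    by (rule measurable_coordinatewise_then_product) (rule measurable_sample)
  from measurable_sets[OF this measurable_empirical_measure[OF compact_X assms]]
  show ?thesis by (simp add: vimage_def Int_def conj_commute)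
qed

lemma empirical_prob_eq:
  "empirical_prob M \<eta> S n \<mu> B
    = measure (\<mu> \<Otimes>\<^sub>M M) {z \<in> space (\<mu> \<Otimes>\<^sub>M M). empirical_measure n (sample z) \<in> B}"
  unfolding empirical_prob_def by (rule arg_cong[where f="measure _"]) auto

lemma weight_measurable [measurable]:
  assumes "continuous_on UNIV V"
  shows "(\<lambda>z. weight V n (sample z)) \<in> borel_measurable (\<mu> \<Otimes>\<^sub>M M)"
proof -
  have [measurable]: "V \<in> borel_measurable borel" using assms by (rule borel_measurable_continuous_onI)
  show ?thesis unfolding weight_def by measurable
qed

lemma weight_bounded:
  assumes V: "continuous_on UNIV V"
  obtains b where "\<And>y. weight V n y \<le> b"
proof -
  obtain b where b: "\<And>x. \<bar>V x\<bar> \<le> b" using continuous_bounded[OF compact_X V] by blast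
  have "weight V n y \<le> exp (real n * b)" for y
  proof -
    have "(\<Sum>k=1..n. V (y k)) \<le> (\<Sum>k=1..n. b)" using b by (intro sum_mono) (simp add: abs_le_iff)
    then show ?thesis by (simp add: weight_def)
  qed
  then show thesis by (rule that)
qed

lemma integrable_weight:
  assumes V: "continuous_on UNIV V"
  shows "integrable (\<mu> \<Otimes>\<^sub>M M) (\<lambda>z. weight V n (sample z))"
proof -
  interpret pair_prob_space \<mu> M by (rule pair_prob)
  obtain b where b: "\<And>y. weight V n y \<le> b" using weight_bounded[OF V] by blast
  show ?thesis
    using weight_measurable[OF V] b
    by (intro P.integrable_const_bound[where B=b]) (auto simp: weight_def)
qed

lemma integral_weight:
  assumes V: "continuous_on UNIV V"
  shows "(\<integral>z. weight V n (sample z) \<partial>(\<mu> \<Otimes>\<^sub>M M)) = (\<integral>x. (feynman_kac P V ^^ n) (\<lambda>_. 1) x \<partial>\<mu>)"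
proof -
  interpret pair_prob_space \<mu> M by (rule pair_prob)
  have "(\<integral>z. weight V n (sample z) \<partial>(\<mu> \<Otimes>\<^sub>M M)) = (\<integral>x. \<integral>\<omega>. weight V n (path x \<omega>) \<partial>M \<partial>\<mu>)"
    using integral_fst'[OF integrable_weight[OF V, of n]] by simp
  also have "\<dots> = (\<integral>x. (feynman_kac P V ^^ n) (\<lambda>_. 1) x \<partial>\<mu>)"
    using feynman_kac_formula[OF V, of "\<lambda>_. 1" n] by simp
  finally show ?thesis .
qed

lemma integral_weight_bounds:
  assumes V: "continuous_on UNIV V"
    and b: "\<And>x. c \<le> (feynman_kac P V ^^ n) (\<lambda>_. 1) x" "\<And>x. (feynman_kac P V ^^ n) (\<lambda>_. 1) x \<le> d"
  shows "c \<le> (\<integral>z. weight V n (sample z) \<partial>(\<mu> \<Otimes>\<^sub>M M))" "(\<integral>z. weight V n (sample z) \<partial>(\<mu> \<Otimes>\<^sub>M M)) \<le> d"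
proof -
  interpret m: prob_space \<mu> using prob_measuresD(1)[OF \<mu>] .
  have step: "continuous_on UNIV (feynman_kac P V f)" if "continuous_on UNIV f" for f
    unfolding feynman_kac_def using that by (intro transition_feller continuous_intros V)
  have "continuous_on UNIV ((feynman_kac P V ^^ n) (\<lambda>_. 1))" for n
    by (induction n) (auto intro: step simp del: One_nat_def)
  from integrable_continuous[OF compact_X \<mu> this[of n]]
  show "c \<le> (\<integral>z. weight V n (sample z) \<partial>(\<mu> \<Otimes>\<^sub>M M))" "(\<integral>z. weight V n (sample z) \<partial>(\<mu> \<Otimes>\<^sub>M M)) \<le> d"
    unfolding integral_weight[OF V] using b
    by (auto intro!: m.integral_ge_const m.integral_le_const)
qed

end

end

section \<open>Lipschitz test functions\<close>

definition lipschitz_function :: "('a::metric_space \<Rightarrow> real) \<Rightarrow> bool" where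
  "lipschitz_function V \<longleftrightarrow> (\<exists>l\<ge>0. \<forall>x y. \<bar>V x - V y\<bar> \<le> l * dist x y)"

lemma lipschitz_functionE:
  assumes "lipschitz_function V"
  obtains l where "\<And>x y. \<bar>V x - V y\<bar> \<le> l * dist x y" "0 \<le> l"
  using assms unfolding lipschitz_function_def by blast

lemma lipschitz_function_continuous: "lipschitz_function V \<Longrightarrow> continuous_on UNIV V"
  unfolding lipschitz_function_def using lipschitz_imp_continuous by blast

lemma lipschitz_function_const: "lipschitz_function (\<lambda>_. c)"
  unfolding lipschitz_function_def by (rule exI[of _ 0]) auto

lemma lipschitz_function_add_mult:
  assumes "lipschitz_function V" "lipschitz_function W"
  shows "lipschitz_function (\<lambda>x. V x + t * W x)"
proof -
  obtain l where l: "\<And>x y. \<bar>V x - V y\<bar> \<le> l * dist x y" "0 \<le> l" using lipschitz_functionE[OF assms(1)] by blast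
  obtain w where w: "\<And>x y. \<bar>W x - W y\<bar> \<le> w * dist x y" "0 \<le> w" using lipschitz_functionE[OF assms(2)] by blast
  have "\<bar>(V x + t * W x) - (V y + t * W y)\<bar> \<le> (l + \<bar>t\<bar> * w) * dist x y" for x y
  proof -
    have "\<bar>(V x + t * W x) - (V y + t * W y)\<bar> \<le> \<bar>V x - V y\<bar> + \<bar>t * (W x - W y)\<bar>"
      by (simp add: algebra_simps)
    also have "\<dots> \<le> l * dist x y + \<bar>t\<bar> * (w * dist x y)"
      unfolding abs_mult by (intro add_mono l mult_left_mono w) auto
    finally show ?thesis by (simp add: algebra_simps)
  qed
  then show ?thesis unfolding lipschitz_function_def using l(2) w(2)
    by (intro exI[of _ "l + \<bar>t\<bar> * w"]) auto
qed

lemma lipschitz_function_sum: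
  assumes "\<And>V. V \<in> F \<Longrightarrow> lipschitz_function V"
  shows "lipschitz_function (\<lambda>x. \<Sum>V\<in>F. \<theta> V * V x)"
  using assms
proof (induction F rule: infinite_finite_induct)
  case (insert V F)
  then have "lipschitz_function (\<lambda>x. (\<Sum>V\<in>F. \<theta> V * V x) + \<theta> V * V x)"
    by (intro lipschitz_function_add_mult) auto
  then show ?case using insert by (simp add: add.commute)
qed (simp_all add: lipschitz_function_const)

text \<open>The infimal convolution of \<open>f\<close> with a large multiple \<open>k\<close> of the distance: by uniform continuity, competitors
  within distance \<open>d\<close> lose at most \<open>e\<close>, and \<open>k = 2 * b / d\<close> makes the more distant ones useless.\<close>

lemma lipschitz_approximation:
  fixes f :: "'a::metric_space \<Rightarrow> real"
  assumes comp: "compact (UNIV :: 'a set)" and f: "continuous_on UNIV f" and e: "0 < e"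
  obtains V where "lipschitz_function V" "\<And>x. \<bar>f x - V x\<bar> \<le> e"
proof -
  obtain b where b: "\<And>x. \<bar>f x\<bar> \<le> b" "0 \<le> b" using continuous_bounded[OF comp f] by metis
  obtain d where d: "0 < d" "\<And>x y. dist x y < d \<Longrightarrow> \<bar>f x - f y\<bar> < e"
    using compact_uniformly_continuous[OF f comp] e unfolding uniformly_continuous_on_def
    by (auto simp: dist_real_def dist_commute)
  define k where "k = 2 * b / d"
  have k: "0 \<le> k" using b d by (simp add: k_def)
  define V where "V x = (INF y. f y + k * dist x y)" for x
  have bdd: "bdd_below (range (\<lambda>y. f y + k * dist x y))" for x
  proof (rule bdd_belowI)
    fix v assume "v \<in> range (\<lambda>y. f y + k * dist x y)"
    then obtain y where v: "v = f y + k * dist x y" by blast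
    have "0 \<le> k * dist x y" using k by simp
    then show "- b \<le> v" using b(1)[of y] v by linarith
  qed
  have V_le: "V x \<le> f y + k * dist x y" for x y
    unfolding V_def by (rule cINF_lower[OF bdd]) auto
  have V_ge: "t \<le> V x" if "\<And>y. t \<le> f y + k * dist x y" for t x
    unfolding V_def by (rule cINF_greatest) (use that in auto)
  have V_lip: "V x \<le> V z + k * dist x z" for x z
  proof -
    have "V x - k * dist x z \<le> V z"
    proof (rule V_ge)
      fix y
      have "k * dist x y \<le> k * (dist x z + dist z y)" using k by (intro mult_left_mono dist_triangle)
      then show "V x - k * dist x z \<le> f y + k * dist z y" using V_le[of x y] by (simp add: distrib_left)
    qed
    then show ?thesis by simp
  qed
  have "\<bar>V x - V z\<bar> \<le> k * dist x z" for x z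
    using V_lip[of x z] V_lip[of z x] by (simp add: dist_commute abs_le_iff)
  then have "lipschitz_function V" unfolding lipschitz_function_def using k by blast
  moreover have "\<bar>f x - V x\<bar> \<le> e" for x
  proof -
    have "V x \<le> f x" using V_le[of x x] by simp
    moreover have "f x - e \<le> V x"
    proof (rule V_ge)
      fix y
      show "f x - e \<le> f y + k * dist x y"
      proof (cases "dist x y < d")
        case True
        have "0 \<le> k * dist x y" using k by simp
        then show ?thesis using d(2)[OF True] by linarith
      next
        case False
        then have "k * d \<le> k * dist x y" using k by (intro mult_left_mono) auto
        then have "2 * b \<le> k * dist x y" using d by (simp add: k_def)
        then show ?thesis using b(1)[of x] b(1)[of y] e by linarith
      qed
    qed
    ultimately show ?thesis using e by linarith
  qed
  ultimately show thesis by (rule that)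
qed

lemma openin_weak_star_integral:
  fixes f :: "'a::topological_space \<Rightarrow> real"
  assumes "continuous_on UNIV f" "open U"
  shows "openin weak_star_topology {\<sigma> \<in> prob_measures. integral\<^sup>L \<sigma> f \<in> U}"
  unfolding weak_star_topology_def using assms by (intro topology_generated_by_Basis) blast

text \<open>Lipschitz functions suffice to describe neighbourhoods because they are uniformly dense in the
  continuous functions.\<close>

lemma weak_star_neighbourhood:
  fixes G :: "'a::metric_space measure set"
  assumes comp: "compact (UNIV :: 'a set)" and G: "openin weak_star_topology G" and \<sigma>: "\<sigma> \<in> G"
  obtains F r where "finite F" "\<And>V. V \<in> F \<Longrightarrow> lipschitz_function V" "0 < r"
    "\<And>\<tau>. \<tau> \<in> prob_measures \<Longrightarrow> (\<And>V. V \<in> F \<Longrightarrow> \<bar>integral\<^sup>L \<tau> V - integral\<^sup>L \<sigma> V\<bar> < r) \<Longrightarrow> \<tau> \<in> G"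
proof -
  have "generate_topology_on {{\<sigma> \<in> prob_measures. integral\<^sup>L \<sigma> f \<in> U} | (f :: 'a \<Rightarrow> real) U.
        continuous_on UNIV f \<and> open U} G"
    using G unfolding weak_star_topology_def by (simp add: openin_topology_generated_by_iff)
  then have "\<sigma> \<in> G \<longrightarrow> (\<exists>F r. finite F \<and> (\<forall>V\<in>F. lipschitz_function V) \<and> 0 < r \<and>
    (\<forall>\<tau>\<in>prob_measures. (\<forall>V\<in>F. \<bar>integral\<^sup>L \<tau> V - integral\<^sup>L \<sigma> V\<bar> < r) \<longrightarrow> \<tau> \<in> G))"
  proof (induction rule: generate_topology_on.induct)
    case Empty then show ?case by simp
  next
    case (Int a b)
    show ?case
    proof
      assume "\<sigma> \<in> a \<inter> b"
      then have "\<sigma> \<in> a" "\<sigma> \<in> b" by auto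
      obtain F r where F: "finite F" "\<forall>V\<in>F. lipschitz_function V" "0 < r"
        "\<forall>\<tau>\<in>prob_measures. (\<forall>V\<in>F. \<bar>integral\<^sup>L \<tau> V - integral\<^sup>L \<sigma> V\<bar> < r) \<longrightarrow> \<tau> \<in> a"
        using Int.IH(1)[THEN mp, OF \<open>\<sigma> \<in> a\<close>] by (elim exE conjE)
      obtain F' r' where F': "finite F'" "\<forall>V\<in>F'. lipschitz_function V" "0 < r'"
        "\<forall>\<tau>\<in>prob_measures. (\<forall>V\<in>F'. \<bar>integral\<^sup>L \<tau> V - integral\<^sup>L \<sigma> V\<bar> < r') \<longrightarrow> \<tau> \<in> b"
        using Int.IH(2)[THEN mp, OF \<open>\<sigma> \<in> b\<close>] by (elim exE conjE)
      show "\<exists>F r. finite F \<and> (\<forall>V\<in>F. lipschitz_function V) \<and> 0 < r \<and>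
        (\<forall>\<tau>\<in>prob_measures. (\<forall>V\<in>F. \<bar>integral\<^sup>L \<tau> V - integral\<^sup>L \<sigma> V\<bar> < r) \<longrightarrow> \<tau> \<in> a \<inter> b)"
      proof (intro exI[of _ "F \<union> F'"] exI[of _ "min r r'"] conjI ballI impI IntI)
        fix \<tau> :: "'a measure"
        assume t: "\<tau> \<in> prob_measures"
          "\<forall>V\<in>F \<union> F'. \<bar>integral\<^sup>L \<tau> V - integral\<^sup>L \<sigma> V\<bar> < min r r'"
        show "\<tau> \<in> a" by (rule F(4)[rule_format, OF t(1)]) (use t(2) in simp)
        show "\<tau> \<in> b" by (rule F'(4)[rule_format, OF t(1)]) (use t(2) in simp)
      qed (use F(1-3) F'(1-3) in auto)
    qed
  next
    case (UN K)
    show ?case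
    proof
      assume "\<sigma> \<in> \<Union>K"
      then obtain k where k: "k \<in> K" "\<sigma> \<in> k" by blast
      obtain F r where F: "finite F" "\<forall>V\<in>F. lipschitz_function V" "0 < r"
        "\<forall>\<tau>\<in>prob_measures. (\<forall>V\<in>F. \<bar>integral\<^sup>L \<tau> V - integral\<^sup>L \<sigma> V\<bar> < r) \<longrightarrow> \<tau> \<in> k"
        using UN.IH[OF k(1), THEN mp, OF k(2)] by (elim exE conjE)
      have "\<forall>\<tau>\<in>prob_measures. (\<forall>V\<in>F. \<bar>integral\<^sup>L \<tau> V - integral\<^sup>L \<sigma> V\<bar> < r) \<longrightarrow> \<tau> \<in> \<Union>K"
        using F(4) k(1) by (metis UnionI)
      then show "\<exists>F r. finite F \<and> (\<forall>V\<in>F. lipschitz_function V) \<and> 0 < r \<and>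
        (\<forall>\<tau>\<in>prob_measures. (\<forall>V\<in>F. \<bar>integral\<^sup>L \<tau> V - integral\<^sup>L \<sigma> V\<bar> < r) \<longrightarrow> \<tau> \<in> \<Union>K)"
        using F(1-3) by (intro exI[of _ F] exI[of _ r] conjI)
    qed
  next
    case (Basis s)
    then obtain f :: "'a \<Rightarrow> real" and U where s: "s = {\<sigma> \<in> prob_measures. integral\<^sup>L \<sigma> f \<in> U}" "continuous_on UNIV f" "open U"
      by blast
    show ?case
    proof
      assume sig: "\<sigma> \<in> s"
      then obtain r where r: "0 < r" "\<And>u. \<bar>u - integral\<^sup>L \<sigma> f\<bar> < r \<Longrightarrow> u \<in> U"
        using s(3) s(1) unfolding open_dist dist_real_def by blast
      obtain V where V: "lipschitz_function V" "\<And>x. \<bar>f x - V x\<bar> \<le> r / 4"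
        using lipschitz_approximation[OF comp s(2), of "r / 4"] r(1) by auto
      have close: "\<bar>integral\<^sup>L \<tau> f - integral\<^sup>L \<tau> V\<bar> \<le> r / 4" if t: "\<tau> \<in> prob_measures" for \<tau>
      proof -
        interpret t: prob_space \<tau> using prob_measuresD(1)[OF t] .
        note int = integrable_continuous[OF comp t]
        have Vc: "continuous_on UNIV V" by (rule lipschitz_function_continuous[OF V(1)])
        have "\<bar>integral\<^sup>L \<tau> f - integral\<^sup>L \<tau> V\<bar> = \<bar>\<integral>x. f x - V x \<partial>\<tau>\<bar>"
          using int s(2) Vc by simp
        also have "\<dots> \<le> (\<integral>x. \<bar>f x - V x\<bar> \<partial>\<tau>)" by (rule integral_abs_bound)
        also have "\<dots> \<le> (\<integral>x. r / 4 \<partial>\<tau>)"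
          by (intro integral_mono int continuous_intros s(2) Vc V(2))
        finally show ?thesis by (simp add: t.prob_space)
      qed
      have "\<tau> \<in> s" if t: "\<tau> \<in> prob_measures" "\<bar>integral\<^sup>L \<tau> V - integral\<^sup>L \<sigma> V\<bar> < r / 2" for \<tau>
      proof -
        have "\<sigma> \<in> prob_measures" using sig s(1) by blast
        from close[OF this] close[OF t(1)] t(2) have "\<bar>integral\<^sup>L \<tau> f - integral\<^sup>L \<sigma> f\<bar> < r" by linarith
        then show ?thesis using r(2) t(1) s(1) by blast
      qed
      then show "\<exists>F r. finite F \<and> (\<forall>V\<in>F. lipschitz_function V) \<and> 0 < r \<and>
        (\<forall>\<tau>\<in>prob_measures. (\<forall>V\<in>F. \<bar>integral\<^sup>L \<tau> V - integral\<^sup>L \<sigma> V\<bar> < r) \<longrightarrow> \<tau> \<in> s)"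
        using V(1) r(1) by (intro exI[of _ "{V}"] exI[of _ "r / 2"]) auto
    qed
  qed
  then show thesis
    using \<sigma> by (elim impE[OF _ \<sigma>] exE conjE) (rule that; blast)
qed

section \<open>The rate function\<close>

locale squeezing_dynamics = random_dynamical_system S M \<eta> + kernel: squeezing_kernel "transition M \<eta> S 1" q C
  for S :: "'a::polish_space \<Rightarrow> 'e::polish_space \<Rightarrow> 'a" and M :: "'w measure" and \<eta> :: "nat \<Rightarrow> 'w \<Rightarrow> 'e"
    and q C :: real
begin

abbreviation \<Lambda> :: "('a \<Rightarrow> real) \<Rightarrow> real" where "\<Lambda> \<equiv> pressure P"

definition rate :: "'a measure \<Rightarrow> ereal" where
  "rate \<sigma> = (SUP V\<in>Collect lipschitz_function. ereal (integral\<^sup>L \<sigma> V - \<Lambda> V))"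

lemma rate_upper: "lipschitz_function V \<Longrightarrow> ereal (integral\<^sup>L \<sigma> V - \<Lambda> V) \<le> rate \<sigma>"
  unfolding rate_def by (rule SUP_upper) simp

lemma rate_nonneg: "0 \<le> rate \<sigma>"
  using rate_upper[OF lipschitz_function_const[of 0], of \<sigma>] kernel.pressure_zero by (simp add: zero_ereal_def)

lemma openin_rate: "openin weak_star_topology {\<sigma> \<in> prob_measures. c < rate \<sigma>}"
proof -
  have "{\<sigma> \<in> prob_measures. c < rate \<sigma>}
    = (\<Union>V\<in>Collect lipschitz_function. {\<sigma> \<in> prob_measures. integral\<^sup>L \<sigma> V \<in> {r. c < ereal (r - \<Lambda> V)}})"
    unfolding rate_def less_SUP_iff by auto
  moreover have "open {r. c < ereal (r - t)}" for t
  proof -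
    have "{r. c < ereal (r - t)} = (\<lambda>r. ereal (r - t)) -` {c<..}" by auto
    moreover have "open \<dots>" by (intro open_vimage continuous_intros open_greaterThan)
    ultimately show ?thesis by simp
  qed
  ultimately show ?thesis
    by (simp only:) (rule openin_Union, clarify, rule openin_weak_star_integral[OF lipschitz_function_continuous])
qed

lemma good_rate_function_rate: "good_rate_function weak_star_topology rate"
  unfolding good_rate_function_def topspace_weak_star_topology
proof (intro conjI ballI allI impI rate_nonneg openin_rate)
  fix c :: real
  have "{\<sigma> \<in> prob_measures. rate \<sigma> \<le> ereal c} = topspace weak_star_topology - {\<sigma> \<in> prob_measures. ereal c < rate \<sigma>}"
    by (auto simp: not_less)
  moreover have "closedin weak_star_topology \<dots>" using openin_rate by blast
  ultimately show "compactin weak_star_topology {\<sigma> \<in> prob_measures. rate \<sigma> \<le> ereal c}"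
    using closedin_compact_space[OF compact_weak_star_topology[OF compact_X]] by simp
qed

lemma convex_rate_rate: "convex_rate rate"
  unfolding convex_rate_def
proof (intro ballI)
  fix \<sigma> \<tau> :: "'a measure" and t :: real
  assume st: "\<sigma> \<in> prob_measures" "\<tau> \<in> prob_measures" "t \<in> {0..1}"
  show "rate (mix_measure t \<sigma> \<tau>) \<le> ereal t * rate \<sigma> + ereal (1 - t) * rate \<tau>"
    unfolding rate_def[of "mix_measure t \<sigma> \<tau>"]
  proof (rule SUP_least)
    fix V :: "'a \<Rightarrow> real" assume "V \<in> Collect lipschitz_function"
    then have V: "lipschitz_function V" by simp
    have "integral\<^sup>L (mix_measure t \<sigma> \<tau>) V - \<Lambda> V
      = t * (integral\<^sup>L \<sigma> V - \<Lambda> V) + (1 - t) * (integral\<^sup>L \<tau> V - \<Lambda> V)"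
      by (simp add: integral_mix_measure[OF compact_X st lipschitz_function_continuous[OF V]] algebra_simps)
    then have "ereal (integral\<^sup>L (mix_measure t \<sigma> \<tau>) V - \<Lambda> V)
      = ereal t * ereal (integral\<^sup>L \<sigma> V - \<Lambda> V) + ereal (1 - t) * ereal (integral\<^sup>L \<tau> V - \<Lambda> V)" by simp
    also have "\<dots> \<le> ereal t * rate \<sigma> + ereal (1 - t) * rate \<tau>"
      using st(3) by (intro add_mono ereal_mult_left_mono rate_upper V) auto
    finally show "ereal (integral\<^sup>L (mix_measure t \<sigma> \<tau>) V - \<Lambda> V) \<le> \<dots>" .
  qed
qed

lemma pressure_differentiable:
  assumes "lipschitz_function V" "lipschitz_function W"
  obtains m where "\<And>\<eta>. 0 < \<eta> \<Longrightarrow> \<exists>\<delta>>0. \<forall>t. \<bar>t\<bar> \<le> \<delta> \<longrightarrow>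
    \<Lambda> (\<lambda>x. V x + t * W x) \<le> \<Lambda> V + t * m + \<bar>t\<bar> * \<eta>"
proof -
  obtain l where l: "\<And>x y. \<bar>V x - V y\<bar> \<le> l * dist x y" "0 \<le> l" using lipschitz_functionE[OF assms(1)] by blast
  obtain w where w: "\<And>x y. \<bar>W x - W y\<bar> \<le> w * dist x y" "0 \<le> w" using lipschitz_functionE[OF assms(2)] by blast
  show thesis by (rule kernel.pressure_differentiable[OF l w]) (rule that; blast)
qed

definition average :: "('a \<Rightarrow> real) \<Rightarrow> nat \<Rightarrow> (nat \<Rightarrow> 'a) \<Rightarrow> real" where
  "average V n y = (\<Sum>k=1..n. V (y k)) / real n"

lemma integral_empirical:
  "n > 0 \<Longrightarrow> continuous_on UNIV V \<Longrightarrow> integral\<^sup>L (empirical_measure n y) V = average V n y"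
  using integral_empirical_measure[OF compact_X] by (simp add: average_def)

lemma weight_average: "n > 0 \<Longrightarrow> weight V n y = exp (real n * average V n y)"
  by (simp add: weight_def average_def)

lemma average_add_mult: "average (\<lambda>x. V x + t * W x) n y = average V n y + t * average W n y"
  by (simp add: average_def sum.distrib add_divide_distrib flip: sum_distrib_left)

lemma average_sum: "average (\<lambda>x. \<Sum>V\<in>F. \<theta> V * V x) n y = (\<Sum>V\<in>F. \<theta> V * average V n y)"
  unfolding average_def
  by (subst sum.swap) (simp add: sum_divide_distrib sum_distrib_left)

lemma measurable_average:
  assumes "\<mu> \<in> prob_measures" "continuous_on UNIV V"
  shows "(\<lambda>z. average V n (sample z)) \<in> borel_measurable (\<mu> \<Otimes>\<^sub>M M)"
proof -
  note [measurable] = measurable_sample[OF assms(1)] borel_measurable_continuous_onI[OF assms(2)]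
  show ?thesis unfolding average_def by measurable
qed

lemma expectation_weight_bounds:
  assumes "lipschitz_function V"
  obtains c A where "0 < c" "0 < A"
    "\<And>n \<mu>. \<mu> \<in> prob_measures \<Longrightarrow> c * exp (real n * \<Lambda> V) \<le> (\<integral>z. weight V n (sample z) \<partial>(\<mu> \<Otimes>\<^sub>M M))"
    "\<And>n \<mu>. \<mu> \<in> prob_measures \<Longrightarrow> (\<integral>z. weight V n (sample z) \<partial>(\<mu> \<Otimes>\<^sub>M M)) \<le> A * exp (real n * \<Lambda> V)"
proof -
  obtain l where l: "\<And>x y. \<bar>V x - V y\<bar> \<le> l * dist x y" "0 \<le> l" using lipschitz_functionE[OF assms] by blast
  obtain c A where cA: "0 < c" "\<And>n x. c * exp (real n * \<Lambda> V) \<le> (feynman_kac P V ^^ n) (\<lambda>_. 1) x"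
    "\<And>n x. (feynman_kac P V ^^ n) (\<lambda>_. 1) x \<le> A * exp (real n * \<Lambda> V)"
    by (rule kernel.fk_iter_two_sided[OF l]) blast
  have "0 < A" using cA(1) cA(2)[of 0 undefined] cA(3)[of 0 undefined] by simp
  show thesis
    by (rule that[OF cA(1) \<open>0 < A\<close>])
      (rule integral_weight_bounds[OF _ lipschitz_function_continuous[OF assms] cA(2,3)], assumption)+
qed

section \<open>Upper bound\<close>

lemma chernoff_bound:
  assumes V: "lipschitz_function V"
  obtains A where "0 < A" "\<And>n \<mu> s. n > 0 \<Longrightarrow> \<mu> \<in> prob_measures \<Longrightarrow>
    measure (\<mu> \<Otimes>\<^sub>M M) {z \<in> space (\<mu> \<Otimes>\<^sub>M M). s \<le> average V n (sample z)} \<le> A * exp (real n * (\<Lambda> V - s))"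
proof -
  note Vc = lipschitz_function_continuous[OF V]
  obtain c A where A: "0 < A"
    "\<And>n \<mu>. \<mu> \<in> prob_measures \<Longrightarrow> (\<integral>z. weight V n (sample z) \<partial>(\<mu> \<Otimes>\<^sub>M M)) \<le> A * exp (real n * \<Lambda> V)"
    by (rule expectation_weight_bounds[OF V]) blast
  show thesis
  proof (rule that[OF A(1)])
    fix n :: nat and \<mu> :: "'a measure" and s assume n: "n > 0" and \<mu>: "\<mu> \<in> prob_measures"
    interpret pp: pair_prob_space \<mu> M by (rule pair_prob[OF \<mu>])
    let ?E = "{z \<in> space (\<mu> \<Otimes>\<^sub>M M). s \<le> average V n (sample z)}"
    have E: "?E \<in> sets (\<mu> \<Otimes>\<^sub>M M)" using measurable_average[OF \<mu> Vc] by measurable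
    have "exp (real n * s) * measure (\<mu> \<Otimes>\<^sub>M M) ?E = (\<integral>z. exp (real n * s) * indicator ?E z \<partial>(\<mu> \<Otimes>\<^sub>M M))"
      using E by simp
    also have "\<dots> \<le> (\<integral>z. weight V n (sample z) \<partial>(\<mu> \<Otimes>\<^sub>M M))"
    proof (rule integral_mono)
      show "integrable (\<mu> \<Otimes>\<^sub>M M) (\<lambda>z. exp (real n * s) * indicator ?E z)"
        using E by (intro integrable_mult_right integrable_real_indicator) (auto simp: pp.P.emeasure_eq_measure)
      show "integrable (\<mu> \<Otimes>\<^sub>M M) (\<lambda>z. weight V n (sample z))" by (rule integrable_weight[OF \<mu> Vc])
      show "exp (real n * s) * indicator ?E z \<le> weight V n (sample z)" for z
        using n by (auto simp: indicator_def weight_average)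
    qed
    also have "\<dots> \<le> A * exp (real n * \<Lambda> V)" by (rule A(2)[OF \<mu>])
    finally show "measure (\<mu> \<Otimes>\<^sub>M M) ?E \<le> A * exp (real n * (\<Lambda> V - s))"
      by (simp add: right_diff_distrib exp_diff field_simps)
  qed
qed

lemma borel_sets_subset: "B \<in> borel_sets_of T \<Longrightarrow> B \<subseteq> topspace T"
  unfolding borel_sets_of_def by (rule sigma_sets_into_sp) (auto dest: openin_subset)

text \<open>Every measure in the closure is separated from level \<open>c\<close> by some Lipschitz potential; by compactness finitely many of
  the corresponding open half-spaces cover, and each of them is estimated by the exponential Chebyshev inequality.\<close>

lemma exponential_upper_bound:
  assumes B: "B \<in> borel_sets_of weak_star_topology"
    and c: "\<And>\<sigma>. \<sigma> \<in> weak_star_topology closure_of B \<Longrightarrow> ereal c < rate \<sigma>"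
  obtains A where "0 < A" "\<And>n \<mu>. n > 0 \<Longrightarrow> \<mu> \<in> prob_measures \<Longrightarrow>
    empirical_prob M \<eta> S n \<mu> B \<le> A * exp (- (real n * c))"
proof -
  let ?F = "weak_star_topology closure_of B"
  let ?U = "\<lambda>V. {\<sigma> \<in> prob_measures. integral\<^sup>L \<sigma> V \<in> {c + \<Lambda> V<..}}"
  have "compactin weak_star_topology ?F"
    using closedin_compact_space[OF compact_weak_star_topology[OF compact_X]] by simp
  moreover have "?F \<subseteq> \<Union> (?U ` Collect lipschitz_function)"
  proof
    fix \<sigma> assume s: "\<sigma> \<in> ?F"
    then have "\<sigma> \<in> prob_measures" using closure_of_subset_topspace by fastforce
    moreover obtain V where "lipschitz_function V" "c < integral\<^sup>L \<sigma> V - \<Lambda> V"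
      using c[OF s] unfolding rate_def less_SUP_iff by auto
    ultimately show "\<sigma> \<in> \<Union> (?U ` Collect lipschitz_function)" by auto
  qed
  moreover have "openin weak_star_topology (?U V)" if "lipschitz_function V" for V
    using that by (intro openin_weak_star_integral lipschitz_function_continuous) auto
  ultimately obtain \<F> where \<F>: "finite \<F>" "\<F> \<subseteq> ?U ` Collect lipschitz_function" "?F \<subseteq> \<Union>\<F>"
    using compactinD[of weak_star_topology ?F "?U ` Collect lipschitz_function"] by blast
  obtain \<V> where \<V>: "\<V> \<subseteq> Collect lipschitz_function" "finite \<V>" "\<F> = ?U ` \<V>"
    using finite_subset_image[OF \<F>(1,2)] by blast
  have B_sub: "B \<subseteq> (\<Union>V\<in>\<V>. ?U V)"
    using closure_of_subset[OF borel_sets_subset[OF B]] \<F>(3) \<V>(3) by blast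
  have "\<forall>V\<in>\<V>. \<exists>A>0. \<forall>n \<mu> s. n > 0 \<longrightarrow> \<mu> \<in> prob_measures \<longrightarrow>
    measure (\<mu> \<Otimes>\<^sub>M M) {z \<in> space (\<mu> \<Otimes>\<^sub>M M). s \<le> average V n (sample z)} \<le> A * exp (real n * (\<Lambda> V - s))"
  proof
    fix V assume "V \<in> \<V>"
    then have "lipschitz_function V" using \<V>(1) by auto
    then show "\<exists>A>0. \<forall>n \<mu> s. n > 0 \<longrightarrow> \<mu> \<in> prob_measures \<longrightarrow>
      measure (\<mu> \<Otimes>\<^sub>M M) {z \<in> space (\<mu> \<Otimes>\<^sub>M M). s \<le> average V n (sample z)} \<le> A * exp (real n * (\<Lambda> V - s))"
      by (rule chernoff_bound) blast
  qed
  then have "\<exists>A. \<forall>V\<in>\<V>. 0 < A V \<and> (\<forall>n \<mu> s. n > 0 \<longrightarrow> \<mu> \<in> prob_measures \<longrightarrow>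
    measure (\<mu> \<Otimes>\<^sub>M M) {z \<in> space (\<mu> \<Otimes>\<^sub>M M). s \<le> average V n (sample z)} \<le> A V * exp (real n * (\<Lambda> V - s)))"
    by (rule bchoice)
  then obtain A where A': "\<forall>V\<in>\<V>. 0 < A V \<and> (\<forall>n \<mu> s. n > 0 \<longrightarrow> \<mu> \<in> prob_measures \<longrightarrow>
    measure (\<mu> \<Otimes>\<^sub>M M) {z \<in> space (\<mu> \<Otimes>\<^sub>M M). s \<le> average V n (sample z)} \<le> A V * exp (real n * (\<Lambda> V - s)))"
    by (elim exE)
  note A = A'[rule_format, THEN conjunct1] A'[rule_format, THEN conjunct2, rule_format]
  show thesis
  proof (rule that[of "1 + (\<Sum>V\<in>\<V>. A V)"])
    have "0 \<le> (\<Sum>V\<in>\<V>. A V)" using A(1) by (intro sum_nonneg) (auto simp: less_imp_le)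
    then show "0 < 1 + (\<Sum>V\<in>\<V>. A V)" by linarith
    fix n :: nat and \<mu> :: "'a measure" assume n: "n > 0" and \<mu>: "\<mu> \<in> prob_measures"
    interpret pp: pair_prob_space \<mu> M by (rule pair_prob[OF \<mu>])
    let ?E = "\<lambda>V. {z \<in> space (\<mu> \<Otimes>\<^sub>M M). c + \<Lambda> V \<le> average V n (sample z)}"
    have Vc: "continuous_on UNIV V" if "V \<in> \<V>" for V
      using that \<V>(1) by (intro lipschitz_function_continuous) auto
    have E: "?E V \<in> sets (\<mu> \<Otimes>\<^sub>M M)" if "V \<in> \<V>" for V
      using measurable_average[OF \<mu> Vc[OF that]] by measurable
    have "empirical_prob M \<eta> S n \<mu> B \<le> measure (\<mu> \<Otimes>\<^sub>M M) (\<Union>V\<in>\<V>. ?E V)"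
      unfolding empirical_prob_eq[OF \<mu>]
    proof (rule pp.P.finite_measure_mono)
      show "(\<Union>V\<in>\<V>. ?E V) \<in> sets (\<mu> \<Otimes>\<^sub>M M)" using \<V>(2) E by (intro sets.finite_UN) auto
      show "{z \<in> space (\<mu> \<Otimes>\<^sub>M M). empirical_measure n (sample z) \<in> B} \<subseteq> (\<Union>V\<in>\<V>. ?E V)"
      proof
        fix z assume "z \<in> {z \<in> space (\<mu> \<Otimes>\<^sub>M M). empirical_measure n (sample z) \<in> B}"
        then obtain V where "V \<in> \<V>" "c + \<Lambda> V < integral\<^sup>L (empirical_measure n (sample z)) V" "z \<in> space (\<mu> \<Otimes>\<^sub>M M)"
          using B_sub by blast
        then show "z \<in> (\<Union>V\<in>\<V>. ?E V)" using integral_empirical[OF n Vc] by (auto intro!: bexI[of _ V] less_imp_le)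
      qed
    qed
    also have "\<dots> \<le> (\<Sum>V\<in>\<V>. measure (\<mu> \<Otimes>\<^sub>M M) (?E V))"
      using \<V>(2) E by (intro pp.P.finite_measure_subadditive_finite) auto
    also have "\<dots> \<le> (\<Sum>V\<in>\<V>. A V * exp (real n * (\<Lambda> V - (c + \<Lambda> V))))"
      by (intro sum_mono A(2) n \<mu>)
    also have "\<dots> = (\<Sum>V\<in>\<V>. A V) * exp (- (real n * c))" by (simp add: sum_distrib_right)
    also have "\<dots> \<le> (1 + (\<Sum>V\<in>\<V>. A V)) * exp (- (real n * c))" by (intro mult_right_mono) auto
    finally show "empirical_prob M \<eta> S n \<mu> B \<le> \<dots>" .
  qed
qed

lemma ereal_le_uminus_swap: "x \<le> - y \<Longrightarrow> y \<le> - x" for x y :: ereal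
  by (cases x; cases y) auto

lemma limsup_upper_bound:
  assumes B: "B \<in> borel_sets_of weak_star_topology"
  shows "limsup (\<lambda>n. SUP \<mu> \<in> prob_measures. ereal (1 / real n) * elog (empirical_prob M \<eta> S n \<mu> B))
    \<le> - (INF \<sigma> \<in> weak_star_topology closure_of B. rate \<sigma>)" (is "limsup ?X \<le> - ?I")
proof -
  have main: "limsup ?X \<le> - ereal c" if c: "ereal c < ?I" for c
  proof -
    have "ereal c < rate \<sigma>" if "\<sigma> \<in> weak_star_topology closure_of B" for \<sigma>
      using c INF_lower[OF that, of rate] by (rule less_le_trans)
    then obtain A where A: "0 < A" "\<And>n \<mu>. n > 0 \<Longrightarrow> \<mu> \<in> prob_measures \<Longrightarrow>
      empirical_prob M \<eta> S n \<mu> B \<le> A * exp (- (real n * c))"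
      by (rule exponential_upper_bound[OF B, of c]) blast+
    have le: "?X n \<le> ereal (ln A / real n - c)" if n: "n > 0" for n
    proof (rule SUP_least)
      fix \<mu> :: "'a measure" assume \<mu>: "\<mu> \<in> prob_measures"
      let ?p = "empirical_prob M \<eta> S n \<mu> B"
      have p0: "0 \<le> ?p" unfolding empirical_prob_def by simp
      show "ereal (1 / real n) * elog ?p \<le> ereal (ln A / real n - c)"
      proof (cases "?p = 0")
        case True then show ?thesis using n by (simp add: elog_def)
      next
        case False
        then have "ln ?p \<le> ln (A * exp (- (real n * c)))" using p0 A(2)[OF n \<mu>] by (intro ln_mono) auto
        also have "\<dots> = ln A - real n * c" using A(1) by (simp add: ln_mult)
        finally have "ln ?p / real n \<le> (ln A - real n * c) / real n" by (intro divide_right_mono) auto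
        then show ?thesis using False n by (simp add: elog_def diff_divide_distrib)
      qed
    qed
    have "limsup ?X \<le> limsup (\<lambda>n. ereal (ln A / real n - c))"
      by (rule Limsup_mono) (use le in \<open>auto simp: eventually_sequentially intro!: exI[of _ 1]\<close>)
    also have "\<dots> = ereal (0 - c)"
    proof (rule lim_imp_Limsup)
      have "(\<lambda>n. ln A / real n - c) \<longlonglongrightarrow> 0 - c"
        by (intro tendsto_diff lim_const_over_n tendsto_const)
      then show "(\<lambda>n. ereal (ln A / real n - c)) \<longlonglongrightarrow> ereal (0 - c)" by (rule tendsto_ereal)
    qed simp
    finally show ?thesis by simp
  qed
  have "?I \<le> - limsup ?X"
  proof (rule dense_le)
    fix y assume y: "y < ?I"
    show "y \<le> - limsup ?X"
    proof (cases y)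
      case (real c)
      then have "limsup ?X \<le> - y" using main[of c] y by simp
      then show ?thesis by (rule ereal_le_uminus_swap)
    qed (use y in auto)
  qed
  then show ?thesis by (rule ereal_le_uminus_swap)
qed

section \<open>Lower bound\<close>

text \<open>Under the law tilted by \<open>weight V n\<close>, deviations of the averages of \<open>W\<close> from the derivative \<open>m\<close> of the pressure
  are exponentially unlikely: tilting further by \<open>t * W\<close> or \<open>- t * W\<close> gains \<open>t * \<rho>\<close> and costs at most \<open>t * \<rho> / 2\<close> for small \<open>t\<close>.\<close>

lemma tilted_deviation:
  assumes V: "lipschitz_function V" and W: "lipschitz_function W" and \<rho>: "0 < \<rho>"
    and m: "\<And>\<eta>. 0 < \<eta> \<Longrightarrow> \<exists>\<delta>>0. \<forall>t. \<bar>t\<bar> \<le> \<delta> \<longrightarrow> \<Lambda> (\<lambda>x. V x + t * W x) \<le> \<Lambda> V + t * m + \<bar>t\<bar> * \<eta>"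
  obtains A \<beta> where "0 < A" "0 < \<beta>" "\<And>n \<mu>. n > 0 \<Longrightarrow> \<mu> \<in> prob_measures \<Longrightarrow>
    (\<integral>z. weight V n (sample z) * indicator {z. \<rho> \<le> \<bar>average W n (sample z) - m\<bar>} z \<partial>(\<mu> \<Otimes>\<^sub>M M))
      \<le> A * exp (real n * (\<Lambda> V - \<beta>))"
proof -
  obtain t where t: "0 < t" "\<And>s. \<bar>s\<bar> \<le> t \<Longrightarrow> \<Lambda> (\<lambda>x. V x + s * W x) \<le> \<Lambda> V + s * m + \<bar>s\<bar> * (\<rho> / 2)"
    using m[of "\<rho> / 2"] \<rho> by auto
  define V1 where "V1 x = V x + t * W x" for x
  define V2 where "V2 x = V x + (- t) * W x" for x
  have L: "lipschitz_function V1" "lipschitz_function V2"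
    unfolding V1_def V2_def by (intro lipschitz_function_add_mult V W)+
  have Vc: "continuous_on UNIV V" "continuous_on UNIV W" "continuous_on UNIV V1" "continuous_on UNIV V2"
    by (intro lipschitz_function_continuous V W L)+
  have P1: "\<Lambda> V1 \<le> \<Lambda> V + t * m + t * (\<rho> / 2)" using t(2)[of t] t(1) by (simp add: V1_def[abs_def])
  have P2: "\<Lambda> V2 \<le> \<Lambda> V - t * m + t * (\<rho> / 2)" using t(2)[of "- t"] t(1) by (simp add: V2_def[abs_def])
  obtain A1 where A1: "0 < A1"
    "\<And>n \<mu>. \<mu> \<in> prob_measures \<Longrightarrow> (\<integral>z. weight V1 n (sample z) \<partial>(\<mu> \<Otimes>\<^sub>M M)) \<le> A1 * exp (real n * \<Lambda> V1)"
    by (rule expectation_weight_bounds[OF L(1)]) blast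
  obtain A2 where A2: "0 < A2"
    "\<And>n \<mu>. \<mu> \<in> prob_measures \<Longrightarrow> (\<integral>z. weight V2 n (sample z) \<partial>(\<mu> \<Otimes>\<^sub>M M)) \<le> A2 * exp (real n * \<Lambda> V2)"
    by (rule expectation_weight_bounds[OF L(2)]) blast
  show thesis
  proof (rule that[of "A1 + A2" "t * (\<rho> / 2)"])
    show "0 < A1 + A2" "0 < t * (\<rho> / 2)" using A1 A2 t \<rho> by auto
    fix n :: nat and \<mu> :: "'a measure" assume n: "n > 0" and \<mu>: "\<mu> \<in> prob_measures"
    let ?E = "{z. \<rho> \<le> \<bar>average W n (sample z) - m\<bar>}"
    let ?e1 = "exp (- (real n * t * (m + \<rho>)))" and ?e2 = "exp (- (real n * t * (\<rho> - m)))"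
    note [measurable] = measurable_average[OF \<mu> Vc(2)] weight_measurable[OF \<mu> Vc(1)]
    have bound: "weight V n (sample z) * indicator ?E z \<le> ?e1 * weight V1 n (sample z) + ?e2 * weight V2 n (sample z)"
      for z
    proof (cases "z \<in> ?E")
      case False
      then show ?thesis by (simp add: weight_def)
    next
      case True
      let ?a = "average V n (sample z)" and ?w = "average W n (sample z)"
      have n0: "0 < real n * t" using n t by simp
      have e1: "?e1 * weight V1 n (sample z) = exp (real n * ?a + real n * t * (?w - (m + \<rho>)))"
        using n unfolding weight_average[OF n] V1_def average_add_mult exp_add[symmetric] by (simp add: algebra_simps)
      have e2: "?e2 * weight V2 n (sample z) = exp (real n * ?a + real n * t * (m - \<rho> - ?w))"
        using n unfolding weight_average[OF n] V2_def average_add_mult exp_add[symmetric] by (simp add: algebra_simps)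
      have w: "weight V n (sample z) = exp (real n * ?a)" by (rule weight_average[OF n])
      from True have "m + \<rho> \<le> ?w \<or> ?w \<le> m - \<rho>" by auto
      then show ?thesis
      proof
        assume "m + \<rho> \<le> ?w"
        then have "0 \<le> real n * t * (?w - (m + \<rho>))" using less_imp_le[OF n0] by simp
        then have "weight V n (sample z) \<le> ?e1 * weight V1 n (sample z)" unfolding e1 w by simp
        moreover have "0 \<le> ?e2 * weight V2 n (sample z)" unfolding e2 by simp
        ultimately show ?thesis using True by simp
      next
        assume "?w \<le> m - \<rho>"
        then have "0 \<le> real n * t * (m - \<rho> - ?w)" using less_imp_le[OF n0] by simp
        then have "weight V n (sample z) \<le> ?e2 * weight V2 n (sample z)" unfolding e2 w by simp
        moreover have "0 \<le> ?e1 * weight V1 n (sample z)" unfolding e1 by simp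
        ultimately show ?thesis using True by simp
      qed
    qed
    have int: "integrable (\<mu> \<Otimes>\<^sub>M M) (\<lambda>z. weight V n (sample z))" "integrable (\<mu> \<Otimes>\<^sub>M M) (\<lambda>z. weight V1 n (sample z))"
      "integrable (\<mu> \<Otimes>\<^sub>M M) (\<lambda>z. weight V2 n (sample z))"
      by (intro integrable_weight \<mu> Vc)+
    have "(\<integral>z. weight V n (sample z) * indicator ?E z \<partial>(\<mu> \<Otimes>\<^sub>M M))
      \<le> (\<integral>z. ?e1 * weight V1 n (sample z) + ?e2 * weight V2 n (sample z) \<partial>(\<mu> \<Otimes>\<^sub>M M))"
    proof (rule integral_mono[OF _ _ bound])
      show "integrable (\<mu> \<Otimes>\<^sub>M M) (\<lambda>z. weight V n (sample z) * indicator ?E z)"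
      proof (rule Bochner_Integration.integrable_bound[OF int(1)])
        show "(\<lambda>z. weight V n (sample z) * indicator ?E z) \<in> borel_measurable (\<mu> \<Otimes>\<^sub>M M)" by measurable
      qed (auto simp: indicator_def weight_def)
      show "integrable (\<mu> \<Otimes>\<^sub>M M) (\<lambda>z. ?e1 * weight V1 n (sample z) + ?e2 * weight V2 n (sample z))"
        using int by simp
    qed
    also have "\<dots> = ?e1 * (\<integral>z. weight V1 n (sample z) \<partial>(\<mu> \<Otimes>\<^sub>M M)) + ?e2 * (\<integral>z. weight V2 n (sample z) \<partial>(\<mu> \<Otimes>\<^sub>M M))"
      using int by simp
    also have "\<dots> \<le> ?e1 * (A1 * exp (real n * \<Lambda> V1)) + ?e2 * (A2 * exp (real n * \<Lambda> V2))"
      by (intro add_mono mult_left_mono A1 A2 \<mu>) auto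
    also have "\<dots> = A1 * exp (real n * (\<Lambda> V1 - t * m - t * \<rho>)) + A2 * exp (real n * (\<Lambda> V2 + t * m - t * \<rho>))"
      by (simp add: mult.left_commute[of "exp _"] exp_add[symmetric] algebra_simps)
    also have "\<dots> \<le> A1 * exp (real n * (\<Lambda> V - t * (\<rho> / 2))) + A2 * exp (real n * (\<Lambda> V - t * (\<rho> / 2)))"
    proof -
      have "real n * (\<Lambda> V1 - t * m - t * \<rho>) \<le> real n * (\<Lambda> V - t * (\<rho> / 2))"
        "real n * (\<Lambda> V2 + t * m - t * \<rho>) \<le> real n * (\<Lambda> V - t * (\<rho> / 2))"
      proof -
        have "\<Lambda> V1 - t * m - t * \<rho> \<le> \<Lambda> V - t * (\<rho> / 2)" "\<Lambda> V2 + t * m - t * \<rho> \<le> \<Lambda> V - t * (\<rho> / 2)"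
          using P1 P2 by (auto simp: field_simps)
        then show "real n * (\<Lambda> V1 - t * m - t * \<rho>) \<le> real n * (\<Lambda> V - t * (\<rho> / 2))"
          "real n * (\<Lambda> V2 + t * m - t * \<rho>) \<le> real n * (\<Lambda> V - t * (\<rho> / 2))"
          by (intro mult_left_mono; simp)+
      qed
      then show ?thesis using A1(1) A2(1) by (intro add_mono mult_left_mono) simp_all
    qed
    finally show "(\<integral>z. weight V n (sample z) * indicator ?E z \<partial>(\<mu> \<Otimes>\<^sub>M M))
      \<le> (A1 + A2) * exp (real n * (\<Lambda> V - t * (\<rho> / 2)))" by (simp add: distrib_right)
  qed
qed

text \<open>Most of the tilted mass sits where all averages are within \<open>\<rho>\<close> of their tilted means \<open>m\<close>; there the weight is
  bounded by \<open>exp (n * (\<Sum>V\<in>F. \<theta> V * m V))\<close> up to an error linear in \<open>\<rho>\<close>, and dividing by it removes the tilt.\<close>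

lemma exponential_minorant:
  fixes F :: "('a \<Rightarrow> real) set" and \<theta> :: "('a \<Rightarrow> real) \<Rightarrow> real"
  defines "V0 \<equiv> \<lambda>x. \<Sum>V\<in>F. \<theta> V * V x"
  assumes F: "finite F" "\<And>V. V \<in> F \<Longrightarrow> lipschitz_function V" and \<rho>: "0 < \<rho>"
    and m: "\<And>V \<eta>. V \<in> F \<Longrightarrow> 0 < \<eta> \<Longrightarrow> \<exists>\<delta>>0. \<forall>t. \<bar>t\<bar> \<le> \<delta> \<longrightarrow>
      \<Lambda> (\<lambda>x. V0 x + t * V x) \<le> \<Lambda> V0 + t * m V + \<bar>t\<bar> * \<eta>"
  obtains c n0 where "0 < c" "\<And>n \<mu>. n \<ge> n0 \<Longrightarrow> n > 0 \<Longrightarrow> \<mu> \<in> prob_measures \<Longrightarrow>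
    c * exp (real n * (\<Lambda> V0 - (\<Sum>V\<in>F. \<theta> V * m V) - \<rho> * (\<Sum>V\<in>F. \<bar>\<theta> V\<bar>)))
      \<le> measure (\<mu> \<Otimes>\<^sub>M M) {z \<in> space (\<mu> \<Otimes>\<^sub>M M). \<forall>V\<in>F. \<bar>average V n (sample z) - m V\<bar> < \<rho>}"
proof -
  have V0: "lipschitz_function V0" unfolding V0_def by (rule lipschitz_function_sum) (rule F)
  note V0c = lipschitz_function_continuous[OF V0]
  obtain c where c: "0 < c"
    "\<And>n \<mu>. \<mu> \<in> prob_measures \<Longrightarrow> c * exp (real n * \<Lambda> V0) \<le> (\<integral>z. weight V0 n (sample z) \<partial>(\<mu> \<Otimes>\<^sub>M M))"
    by (rule expectation_weight_bounds[OF V0]) blast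
  let ?D = "\<lambda>V n. {z. \<rho> \<le> \<bar>average V n (sample z) - m V\<bar>}"
  have "\<forall>V\<in>F. \<exists>A\<beta>. 0 < fst A\<beta> \<and> 0 < snd A\<beta> \<and> (\<forall>n \<mu>. n > 0 \<longrightarrow> \<mu> \<in> prob_measures \<longrightarrow>
    (\<integral>z. weight V0 n (sample z) * indicator (?D V n) z \<partial>(\<mu> \<Otimes>\<^sub>M M)) \<le> fst A\<beta> * exp (real n * (\<Lambda> V0 - snd A\<beta>)))"
  proof
    fix V assume V: "V \<in> F"
    obtain A \<beta> where "0 < A" "0 < \<beta>" "\<And>n \<mu>. n > 0 \<Longrightarrow> \<mu> \<in> prob_measures \<Longrightarrow>
      (\<integral>z. weight V0 n (sample z) * indicator (?D V n) z \<partial>(\<mu> \<Otimes>\<^sub>M M)) \<le> A * exp (real n * (\<Lambda> V0 - \<beta>))"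
      by (rule tilted_deviation[OF V0 F(2)[OF V] \<rho> m[OF V]]) blast+
    then show "\<exists>A\<beta>. 0 < fst A\<beta> \<and> 0 < snd A\<beta> \<and> (\<forall>n \<mu>. n > 0 \<longrightarrow> \<mu> \<in> prob_measures \<longrightarrow>
      (\<integral>z. weight V0 n (sample z) * indicator (?D V n) z \<partial>(\<mu> \<Otimes>\<^sub>M M)) \<le> fst A\<beta> * exp (real n * (\<Lambda> V0 - snd A\<beta>)))"
      by (intro exI[of _ "(A, \<beta>)"]) auto
  qed
  then have "\<exists>A\<beta>. \<forall>V\<in>F. 0 < fst (A\<beta> V) \<and> 0 < snd (A\<beta> V) \<and> (\<forall>n \<mu>. n > 0 \<longrightarrow> \<mu> \<in> prob_measures \<longrightarrow>
    (\<integral>z. weight V0 n (sample z) * indicator (?D V n) z \<partial>(\<mu> \<Otimes>\<^sub>M M)) \<le> fst (A\<beta> V) * exp (real n * (\<Lambda> V0 - snd (A\<beta> V))))"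
    by (rule bchoice)
  then obtain A\<beta> where A\<beta>: "\<forall>V\<in>F. 0 < fst (A\<beta> V) \<and> 0 < snd (A\<beta> V) \<and> (\<forall>n \<mu>. n > 0 \<longrightarrow> \<mu> \<in> prob_measures \<longrightarrow>
    (\<integral>z. weight V0 n (sample z) * indicator (?D V n) z \<partial>(\<mu> \<Otimes>\<^sub>M M)) \<le> fst (A\<beta> V) * exp (real n * (\<Lambda> V0 - snd (A\<beta> V))))"
    by (elim exE)
  define A where "A V = fst (A\<beta> V)" for V
  define \<beta> where "\<beta> V = snd (A\<beta> V)" for V
  have A: "0 < A V" and \<beta>: "0 < \<beta> V"
    and dev: "\<And>n \<mu>. n > 0 \<Longrightarrow> \<mu> \<in> prob_measures \<Longrightarrow>
      (\<integral>z. weight V0 n (sample z) * indicator (?D V n) z \<partial>(\<mu> \<Otimes>\<^sub>M M)) \<le> A V * exp (real n * (\<Lambda> V0 - \<beta> V))"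
    if "V \<in> F" for V
    using A\<beta>[rule_format, OF that] by (auto simp: A_def \<beta>_def)
  have "(\<lambda>n. \<Sum>V\<in>F. A V * exp (- \<beta> V) ^ n) \<longlonglongrightarrow> (\<Sum>V\<in>F. A V * 0)"
    using \<beta> by (intro tendsto_sum tendsto_mult tendsto_const LIMSEQ_realpow_zero) auto
  then have "\<forall>\<^sub>F n in sequentially. (\<Sum>V\<in>F. A V * exp (- \<beta> V) ^ n) < c / 2"
    using c(1) by (intro order_tendstoD) auto
  then obtain n0 where n0: "\<And>n. n \<ge> n0 \<Longrightarrow> (\<Sum>V\<in>F. A V * exp (- \<beta> V) ^ n) < c / 2"
    by (auto simp: eventually_sequentially)
  show thesis
  proof (rule that[of "c / 2" n0])
    show "0 < c / 2" using c by simp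
    fix n :: nat and \<mu> :: "'a measure" assume nn: "n \<ge> n0" and n: "n > 0" and \<mu>: "\<mu> \<in> prob_measures"
    interpret pp: pair_prob_space \<mu> M by (rule pair_prob[OF \<mu>])
    let ?E = "{z \<in> space (\<mu> \<Otimes>\<^sub>M M). \<forall>V\<in>F. \<bar>average V n (sample z) - m V\<bar> < \<rho>}"
    let ?s = "(\<Sum>V\<in>F. \<theta> V * m V) + \<rho> * (\<Sum>V\<in>F. \<bar>\<theta> V\<bar>)"
    have av: "(\<lambda>z. average V n (sample z)) \<in> borel_measurable (\<mu> \<Otimes>\<^sub>M M)" if "V \<in> F" for V
      using that by (intro measurable_average \<mu> lipschitz_function_continuous F)
    have E: "?E \<in> sets (\<mu> \<Otimes>\<^sub>M M)"
    proof (rule sets.sets_Collect_finite_All[OF _ F(1)])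
      fix V assume "V \<in> F"
      note [measurable] = av[OF this]
      show "{z \<in> space (\<mu> \<Otimes>\<^sub>M M). \<bar>average V n (sample z) - m V\<bar> < \<rho>} \<in> sets (\<mu> \<Otimes>\<^sub>M M)" by measurable
    qed
    have D: "(\<lambda>z. indicator (?D V n) z :: real) \<in> borel_measurable (\<mu> \<Otimes>\<^sub>M M)" if "V \<in> F" for V
    proof -
      note [measurable] = av[OF that]
      show ?thesis by measurable
    qed
    note intV0 = integrable_weight[OF \<mu> V0c, of n]
    have intD: "integrable (\<mu> \<Otimes>\<^sub>M M) (\<lambda>z. weight V0 n (sample z) * indicator (?D V n) z)" if "V \<in> F" for V
      by (rule Bochner_Integration.integrable_bound[OF intV0])
        (use D[OF that] weight_measurable[OF \<mu> V0c, of n] in \<open>auto simp: indicator_def weight_def\<close>)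
    have intE: "integrable (\<mu> \<Otimes>\<^sub>M M) (\<lambda>z. exp (real n * ?s) * indicator ?E z)"
      using E by (intro integrable_mult_right integrable_real_indicator) (auto simp: pp.P.emeasure_eq_measure)
    have "c * exp (real n * \<Lambda> V0) \<le> (\<integral>z. weight V0 n (sample z) \<partial>(\<mu> \<Otimes>\<^sub>M M))" by (rule c(2)[OF \<mu>])
    also have "\<dots> \<le> (\<integral>z. exp (real n * ?s) * indicator ?E z
      + (\<Sum>V\<in>F. weight V0 n (sample z) * indicator (?D V n) z) \<partial>(\<mu> \<Otimes>\<^sub>M M))"
    proof (rule integral_mono)
      show "integrable (\<mu> \<Otimes>\<^sub>M M) (\<lambda>z. weight V0 n (sample z))" by (rule intV0)
      show "integrable (\<mu> \<Otimes>\<^sub>M M) (\<lambda>z. exp (real n * ?s) * indicator ?E z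
        + (\<Sum>V\<in>F. weight V0 n (sample z) * indicator (?D V n) z))"
        by (intro Bochner_Integration.integrable_add Bochner_Integration.integrable_sum intE intD)
      fix z assume z: "z \<in> space (\<mu> \<Otimes>\<^sub>M M)"
      have nonneg: "0 \<le> weight V0 n (sample z) * indicator (?D V n) z" for V by (simp add: weight_def)
      show "weight V0 n (sample z) \<le> exp (real n * ?s) * indicator ?E z
        + (\<Sum>V\<in>F. weight V0 n (sample z) * indicator (?D V n) z)"
      proof (cases "z \<in> ?E")
        case True
        have "average V0 n (sample z) = (\<Sum>V\<in>F. \<theta> V * average V n (sample z))"
          unfolding V0_def by (rule average_sum)
        also have "\<dots> \<le> (\<Sum>V\<in>F. \<theta> V * m V + \<rho> * \<bar>\<theta> V\<bar>)"
        proof (rule sum_mono)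
          fix V assume "V \<in> F"
          then have "\<bar>average V n (sample z) - m V\<bar> \<le> \<rho>" using True by auto
          then have "\<bar>\<theta> V\<bar> * \<bar>average V n (sample z) - m V\<bar> \<le> \<bar>\<theta> V\<bar> * \<rho>" by (intro mult_left_mono) auto
          then have "\<theta> V * (average V n (sample z) - m V) \<le> \<bar>\<theta> V\<bar> * \<rho>"
            unfolding abs_mult[symmetric] by linarith
          then show "\<theta> V * average V n (sample z) \<le> \<theta> V * m V + \<rho> * \<bar>\<theta> V\<bar>" by (simp add: algebra_simps)
        qed
        also have "\<dots> = ?s" by (simp add: sum.distrib sum_distrib_left)
        finally have "weight V0 n (sample z) \<le> exp (real n * ?s)"
          unfolding weight_average[OF n] by (simp add: mult_left_mono)
        moreover have "0 \<le> (\<Sum>V\<in>F. weight V0 n (sample z) * indicator (?D V n) z)"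
          by (intro sum_nonneg nonneg)
        ultimately show ?thesis using True by simp
      next
        case False
        then obtain V where V: "V \<in> F" "z \<in> ?D V n" using z by (auto simp: not_less)
        have "weight V0 n (sample z) * indicator (?D V n) z \<le> (\<Sum>V\<in>F. weight V0 n (sample z) * indicator (?D V n) z)"
          using nonneg F(1) V(1) by (intro member_le_sum) auto
        then show ?thesis using V(2) False by simp
      qed
    qed
    also have "\<dots> = exp (real n * ?s) * measure (\<mu> \<Otimes>\<^sub>M M) ?E
      + (\<Sum>V\<in>F. \<integral>z. weight V0 n (sample z) * indicator (?D V n) z \<partial>(\<mu> \<Otimes>\<^sub>M M))"
      using intE E by (simp add: intD Bochner_Integration.integral_sum)
    also have "\<dots> \<le> exp (real n * ?s) * measure (\<mu> \<Otimes>\<^sub>M M) ?E + (\<Sum>V\<in>F. A V * exp (real n * (\<Lambda> V0 - \<beta> V)))"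
      by (intro add_left_mono sum_mono dev n \<mu>)
    also have "(\<Sum>V\<in>F. A V * exp (real n * (\<Lambda> V0 - \<beta> V))) = (\<Sum>V\<in>F. A V * exp (- \<beta> V) ^ n) * exp (real n * \<Lambda> V0)"
      unfolding sum_distrib_right
      by (rule sum.cong[OF refl]) (simp add: exp_of_nat_mult[symmetric] exp_add[symmetric] algebra_simps)
    also have "\<dots> \<le> c / 2 * exp (real n * \<Lambda> V0)" using n0[OF nn] by (intro mult_right_mono) auto
    finally have "c / 2 * exp (real n * \<Lambda> V0) \<le> exp (real n * ?s) * measure (\<mu> \<Otimes>\<^sub>M M) ?E" by simp
    then have "c / 2 * exp (real n * \<Lambda> V0) * exp (- (real n * ?s))
      \<le> exp (real n * ?s) * measure (\<mu> \<Otimes>\<^sub>M M) ?E * exp (- (real n * ?s))"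
      by (rule mult_right_mono) simp
    also have "\<dots> = measure (\<mu> \<Otimes>\<^sub>M M) ?E" by (simp add: exp_minus)
    finally have "c / 2 * exp (real n * \<Lambda> V0) * exp (- (real n * ?s)) \<le> measure (\<mu> \<Otimes>\<^sub>M M) ?E" .
    then show "c / 2 * exp (real n * (\<Lambda> V0 - (\<Sum>V\<in>F. \<theta> V * m V) - \<rho> * (\<Sum>V\<in>F. \<bar>\<theta> V\<bar>)))
      \<le> measure (\<mu> \<Otimes>\<^sub>M M) ?E"
      by (simp add: mult.assoc exp_add[symmetric] algebra_simps)
  qed
qed

text \<open>The target means \<open>z\<close> need not be attained as derivatives of the pressure. The penalty \<open>\<delta> / 2 * |\<theta>|\<^sup>2\<close> makes the dual problem
  coercive, so that \<open>J\<close> has a minimizer; its Euler equation is \<open>m V = z V - \<delta> * \<theta> V\<close>. Comparing \<open>J \<theta>\<close> with \<open>J 0 = 0\<close> bounds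
  \<open>\<delta> * |\<theta>|\<^sup>2 / 2\<close> by \<open>a\<close>, hence the displacement \<open>m - z\<close>, and moving the mean from \<open>z\<close> to \<open>m\<close> does not raise
  the cost. Coefficient vectors are functions on test functions, with coordinates outside \<open>F\<close> set to 0 for compactness.\<close>

lemma optimal_tilt:
  fixes F :: "('a \<Rightarrow> real) set" and z :: "('a \<Rightarrow> real) \<Rightarrow> real" and a \<delta> :: real
  defines "comb \<equiv> \<lambda>\<theta> x. \<Sum>V\<in>F. \<theta> V * V x"
  assumes F: "finite F" "\<And>V. V \<in> F \<Longrightarrow> lipschitz_function V" and \<delta>: "0 < \<delta>" and a: "0 \<le> a"
    and dual: "\<And>\<theta>. (\<Sum>V\<in>F. \<theta> V * z V) - \<Lambda> (comb \<theta>) \<le> a"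
  obtains \<theta> m where "\<And>V \<eta>. V \<in> F \<Longrightarrow> 0 < \<eta> \<Longrightarrow> \<exists>\<epsilon>>0. \<forall>t. \<bar>t\<bar> \<le> \<epsilon> \<longrightarrow>
      \<Lambda> (\<lambda>x. comb \<theta> x + t * V x) \<le> \<Lambda> (comb \<theta>) + t * m V + \<bar>t\<bar> * \<eta>"
    "\<And>V. V \<in> F \<Longrightarrow> (m V - z V)\<^sup>2 \<le> 2 * \<delta> * a" "- a \<le> \<Lambda> (comb \<theta>) - (\<Sum>V\<in>F. \<theta> V * m V)"
proof -
  have comb: "lipschitz_function (comb \<theta>)" for \<theta>
    unfolding comb_def by (rule lipschitz_function_sum) (rule F)
  define J where "J \<theta> = \<Lambda> (comb \<theta>) - (\<Sum>V\<in>F. \<theta> V * z V) + \<delta> / 2 * (\<Sum>V\<in>F. (\<theta> V)\<^sup>2)" for \<theta>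
  have J_lower: "\<delta> / 2 * (\<Sum>V\<in>F. (\<theta> V)\<^sup>2) - a \<le> J \<theta>" for \<theta> using dual[of \<theta>] by (simp add: J_def)
  have comb0: "comb (\<lambda>_. 0) = (\<lambda>_. 0)" by (simp add: comb_def)
  have J0: "J (\<lambda>_. 0) = 0" unfolding J_def comb0 kernel.pressure_zero by simp
  have "\<forall>V\<in>F. \<exists>b. \<forall>x. \<bar>V x\<bar> \<le> b"
    using continuous_bounded[OF compact_X lipschitz_function_continuous[OF F(2)]] by metis
  then obtain b where b: "\<And>V x. V \<in> F \<Longrightarrow> \<bar>V x\<bar> \<le> b V" using bchoice[of F "\<lambda>V b. \<forall>x. \<bar>V x\<bar> \<le> b"] by blast
  have press_lip: "\<bar>\<Lambda> (comb \<theta>) - \<Lambda> (comb \<theta>')\<bar> \<le> (\<Sum>V\<in>F. \<bar>\<theta> V - \<theta>' V\<bar> * b V)" for \<theta> \<theta>'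
  proof -
    have diff: "comb \<theta> x \<le> comb \<theta>' x + (\<Sum>V\<in>F. \<bar>\<theta> V - \<theta>' V\<bar> * b V)" for \<theta> \<theta>' x
    proof -
      have "comb \<theta> x - comb \<theta>' x = (\<Sum>V\<in>F. (\<theta> V - \<theta>' V) * V x)"
        by (simp add: comb_def sum_subtractf left_diff_distrib)
      also have "\<dots> \<le> (\<Sum>V\<in>F. \<bar>\<theta> V - \<theta>' V\<bar> * b V)"
      proof (rule sum_mono)
        fix V assume "V \<in> F"
        then have "\<bar>\<theta> V - \<theta>' V\<bar> * \<bar>V x\<bar> \<le> \<bar>\<theta> V - \<theta>' V\<bar> * b V" by (intro mult_left_mono b) auto
        then show "(\<theta> V - \<theta>' V) * V x \<le> \<bar>\<theta> V - \<theta>' V\<bar> * b V" unfolding abs_mult[symmetric] by linarith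
      qed
      finally show ?thesis by simp
    qed
    have "\<Lambda> (comb \<theta>) \<le> \<Lambda> (comb \<theta>') + (\<Sum>V\<in>F. \<bar>\<theta> V - \<theta>' V\<bar> * b V)" for \<theta> \<theta>'
      by (intro kernel.pressure_mono lipschitz_function_continuous comb diff)
    from this[of \<theta> \<theta>'] this[of \<theta>' \<theta>] show ?thesis by (simp add: abs_minus_commute abs_le_iff)
  qed
  have coord: "continuous_on UNIV (\<lambda>\<theta>::('a\<Rightarrow>real)\<Rightarrow>real. \<theta> V)" for V
    by (rule continuous_on_product_coordinates)
  have press_cont: "continuous_on UNIV (\<lambda>\<theta>. \<Lambda> (comb \<theta>))"
    unfolding continuous_on_def
  proof
    fix \<theta>0 :: "('a \<Rightarrow> real) \<Rightarrow> real"
    have "((\<lambda>\<theta>. \<Sum>V\<in>F. \<bar>\<theta> V - \<theta>0 V\<bar> * b V) \<longlongrightarrow> (\<Sum>V\<in>F. \<bar>\<theta>0 V - \<theta>0 V\<bar> * b V)) (at \<theta>0 within UNIV)"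
      using coord unfolding continuous_on_def by (intro tendsto_intros) auto
    then have "((\<lambda>\<theta>. \<Sum>V\<in>F. \<bar>\<theta> V - \<theta>0 V\<bar> * b V) \<longlongrightarrow> 0) (at \<theta>0 within UNIV)" by simp
    then have "((\<lambda>\<theta>. \<Lambda> (comb \<theta>) - \<Lambda> (comb \<theta>0)) \<longlongrightarrow> 0) (at \<theta>0 within UNIV)"
      by (rule Lim_null_comparison[rotated]) (use press_lip in auto)
    then show "((\<lambda>\<theta>. \<Lambda> (comb \<theta>)) \<longlongrightarrow> \<Lambda> (comb \<theta>0)) (at \<theta>0 within UNIV)" by (rule LIM_zero_cancel)
  qed
  have J_cont: "continuous_on UNIV J"
    unfolding J_def by (intro continuous_intros press_cont coord)
  define R where "R = sqrt (2 * (a + 1) / \<delta>)"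
  have R: "0 < R" "\<delta> / 2 * R\<^sup>2 = a + 1" using a \<delta> by (auto simp: R_def)
  define K where "K = PiE UNIV (\<lambda>V. if V \<in> F then {- R..R} else {0})"
  have "compactin (product_topology (\<lambda>_. euclidean) UNIV) K"
    unfolding K_def by (subst compactin_PiE) auto
  then have "compact K" by (simp add: euclidean_product_topology)
  moreover have K0: "(\<lambda>_. 0) \<in> K" using R by (auto simp: K_def)
  ultimately obtain \<theta> where \<theta>: "\<theta> \<in> K" "\<And>\<theta>'. \<theta>' \<in> K \<Longrightarrow> J \<theta> \<le> J \<theta>'"
    using continuous_attains_inf[of K J] continuous_on_subset[OF J_cont] by (metis empty_iff subset_UNIV)
  have J\<theta>: "J \<theta> \<le> 0" using \<theta>(2)[OF K0] J0 by simp
  have minimal: "J \<theta> \<le> J \<theta>'" for \<theta>'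
  proof (cases "\<forall>V\<in>F. \<bar>\<theta>' V\<bar> \<le> R")
    case True
    define \<theta>'' where "\<theta>'' V = (if V \<in> F then \<theta>' V else 0)" for V
    have "- R \<le> \<theta>' V \<and> \<theta>' V \<le> R" if "V \<in> F" for V using bspec[OF True that] by linarith
    then have "\<theta>'' \<in> K" unfolding K_def \<theta>''_def by auto
    moreover have "J \<theta>'' = J \<theta>'"
    proof -
      have "comb \<theta>'' = comb \<theta>'" by (auto simp: comb_def \<theta>''_def fun_eq_iff intro!: sum.cong)
      then show ?thesis unfolding J_def by (simp add: \<theta>''_def cong: sum.cong_simp)
    qed
    ultimately show ?thesis using \<theta>(2) by metis
  next
    case False
    then obtain V where V: "V \<in> F" "R < \<bar>\<theta>' V\<bar>" by (auto simp: not_le)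
    have "R\<^sup>2 \<le> (\<theta>' V)\<^sup>2" using V(2) R(1) by (simp add: abs_le_square_iff[symmetric])
    also have "\<dots> \<le> (\<Sum>V\<in>F. (\<theta>' V)\<^sup>2)" using F(1) V(1) by (intro member_le_sum) auto
    finally have "\<delta> / 2 * R\<^sup>2 \<le> \<delta> / 2 * (\<Sum>V\<in>F. (\<theta>' V)\<^sup>2)" using \<delta> by (intro mult_left_mono) auto
    then have "0 \<le> J \<theta>'" using J_lower[of \<theta>'] R(2) by linarith
    then show ?thesis using J\<theta> by linarith
  qed
  have "\<forall>V\<in>F. \<exists>m. \<forall>\<eta>>0. \<exists>\<epsilon>>0. \<forall>t. \<bar>t\<bar> \<le> \<epsilon> \<longrightarrow>
      \<Lambda> (\<lambda>x. comb \<theta> x + t * V x) \<le> \<Lambda> (comb \<theta>) + t * m + \<bar>t\<bar> * \<eta>"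
  proof
    fix V assume V: "V \<in> F"
    show "\<exists>m. \<forall>\<eta>>0. \<exists>\<epsilon>>0. \<forall>t. \<bar>t\<bar> \<le> \<epsilon> \<longrightarrow>
      \<Lambda> (\<lambda>x. comb \<theta> x + t * V x) \<le> \<Lambda> (comb \<theta>) + t * m + \<bar>t\<bar> * \<eta>"
      by (rule pressure_differentiable[OF comb F(2)[OF V]]) blast
  qed
  from bchoice[OF this] obtain m where m: "\<And>V \<eta>. V \<in> F \<Longrightarrow> 0 < \<eta> \<Longrightarrow> \<exists>\<epsilon>>0. \<forall>t. \<bar>t\<bar> \<le> \<epsilon> \<longrightarrow>
      \<Lambda> (\<lambda>x. comb \<theta> x + t * V x) \<le> \<Lambda> (comb \<theta>) + t * m V + \<bar>t\<bar> * \<eta>"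
    by blast
  have euler: "m V = z V - \<delta> * \<theta> V" if V: "V \<in> F" for V
  proof (rule ccontr)
    define D where "D = m V - z V + \<delta> * \<theta> V"
    assume "m V \<noteq> z V - \<delta> * \<theta> V"
    then have D: "D \<noteq> 0" by (simp add: D_def)
    then obtain \<epsilon> where \<epsilon>: "0 < \<epsilon>" "\<And>t. \<bar>t\<bar> \<le> \<epsilon> \<Longrightarrow>
      \<Lambda> (\<lambda>x. comb \<theta> x + t * V x) \<le> \<Lambda> (comb \<theta>) + t * m V + \<bar>t\<bar> * (\<bar>D\<bar> / 4)"
      using m[OF V, of "\<bar>D\<bar> / 4"] by auto
    \<comment> \<open>A step of length \<open>s\<close> against the sign of \<open>D\<close> would decrease \<open>J\<close>: the linear gain is at least \<open>3 / 4 * s * \<bar>D\<bar>\<close>, the quadratic term at most half of \<open>s * \<bar>D\<bar>\<close>.\<close>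
    define s where "s = min \<epsilon> (\<bar>D\<bar> / \<delta>)"
    have s: "0 < s" "s \<le> \<epsilon>" "\<delta> * s \<le> \<bar>D\<bar>" using \<epsilon>(1) D \<delta> by (auto simp: s_def min_def field_simps)
    define t where "t = - sgn D * s"
    have t: "\<bar>t\<bar> = s" "t * D = - (s * \<bar>D\<bar>)" "t\<^sup>2 = s\<^sup>2"
      using s(1) D by (auto simp: t_def abs_mult sgn_if power_mult_distrib)
    define \<theta>' where "\<theta>' = \<theta>(V := \<theta> V + t)"
    have upd: "(\<Sum>W\<in>F. \<theta>' W * g W) = (\<Sum>W\<in>F. \<theta> W * g W) + t * g V" for g :: "('a \<Rightarrow> real) \<Rightarrow> real"
    proof -
      have "(\<Sum>W\<in>F. \<theta>' W * g W) = (\<Sum>W\<in>F. \<theta> W * g W + (if W = V then t * g V else 0))"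
        by (rule sum.cong) (auto simp: \<theta>'_def distrib_right)
      then show ?thesis using F(1) V by (simp add: sum.distrib)
    qed
    have sq: "(\<Sum>W\<in>F. (\<theta>' W)\<^sup>2) = (\<Sum>W\<in>F. (\<theta> W)\<^sup>2) + (2 * t * \<theta> V + t\<^sup>2)"
    proof -
      have "(\<Sum>W\<in>F. (\<theta>' W)\<^sup>2) = (\<Sum>W\<in>F. (\<theta> W)\<^sup>2 + (if W = V then 2 * t * \<theta> V + t\<^sup>2 else 0))"
        by (rule sum.cong) (auto simp: \<theta>'_def power2_sum)
      then show ?thesis using F(1) V by (simp add: sum.distrib)
    qed
    have comb': "comb \<theta>' = (\<lambda>x. comb \<theta> x + t * V x)"
      using upd[of "\<lambda>W. W x" for x] by (simp add: comb_def fun_eq_iff)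
    have "J \<theta> \<le> J \<theta>'" by (rule minimal)
    also have "\<dots> = J \<theta> + (\<Lambda> (\<lambda>x. comb \<theta> x + t * V x) - \<Lambda> (comb \<theta>)) - t * z V + \<delta> * t * \<theta> V + \<delta> / 2 * t\<^sup>2"
      unfolding J_def comb' upd sq by (simp add: algebra_simps)
    also have "\<dots> \<le> J \<theta> + (t * m V + \<bar>t\<bar> * (\<bar>D\<bar> / 4)) - t * z V + \<delta> * t * \<theta> V + \<delta> / 2 * t\<^sup>2"
      using \<epsilon>(2)[of t] s t by simp
    also have "\<dots> = J \<theta> + t * D + \<bar>t\<bar> * (\<bar>D\<bar> / 4) + \<delta> / 2 * t\<^sup>2" by (simp add: D_def algebra_simps)
    also have "\<dots> = J \<theta> + s * (\<delta> * s / 2 - 3 / 4 * \<bar>D\<bar>)"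
      unfolding t by (simp add: power2_eq_square algebra_simps)
    finally have "0 \<le> s * (\<delta> * s / 2 - 3 / 4 * \<bar>D\<bar>)" by simp
    then have "3 / 4 * \<bar>D\<bar> \<le> \<delta> * s / 2" using s(1) by (simp add: zero_le_mult_iff)
    then show False using s(3) D by auto
  qed
  have sq_sum: "\<delta> / 2 * (\<Sum>V\<in>F. (\<theta> V)\<^sup>2) \<le> a" using J_lower[of \<theta>] J\<theta> by linarith
  show thesis
  proof (rule that[OF m])
    fix V assume V: "V \<in> F"
    have "(\<theta> V)\<^sup>2 \<le> (\<Sum>V\<in>F. (\<theta> V)\<^sup>2)" using F(1) V by (intro member_le_sum) auto
    then have "\<delta> / 2 * (\<theta> V)\<^sup>2 \<le> a" using \<delta> by (intro order_trans[OF mult_left_mono sq_sum]) auto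
    then have "2 * \<delta> * (\<delta> / 2 * (\<theta> V)\<^sup>2) \<le> 2 * \<delta> * a" using \<delta> by (intro mult_left_mono) auto
    then show "(m V - z V)\<^sup>2 \<le> 2 * \<delta> * a"
      unfolding euler[OF V] by (simp add: power_mult_distrib power2_eq_square mult_ac)
  next
    have "(\<Sum>V\<in>F. \<theta> V * m V) = (\<Sum>V\<in>F. \<theta> V * z V) - \<delta> * (\<Sum>V\<in>F. (\<theta> V)\<^sup>2)"
      by (simp add: euler right_diff_distrib sum_subtractf sum_distrib_left power2_eq_square mult_ac)
    moreover have "0 \<le> \<delta> * (\<Sum>V\<in>F. (\<theta> V)\<^sup>2)" using \<delta> by (simp add: sum_nonneg)
    ultimately show "- a \<le> \<Lambda> (comb \<theta>) - (\<Sum>V\<in>F. \<theta> V * m V)" using dual[of \<theta>] by linarith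
  qed
qed

text \<open>The finite-dimensional problem satisfies the duality bound of lemma \<open>optimal_tilt\<close> with the value \<open>a\<close> of the rate function,
  which is a supremum over all potentials. The constant \<open>\<delta>\<close> keeps the tilted means within \<open>r / 2\<close> of the integrals of \<open>\<sigma>\<close>,
  and \<open>\<rho> \<le> r / 2\<close> keeps the averages in the neighbourhood.\<close>

lemma exponential_lower_bound:
  assumes B: "B \<in> borel_sets_of weak_star_topology"
    and \<sigma>: "\<sigma> \<in> weak_star_topology interior_of B" and a: "rate \<sigma> = ereal a" and \<kappa>: "0 < \<kappa>"
  obtains c n0 where "0 < c" "\<And>n \<mu>. n \<ge> n0 \<Longrightarrow> n > 0 \<Longrightarrow> \<mu> \<in> prob_measures \<Longrightarrow>
    c * exp (- (real n * (a + \<kappa>))) \<le> empirical_prob M \<eta> S n \<mu> B"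
proof -
  have a0: "0 \<le> a" using rate_nonneg[of \<sigma>] a by simp
  have \<sigma>P: "\<sigma> \<in> prob_measures" using \<sigma> interior_of_subset_topspace by fastforce
  obtain F r where F: "finite F" "\<And>V. V \<in> F \<Longrightarrow> lipschitz_function V" and r: "0 < r"
    and nbhd: "\<And>\<tau>. \<tau> \<in> prob_measures \<Longrightarrow> (\<And>V. V \<in> F \<Longrightarrow> \<bar>integral\<^sup>L \<tau> V - integral\<^sup>L \<sigma> V\<bar> < r) \<Longrightarrow>
      \<tau> \<in> weak_star_topology interior_of B"
    by (rule weak_star_neighbourhood[OF compact_X openin_interior_of \<sigma>]) blast
  define \<delta> where "\<delta> = r\<^sup>2 / (16 * (a + 1))"
  have \<delta>: "0 < \<delta>" using r a0 by (simp add: \<delta>_def)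
  have small: "2 * \<delta> * a \<le> (r / 2)\<^sup>2"
  proof -
    have "\<delta> * a \<le> \<delta> * (a + 1)" using \<delta> by (intro mult_left_mono) auto
    also have "\<dots> = r\<^sup>2 / 16"
    proof -
      have "r\<^sup>2 / (16 * u) * u = r\<^sup>2 / 16" if "u \<noteq> 0" for u using that by simp
      from this[of "a + 1"] show ?thesis using a0 by (simp only: \<delta>_def)
    qed
    finally have "\<delta> * a \<le> r\<^sup>2 / 16" by simp
    moreover have "(r / 2)\<^sup>2 = r\<^sup>2 / 4" by (simp add: power_divide)
    ultimately show ?thesis using zero_le_power2[of r] by linarith
  qed
  have dual: "(\<Sum>V\<in>F. \<theta> V * integral\<^sup>L \<sigma> V) - \<Lambda> (\<lambda>x. \<Sum>V\<in>F. \<theta> V * V x) \<le> a" for \<theta>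
  proof -
    have "integral\<^sup>L \<sigma> (\<lambda>x. \<Sum>V\<in>F. \<theta> V * V x) = (\<Sum>V\<in>F. \<theta> V * integral\<^sup>L \<sigma> V)"
      using integrable_continuous[OF compact_X \<sigma>P lipschitz_function_continuous[OF F(2)]]
      by (simp add: Bochner_Integration.integral_sum)
    moreover have "lipschitz_function (\<lambda>x. \<Sum>V\<in>F. \<theta> V * V x)" by (rule lipschitz_function_sum) (rule F)
    ultimately show ?thesis using rate_upper[of "\<lambda>x. \<Sum>V\<in>F. \<theta> V * V x" \<sigma>] a by simp
  qed
  obtain \<theta> m where m: "\<And>V \<eta>. V \<in> F \<Longrightarrow> 0 < \<eta> \<Longrightarrow> \<exists>\<epsilon>>0. \<forall>t. \<bar>t\<bar> \<le> \<epsilon> \<longrightarrow>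
      \<Lambda> (\<lambda>x. (\<Sum>V\<in>F. \<theta> V * V x) + t * V x) \<le> \<Lambda> (\<lambda>x. \<Sum>V\<in>F. \<theta> V * V x) + t * m V + \<bar>t\<bar> * \<eta>"
    and near: "\<And>V. V \<in> F \<Longrightarrow> (m V - integral\<^sup>L \<sigma> V)\<^sup>2 \<le> 2 * \<delta> * a"
    and tilt_value: "- a \<le> \<Lambda> (\<lambda>x. \<Sum>V\<in>F. \<theta> V * V x) - (\<Sum>V\<in>F. \<theta> V * m V)"
    by (rule optimal_tilt[OF F \<delta> a0 dual]) blast+
  have near': "\<bar>m V - integral\<^sup>L \<sigma> V\<bar> \<le> r / 2" if "V \<in> F" for V
    using order_trans[OF near[OF that] small] r by (simp add: abs_le_square_iff[symmetric])
  let ?t = "\<Sum>V\<in>F. \<bar>\<theta> V\<bar>"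
  have t0: "0 \<le> ?t" by (simp add: sum_nonneg)
  define \<rho> where "\<rho> = min (r / 2) (\<kappa> / (?t + 1))"
  have \<rho>: "0 < \<rho>" "\<rho> \<le> r / 2" unfolding \<rho>_def using r \<kappa> t0 by (simp_all only: min.cobounded1) (simp add: add_nonneg_pos)
  have \<rho>t: "\<rho> * ?t \<le> \<kappa>"
  proof -
    have "\<rho> * ?t \<le> \<kappa> / (?t + 1) * (?t + 1)" using t0 \<kappa> by (intro mult_mono) (auto simp: \<rho>_def)
    then show ?thesis using t0 by simp
  qed
  obtain c n0 where c: "0 < c" "\<And>n \<mu>. n \<ge> n0 \<Longrightarrow> n > 0 \<Longrightarrow> \<mu> \<in> prob_measures \<Longrightarrow>
    c * exp (real n * (\<Lambda> (\<lambda>x. \<Sum>V\<in>F. \<theta> V * V x) - (\<Sum>V\<in>F. \<theta> V * m V) - \<rho> * ?t))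
      \<le> measure (\<mu> \<Otimes>\<^sub>M M) {z \<in> space (\<mu> \<Otimes>\<^sub>M M). \<forall>V\<in>F. \<bar>average V n (sample z) - m V\<bar> < \<rho>}"
    by (rule exponential_minorant[OF F \<rho>(1) m]) blast+
  show thesis
  proof (rule that[OF c(1)])
    fix n :: nat and \<mu> :: "'a measure" assume nn: "n \<ge> n0" and n: "n > 0" and \<mu>: "\<mu> \<in> prob_measures"
    interpret pp: pair_prob_space \<mu> M by (rule pair_prob[OF \<mu>])
    have "c * exp (- (real n * (a + \<kappa>)))
      \<le> c * exp (real n * (\<Lambda> (\<lambda>x. \<Sum>V\<in>F. \<theta> V * V x) - (\<Sum>V\<in>F. \<theta> V * m V) - \<rho> * ?t))"
    proof -
      have "- (a + \<kappa>) \<le> \<Lambda> (\<lambda>x. \<Sum>V\<in>F. \<theta> V * V x) - (\<Sum>V\<in>F. \<theta> V * m V) - \<rho> * ?t"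
        using tilt_value \<rho>t by linarith
      then have "real n * - (a + \<kappa>) \<le> real n * (\<Lambda> (\<lambda>x. \<Sum>V\<in>F. \<theta> V * V x) - (\<Sum>V\<in>F. \<theta> V * m V) - \<rho> * ?t)"
        by (rule mult_left_mono) simp
      then show ?thesis using c(1) by (intro mult_left_mono) (simp_all only: exp_le_cancel_iff mult_minus_right less_imp_le)
    qed
    also have "\<dots> \<le> measure (\<mu> \<Otimes>\<^sub>M M) {z \<in> space (\<mu> \<Otimes>\<^sub>M M). \<forall>V\<in>F. \<bar>average V n (sample z) - m V\<bar> < \<rho>}"
      by (rule c(2)[OF nn n \<mu>])
    also have "\<dots> \<le> empirical_prob M \<eta> S n \<mu> B"
      unfolding empirical_prob_eq[OF \<mu>]
    proof (rule pp.P.finite_measure_mono)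
      show "{z \<in> space (\<mu> \<Otimes>\<^sub>M M). empirical_measure n (sample z) \<in> B} \<in> sets (\<mu> \<Otimes>\<^sub>M M)"
        by (rule empirical_event[OF \<mu> n B])
      show "{z \<in> space (\<mu> \<Otimes>\<^sub>M M). \<forall>V\<in>F. \<bar>average V n (sample z) - m V\<bar> < \<rho>}
        \<subseteq> {z \<in> space (\<mu> \<Otimes>\<^sub>M M). empirical_measure n (sample z) \<in> B}"
      proof clarify
        fix x \<omega> assume *: "\<forall>V\<in>F. \<bar>average V n (sample (x, \<omega>)) - m V\<bar> < \<rho>"
        have "empirical_measure n (sample (x, \<omega>)) \<in> weak_star_topology interior_of B"
        proof (rule nbhd[OF empirical_measure_in_prob_measures[OF n]])
          fix V assume V: "V \<in> F"
          have "\<bar>average V n (sample (x, \<omega>)) - m V\<bar> < \<rho>" using * V by blast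
          then show "\<bar>integral\<^sup>L (empirical_measure n (sample (x, \<omega>))) V - integral\<^sup>L \<sigma> V\<bar> < r"
            unfolding integral_empirical[OF n lipschitz_function_continuous[OF F(2)[OF V]]]
            using near'[OF V] \<rho>(2) by linarith
        qed
        then show "empirical_measure n (sample (x, \<omega>)) \<in> B" using interior_of_subset by fastforce
      qed
    qed
    finally show "c * exp (- (real n * (a + \<kappa>))) \<le> empirical_prob M \<eta> S n \<mu> B" .
  qed
qed

lemma liminf_lower_bound:
  assumes B: "B \<in> borel_sets_of weak_star_topology"
  shows "- (INF \<sigma> \<in> weak_star_topology interior_of B. rate \<sigma>)
    \<le> liminf (\<lambda>n. INF \<mu> \<in> prob_measures. ereal (1 / real n) * elog (empirical_prob M \<eta> S n \<mu> B))"
    (is "- ?I \<le> liminf ?X")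
proof -
  have main: "- rate \<sigma> \<le> liminf ?X" if \<sigma>: "\<sigma> \<in> weak_star_topology interior_of B" for \<sigma>
  proof (cases "rate \<sigma>")
    case (real a)
    show ?thesis
    proof (rule ereal_le_epsilon2)
        fix \<kappa> :: real assume \<kappa>: "0 < \<kappa>"
        obtain c n0 where c: "0 < c" "\<And>n \<mu>. n \<ge> n0 \<Longrightarrow> n > 0 \<Longrightarrow> \<mu> \<in> prob_measures \<Longrightarrow>
          c * exp (- (real n * (a + \<kappa>))) \<le> empirical_prob M \<eta> S n \<mu> B"
          by (rule exponential_lower_bound[OF B \<sigma> real \<kappa>]) blast
        have le: "ereal (ln c / real n - (a + \<kappa>)) \<le> ?X n" if n: "n \<ge> n0" "n > 0" for n
        proof (rule INF_greatest)
          fix \<mu> :: "'a measure" assume \<mu>: "\<mu> \<in> prob_measures"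
          let ?p = "empirical_prob M \<eta> S n \<mu> B"
          have pos: "0 < c * exp (- (real n * (a + \<kappa>)))" using c(1) by simp
          then have p: "0 < ?p" using c(2)[OF n \<mu>] by linarith
          have "ln c - real n * (a + \<kappa>) = ln (c * exp (- (real n * (a + \<kappa>))))" using c(1) by (simp add: ln_mult)
          also have "\<dots> \<le> ln ?p" using c(2)[OF n \<mu>] pos by (intro ln_mono) auto
          finally have "(ln c - real n * (a + \<kappa>)) / real n \<le> ln ?p / real n" by (intro divide_right_mono) auto
          then show "ereal (ln c / real n - (a + \<kappa>)) \<le> ereal (1 / real n) * elog ?p"
            using p n by (simp add: elog_def diff_divide_distrib)
        qed
        have "ereal (0 - (a + \<kappa>)) = liminf (\<lambda>n. ereal (ln c / real n - (a + \<kappa>)))"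
        proof (rule lim_imp_Liminf[symmetric])
          have "(\<lambda>n. ln c / real n - (a + \<kappa>)) \<longlonglongrightarrow> 0 - (a + \<kappa>)"
            by (intro tendsto_diff lim_const_over_n tendsto_const)
          then show "(\<lambda>n. ereal (ln c / real n - (a + \<kappa>))) \<longlonglongrightarrow> ereal (0 - (a + \<kappa>))" by (rule tendsto_ereal)
        qed simp
        also have "\<dots> \<le> liminf ?X"
        proof (rule Liminf_mono)
          show "\<forall>\<^sub>F n in sequentially. ereal (ln c / real n - (a + \<kappa>)) \<le> ?X n"
            unfolding eventually_sequentially using le by (intro exI[of _ "Suc n0"]) auto
        qed
        finally have "ereal (0 - (a + \<kappa>)) + ereal \<kappa> \<le> liminf ?X + ereal \<kappa>" by (rule add_right_mono)
        then show "- rate \<sigma> \<le> liminf ?X + ereal \<kappa>" using real by simp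
    qed
  qed (use rate_nonneg[of \<sigma>] in auto)
  have "- liminf ?X \<le> ?I"
    by (rule INF_greatest) (rule ereal_uminus_le_reorder[THEN iffD1, OF main])
  then show ?thesis by (rule ereal_uminus_le_reorder[THEN iffD1])
qed

lemma liminf_le_limsup:
  "liminf (\<lambda>n. INF \<mu> \<in> prob_measures. ereal (1 / real n) * elog (empirical_prob M \<eta> S n \<mu> B))
    \<le> limsup (\<lambda>n. SUP \<mu> \<in> prob_measures. ereal (1 / real n) * elog (empirical_prob M \<eta> S n \<mu> B))"
proof -
  have ne: "(prob_measures :: 'a measure set) \<noteq> {}" using transition_in_prob_measures by blast
  have "liminf (\<lambda>n. INF \<mu> \<in> prob_measures. ereal (1 / real n) * elog (empirical_prob M \<eta> S n \<mu> B))
    \<le> liminf (\<lambda>n. SUP \<mu> \<in> prob_measures. ereal (1 / real n) * elog (empirical_prob M \<eta> S n \<mu> B))"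
    by (intro Liminf_mono always_eventually allI INF_le_SUP ne)
  also have "\<dots> \<le> limsup (\<lambda>n. SUP \<mu> \<in> prob_measures. ereal (1 / real n) * elog (empirical_prob M \<eta> S n \<mu> B))"
    by (rule Liminf_le_Limsup) simp
  finally show ?thesis .
qed

end

section \<open>The large deviation principle\<close>

theorem theorem2p2:
  fixes S :: "'a::polish_space \<Rightarrow> 'e::polish_space \<Rightarrow> 'a"
    and M :: "'w measure"
    and \<eta> :: "nat \<Rightarrow> 'w \<Rightarrow> 'e"
    and Q :: "'b measure"
  assumes compact_X: "compact (UNIV :: 'a set)"
    and compact_E: "compact (UNIV :: 'e set)"
    and iid: "iid_sequence M \<eta>"
    and cont: "continuous_on UNIV (\<lambda>(x, \<zeta>). S x \<zeta>)"
    and lip: "\<exists>C>0. \<forall>x x' \<zeta>. dist (S x \<zeta>) (S x' \<zeta>) \<le> C * dist x x'"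
    and hyp_I: "uniformly_irreducible (transition M \<eta> S)"
    and hyp_C: "squeezing_coupling Q (transition M \<eta> S 1)"
  shows "\<exists>I :: 'a measure \<Rightarrow> ereal.
    good_rate_function weak_star_topology I \<and> convex_rate I \<and>
    (\<forall>B \<in> borel_sets_of weak_star_topology.
       - (INF \<sigma> \<in> weak_star_topology interior_of B. I \<sigma>)
         \<le> liminf (\<lambda>n. INF \<mu> \<in> prob_measures.
                ereal (1 / real n) * elog (empirical_prob M \<eta> S n \<mu> B)) \<and>
       liminf (\<lambda>n. INF \<mu> \<in> prob_measures.
                ereal (1 / real n) * elog (empirical_prob M \<eta> S n \<mu> B))
         \<le> limsup (\<lambda>n. SUP \<mu> \<in> prob_measures.
                ereal (1 / real n) * elog (empirical_prob M \<eta> S n \<mu> B)) \<and>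
       limsup (\<lambda>n. SUP \<mu> \<in> prob_measures.
                ereal (1 / real n) * elog (empirical_prob M \<eta> S n \<mu> B))
         \<le> - (INF \<sigma> \<in> weak_star_topology closure_of B. I \<sigma>))"
proof -
  interpret random_dynamical_system S M \<eta>
    using compact_X iid cont by unfold_locales
  obtain q C where "squeezing_kernel (transition M \<eta> S 1) q C"
    using squeezing_kernel_transition[OF hyp_I hyp_C] by (elim exE)
  then interpret squeezing_dynamics S M \<eta> q C
    by (intro squeezing_dynamics.intro random_dynamical_system_axioms)
  show ?thesis
  proof (rule exI[of _ rate], intro conjI ballI)
    show "good_rate_function weak_star_topology rate" by (rule good_rate_function_rate)
    show "convex_rate rate" by (rule convex_rate_rate)
  qed (erule liminf_lower_bound, rule liminf_le_limsup, erule limsup_upper_bound)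
qed

end
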